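(* Let $\lambda\in V_{\mathbb{C}}^*$. The space $E(\lambda)_{Q_k}^{W}$ is one-dimensional or zero-dimensional. It is one-dimensional if and only if $\lambda$ is a purely imaginary, regular solution of the Bethe ansatz equations $$e^{w\lambda(\varphi^\vee)}=\prod_{\alpha\in\Sigma_0^+}\left(\frac{w\lambda(\alpha^\vee)-k_\alpha}{w\lambda(\alpha^\vee)+k_\alpha}\right)^{\alpha(\varphi^\vee)}\qquad \forall\, w\in W_0.$$ If $E(\lambda)_{Q_k}^{W}$ is one-dimensional then $$\psi_\lambda^k(v)=\frac{1}{\#W_0}\sum_{w\in W_0}\widetilde{c}_k(w\lambda)e^{w\lambda(v)},\qquad \forall v\in V$$ is the unique function in $E(\lambda)_{Q_k}^{W}$ normalized by $\psi_\lambda^k(0)=1$.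
   Context: Root systems. Let $V$ be a Euclidean space of dimension $n$ and $V^*$ the dual Euclidean space, with norm $\|\cdot\|$ and inner product $\langle\cdot,\cdot\rangle$ on $V^*$. Let $\Sigma_0\subset V^*$ be a finite, irreducible, reduced crystallographic root system. The co-root $\alpha^\vee\in V$ of $\alpha\in\Sigma_0$ is determined by $\xi(\alpha^\vee)=2\langle\xi,\alpha\rangle/\|\alpha\|^2$ for all $\xi\in V^*$. Fix a basis $I_0=\{a_1,\ldots,a_n\}$ of $\Sigma_0$, with positive roots $\Sigma_0^+$ and highest root $\varphi$. The Weyl group $W_0$ is generated by the reflections $s_\alpha$ ($\alpha\in\Sigma_0$), acting on $V$ by $s_\alpha v=v-\alpha(v)\alpha^\vee$ and on $V^*$ by $s_\alpha\xi=\xi-\xi(\alpha^\vee)\alpha$. Let $V_{\mathbb{C}}^*=V^*\oplus iV^*$ be the complexification, with complex linear extension of the $W_0$-action and of evaluation. Affine root system. Affine linear functionals on $V$ are written as elements of $V^*\oplus\mathbb{R}$, and $D$ denotes the projection onto $V^*$ (the gradient). The affine root system is $\Sigma=\Sigma_0+\mathbb{Z}$, with basis $I=\{a_0=-\varphi+1,a_1,\ldots,a_n\}$. For $a\in\Sigma$ write $Da^\vee=(Da)^\vee$ and $s_a(v)=v-a(v)Da^\vee$ ($v\in V$). The affine Weyl group $W$ is generated by all $s_a$ ($a\in\Sigma$); it is a Coxeter group with Coxeter generators $s_a$ ($a\in I$). $W$ acts on $\Sigma$ by $(wa)(v)=a(w^{-1}v)$. Multiplicity function. $k:\Sigma\to\mathbb{R}_{>0}$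 is a fixed $W$-invariant function with $k(a)=k(Da)$ for all $a\in\Sigma$; write $k_a=k(a)$. The space $E(\lambda)$. Identify the symmetric algebra $S(V)$ with the polynomial functions on $V^*$; $p(\partial)$ is the constant coefficient differential operator obtained from $v\mapsto\partial_v$ (directional derivative). $S(V)_{\mathbb{C}}^{W_0}$ is the algebra of $W_0$-invariants in $S(V)_{\mathbb{C}}=\mathbb{C}\otimes S(V)$. $E(\lambda)$ is the space of complex-valued real analytic functions $f$ on $V$ with $p(\partial)f=p(\lambda)f$ for all $p\in S(V)_{\mathbb{C}}^{W_0}$. Integral-reflection operators. On the space $C(V)$ of complex-valued continuous functions on $V$ define, for $a\in\Sigma$, $$(Q_{k,a}f)(v)=f(s_av)+k_a\int_0^{a(v)}f(v-tDa^\vee)\,dt.$$ The assignment $s_a\mapsto Q_{k,a}$ ($a\in I$) extends uniquely to an action $w\mapsto Q_k(w)$ of $W$ on $C(V)$. $E(\lambda)_{Q_k}^W$ is the subspace of functions $f\in E(\lambda)$ with $Q_k(w)f=f$ for all $w\in W$. Spectral values. $\lambda\in V_{\mathbb{C}}^*$ is regular if $\lambda(\alpha^\vee)\neq0$ for all $\alpha\in\Sigma_0$, and purely imaginary if $\lambda\in iV^*$. The $c$-function is $\widetilde{c}_k(\lambda)=\prod_{\alpha\in\Sigma_0^+}\frac{\lambda(\alpha^\vee)+k_\alpha}{\lambda(\alpha^\vee)}$. *)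

theory Defs
  imports "HOL-Analysis.Analysis"
begin

section \<open>The dual Euclidean space\<close>

text \<open>
  The Euclidean space \<open>V\<close> is a type of class \<open>euclidean_space\<close>. Its dual is the type of bounded
  linear functionals, whose library norm (the operator norm) is the dual Euclidean norm; the library
  has no inner product on it, so it is defined through an orthonormal basis
  (see \<open>dual_inner_self\<close>).
\<close>

type_synonym 'a dual = "'a \<Rightarrow>\<^sub>L real"

definition dual_inner :: "'a::euclidean_space dual \<Rightarrow> 'a dual \<Rightarrow> real" where
  "dual_inner \<xi> \<eta> = (\<Sum>b\<in>Basis. \<xi> b * \<eta> b)"

definition coroot :: "'a::euclidean_space dual \<Rightarrow> 'a" where
  "coroot \<alpha> = (2 / (norm \<alpha>)\<^sup>2) *\<^sub>R (\<Sum>b\<in>Basis. \<alpha> b *\<^sub>R b)"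

lemma blinfun_eq_dual_inner:
  fixes \<xi> \<alpha> :: "'a::euclidean_space dual"
  shows "blinfun_apply \<xi> (\<Sum>b\<in>Basis. \<alpha> b *\<^sub>R b) = dual_inner \<xi> \<alpha>"
  by (simp add: dual_inner_def blinfun.sum_right blinfun.scaleR_right mult.commute)

lemma blinfun_eq_inner:
  fixes \<alpha> :: "'a::euclidean_space dual"
  shows "\<alpha> v = (\<Sum>b\<in>Basis. \<alpha> b *\<^sub>R b) \<bullet> v"
proof -
  have "blinfun_apply \<alpha> v = blinfun_apply \<alpha> (\<Sum>b\<in>Basis. (v \<bullet> b) *\<^sub>R b)"
    by (simp add: euclidean_representation)
  also have "\<dots> = (\<Sum>b\<in>Basis. \<alpha> b *\<^sub>R b) \<bullet> v"
    by (simp add: blinfun.sum_right blinfun.scaleR_right inner_sum_left mult.commute inner_commute[of v])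
  finally show ?thesis .
qed

lemma dual_inner_self: "dual_inner \<xi> \<xi> = (norm \<xi>)\<^sup>2"
proof -
  define u where "u = (\<Sum>b\<in>Basis. \<xi> b *\<^sub>R b)"
  have ap: "blinfun_apply \<xi> v = u \<bullet> v" for v
    unfolding u_def by (rule blinfun_eq_inner)
  have 1: "norm \<xi> \<le> norm u"
    by (rule norm_blinfun_bound) (auto simp: ap Cauchy_Schwarz_ineq2)
  have "norm u * norm u = norm (blinfun_apply \<xi> u)"
    by (simp add: ap dot_square_norm power2_eq_square)
  also have "\<dots> \<le> norm \<xi> * norm u"
    by (rule norm_blinfun)
  finally have 2: "norm u \<le> norm \<xi>"
    by (cases "norm u = 0") (auto simp: mult_le_cancel_right)
  have "dual_inner \<xi> \<xi> = blinfun_apply \<xi> u"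
    unfolding u_def by (simp add: blinfun_eq_dual_inner)
  also have "\<dots> = (norm u)\<^sup>2"
    by (simp add: ap dot_square_norm)
  finally show ?thesis
    using 1 2 by simp
qed

lemma coroot_characterization:
  fixes \<xi> \<alpha> :: "'a::euclidean_space dual"
  shows "blinfun_apply \<xi> (coroot \<alpha>) = 2 * dual_inner \<xi> \<alpha> / (norm \<alpha>)\<^sup>2"
  by (simp add: coroot_def blinfun.scaleR_right blinfun_eq_dual_inner)


section \<open>Root systems and Weyl groups\<close>

definition reflection :: "'a::euclidean_space dual \<Rightarrow> 'a \<Rightarrow> 'a" where
  "reflection \<alpha> v = v - \<alpha> v *\<^sub>R coroot \<alpha>"

definition dual_reflection :: "'a::euclidean_space dual \<Rightarrow> 'a dual \<Rightarrow> 'a dual" where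
  "dual_reflection \<alpha> \<xi> = \<xi> - \<xi> (coroot \<alpha>) *\<^sub>R \<alpha>"

definition root_system :: "'a::euclidean_space dual set \<Rightarrow> bool" where
  "root_system R \<longleftrightarrow>
     finite R \<and> 0 \<notin> R \<and> span R = UNIV \<and>
     (\<forall>\<alpha>\<in>R. dual_reflection \<alpha> ` R = R) \<and>
     (\<forall>\<alpha>\<in>R. \<forall>\<beta>\<in>R. \<beta> (coroot \<alpha>) \<in> \<int>)"

definition reduced_roots :: "'a::euclidean_space dual set \<Rightarrow> bool" where
  "reduced_roots R \<longleftrightarrow> (\<forall>\<alpha>\<in>R. \<forall>c::real. c *\<^sub>R \<alpha> \<in> R \<longrightarrow> c = 1 \<or> c = -1)"

definition irreducible_roots :: "'a::euclidean_space dual set \<Rightarrow> bool" where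
  "irreducible_roots R \<longleftrightarrow>
     R \<noteq> {} \<and>
     \<not> (\<exists>A B. A \<noteq> {} \<and> B \<noteq> {} \<and> A \<inter> B = {} \<and> A \<union> B = R \<and>
            (\<forall>\<alpha>\<in>A. \<forall>\<beta>\<in>B. dual_inner \<alpha> \<beta> = 0))"

definition nonneg_comb :: "'a::euclidean_space dual set \<Rightarrow> 'a dual \<Rightarrow> bool" where
  "nonneg_comb B \<xi> \<longleftrightarrow> (\<exists>c :: 'a dual \<Rightarrow> nat. \<xi> = (\<Sum>\<beta>\<in>B. real (c \<beta>) *\<^sub>R \<beta>))"

definition root_basis :: "'a::euclidean_space dual set \<Rightarrow> 'a dual set \<Rightarrow> bool" where
  "root_basis R B \<longleftrightarrow>
     B \<subseteq> R \<and> independent B \<and> (\<forall>\<alpha>\<in>R. nonneg_comb B \<alpha> \<or> nonneg_comb B (- \<alpha>))"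

definition positive_roots :: "'a::euclidean_space dual set \<Rightarrow> 'a dual set \<Rightarrow> 'a dual set" where
  "positive_roots R B = {\<alpha>\<in>R. nonneg_comb B \<alpha>}"

definition highest_root :: "'a::euclidean_space dual set \<Rightarrow> 'a dual set \<Rightarrow> 'a dual \<Rightarrow> bool" where
  "highest_root R B \<phi> \<longleftrightarrow> \<phi> \<in> R \<and> (\<forall>\<alpha>\<in>R. nonneg_comb B (\<phi> - \<alpha>))"

inductive_set transformation_group :: "('a \<Rightarrow> 'a) set \<Rightarrow> ('a \<Rightarrow> 'a) set"
  for S :: "('a \<Rightarrow> 'a) set" where
  generator: "s \<in> S \<Longrightarrow> s \<in> transformation_group S"
| identity: "id \<in> transformation_group S"
| product: "u \<in> transformation_group S \<Longrightarrow> w \<in> transformation_group S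
     \<Longrightarrow> u \<circ> w \<in> transformation_group S"
| inverse: "w \<in> transformation_group S \<Longrightarrow> inv w \<in> transformation_group S"

definition weyl_group :: "'a::euclidean_space dual set \<Rightarrow> ('a \<Rightarrow> 'a) set" where
  "weyl_group R = transformation_group (reflection ` R)"

text \<open>
  The complexification \<open>V\<^sup>* \<oplus> iV\<^sup>*\<close> is realised as the space of real-linear maps from \<open>V\<close> to the
  complex numbers, on which evaluation at \<open>v \<in> V\<close> is the complex linear extension of evaluation on
  \<open>V\<^sup>*\<close>. The action of \<open>w\<close> on \<open>V\<^sup>*\<close> generated by the \<open>dual_reflection\<close> is contragredient to the one on
  \<open>V\<close>, i.e. \<open>(w\<xi>)(v) = \<xi>(w\<inverse> v)\<close>; this formula also describes its complex linear extension.
\<close>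

definition complex_dual :: "('a::euclidean_space \<Rightarrow> complex) set" where
  "complex_dual = {l. linear l}"

definition complexify :: "'a::euclidean_space dual \<Rightarrow> 'a \<Rightarrow> complex" where
  "complexify \<xi> = (\<lambda>v. complex_of_real (\<xi> v))"

definition weyl_act :: "('a \<Rightarrow> 'a) \<Rightarrow> ('a \<Rightarrow> complex) \<Rightarrow> 'a \<Rightarrow> complex" where
  "weyl_act w \<Lambda> = (\<lambda>v. \<Lambda> (inv w v))"

lemma reflection_reflection: "reflection \<alpha> (reflection \<alpha> v) = v"
proof (cases "\<alpha> = 0")
  case True
  then show ?thesis by (simp add: reflection_def)
next
  case False
  then have "blinfun_apply \<alpha> (coroot \<alpha>) = 2"
    by (simp add: coroot_characterization dual_inner_self)
  then show ?thesis
    by (simp add: reflection_def blinfun.diff_right blinfun.scaleR_right algebra_simps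
        flip: scaleR_left.add)
qed

lemma weyl_act_reflection: "weyl_act (reflection \<alpha>) (complexify \<xi>) = complexify (dual_reflection \<alpha> \<xi>)"
proof -
  have "inv (reflection \<alpha>) = reflection \<alpha>"
    by (rule inv_unique_comp) (auto simp: fun_eq_iff reflection_reflection)
  then show ?thesis
    by (auto simp: weyl_act_def complexify_def fun_eq_iff reflection_def dual_reflection_def
        blinfun.diff_right blinfun.scaleR_right blinfun.diff_left blinfun.scaleR_left)
qed


section \<open>The affine root system\<close>

text \<open>
  Affine linear functionals are elements \<open>(\<xi>, r)\<close> of \<open>V\<^sup>* \<oplus> \<real>\<close>, acting by \<open>v \<mapsto> \<xi>(v) + r\<close>;
  the gradient is \<open>fst\<close>.
\<close>

definition aff_eval :: "'a::euclidean_space dual \<times> real \<Rightarrow> 'a \<Rightarrow> real" where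
  "aff_eval a v = (fst a) v + snd a"

definition affine_roots :: "'a::euclidean_space dual set \<Rightarrow> ('a dual \<times> real) set" where
  "affine_roots R = R \<times> \<int>"

definition affine_basis :: "'a::euclidean_space dual set \<Rightarrow> 'a dual \<Rightarrow> ('a dual \<times> real) set" where
  "affine_basis B \<phi> = insert (- \<phi>, 1) ((\<lambda>\<alpha>. (\<alpha>, 0)) ` B)"

definition aff_reflection :: "'a::euclidean_space dual \<times> real \<Rightarrow> 'a \<Rightarrow> 'a" where
  "aff_reflection a v = v - aff_eval a v *\<^sub>R coroot (fst a)"

definition affine_weyl_group :: "'a::euclidean_space dual set \<Rightarrow> ('a \<Rightarrow> 'a) set" where
  "affine_weyl_group R = transformation_group (aff_reflection ` affine_roots R)"

text \<open>In the invariance clause, \<open>b\<close> is the affine root \<open>wa\<close>.\<close>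

definition multiplicity_function ::
    "'a::euclidean_space dual set \<Rightarrow> ('a dual \<times> real \<Rightarrow> real) \<Rightarrow> bool" where
  "multiplicity_function R k \<longleftrightarrow>
     (\<forall>a\<in>affine_roots R. k a > 0) \<and>
     (\<forall>w\<in>affine_weyl_group R. \<forall>a\<in>affine_roots R. \<forall>b\<in>affine_roots R.
        (\<forall>v. aff_eval b v = aff_eval a (inv w v)) \<longrightarrow> k b = k a) \<and>
     (\<forall>a\<in>affine_roots R. k a = k (fst a, 0))"


section \<open>The space of solutions of the invariant differential equations\<close>

text \<open>
  An element \<open>\<Sum>\<^sub>j c\<^sub>j v\<^sub>j\<^sub>1 \<cdots> v\<^sub>j\<^sub>r\<close> of the complexified symmetric algebra of \<open>V\<close> is represented by the
  list of its terms \<open>(c\<^sub>j, [v\<^sub>j\<^sub>1, \<dots>, v\<^sub>j\<^sub>r])\<close>. Representatives are not unique, but two of them denote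
  the same element iff they have the same values \<open>sym_eval\<close> as polynomial functions on \<open>V\<^sup>*\<close>, and
  all of the notions below depend only on the element (for \<open>sym_diff\<close>: when applied to smooth
  functions).
\<close>

type_synonym 'a sym = "(complex \<times> 'a list) list"

definition sym_eval :: "'a sym \<Rightarrow> ('a \<Rightarrow> complex) \<Rightarrow> complex" where
  "sym_eval p \<Lambda> = sum_list (map (\<lambda>(c, vs). c * prod_list (map \<Lambda> vs)) p)"

definition dir_deriv :: "'a::euclidean_space \<Rightarrow> ('a \<Rightarrow> complex) \<Rightarrow> 'a \<Rightarrow> complex" where
  "dir_deriv v f x = vector_derivative (\<lambda>t. f (x + t *\<^sub>R v)) (at 0)"

definition sym_diff :: "'a::euclidean_space sym \<Rightarrow> ('a \<Rightarrow> complex) \<Rightarrow> 'a \<Rightarrow> complex" where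
  "sym_diff p f x = sum_list (map (\<lambda>(c, vs). c * foldr dir_deriv vs f x) p)"

definition sym_invariant :: "'a::euclidean_space dual set \<Rightarrow> 'a sym \<Rightarrow> bool" where
  "sym_invariant R p \<longleftrightarrow>
     (\<forall>w\<in>weyl_group R. \<forall>\<xi>. sym_eval p (weyl_act w (complexify \<xi>)) = sym_eval p (complexify \<xi>))"

text \<open>Local expansion in a multivariate power series; the functions \<open>m\<close> are the multi-indices.\<close>

definition real_analytic :: "('a::euclidean_space \<Rightarrow> complex) \<Rightarrow> bool" where
  "real_analytic f \<longleftrightarrow>
     (\<forall>x. \<exists>r>0. \<exists>c :: ('a \<Rightarrow> nat) \<Rightarrow> complex. \<forall>h. norm h < r \<longrightarrow>
        ((\<lambda>m. c m * complex_of_real (\<Prod>b\<in>Basis. (h \<bullet> b) ^ m b)) has_sum f (x + h))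
          (Basis \<rightarrow>\<^sub>E UNIV))"

definition E_space ::
    "'a::euclidean_space dual set \<Rightarrow> ('a \<Rightarrow> complex) \<Rightarrow> ('a \<Rightarrow> complex) set" where
  "E_space R \<Lambda> =
     {f. real_analytic f \<and>
         (\<forall>p. sym_invariant R p \<longrightarrow> (\<forall>x. sym_diff p f x = sym_eval p \<Lambda> * f x))}"


section \<open>Integral-reflection operators\<close>

text \<open>The library's interval integral is oriented, as needed when \<open>a(v) < 0\<close>.\<close>

definition integral_reflection ::
    "('a::euclidean_space dual \<times> real \<Rightarrow> real) \<Rightarrow> 'a dual \<times> real
       \<Rightarrow> ('a \<Rightarrow> complex) \<Rightarrow> 'a \<Rightarrow> complex" where
  "integral_reflection k a f v =
     f (aff_reflection a v) +
     complex_of_real (k a) *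
       (LBINT t=ereal 0..ereal (aff_eval a v). f (v - t *\<^sub>R coroot (fst a)))"

definition C_space :: "('a::euclidean_space \<Rightarrow> complex) set" where
  "C_space = {f. continuous_on UNIV f}"

text \<open>
  \<open>integral_reflection_action R B \<phi> k Q\<close> says that \<open>Q\<close> is the action of the affine Weyl group on
  the continuous functions which extends the assignment of the integral-reflection operators to the
  simple reflections. Since the latter generate the group, \<open>Q\<close> is uniquely determined on
  \<open>affine_weyl_group R\<close> and \<open>C_space\<close>; its values elsewhere are irrelevant.
\<close>

definition integral_reflection_action ::
    "'a::euclidean_space dual set \<Rightarrow> 'a dual set \<Rightarrow> 'a dual \<Rightarrow> ('a dual \<times> real \<Rightarrow> real)
       \<Rightarrow> (('a \<Rightarrow> 'a) \<Rightarrow> ('a \<Rightarrow> complex) \<Rightarrow> 'a \<Rightarrow> complex) \<Rightarrow> bool" where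
  "integral_reflection_action R B \<phi> k Q \<longleftrightarrow>
     (\<forall>w\<in>affine_weyl_group R. \<forall>f\<in>C_space. Q w f \<in> C_space) \<and>
     (\<forall>f\<in>C_space. Q id f = f) \<and>
     (\<forall>u\<in>affine_weyl_group R. \<forall>w\<in>affine_weyl_group R. \<forall>f\<in>C_space. Q (u \<circ> w) f = Q u (Q w f)) \<and>
     (\<forall>a\<in>affine_basis B \<phi>. \<forall>f\<in>C_space. Q (aff_reflection a) f = integral_reflection k a f)"

definition E_invariants ::
    "'a::euclidean_space dual set \<Rightarrow> (('a \<Rightarrow> 'a) \<Rightarrow> ('a \<Rightarrow> complex) \<Rightarrow> 'a \<Rightarrow> complex)
       \<Rightarrow> ('a \<Rightarrow> complex) \<Rightarrow> ('a \<Rightarrow> complex) set" where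
  "E_invariants R Q \<Lambda> = {f\<in>E_space R \<Lambda>. \<forall>w\<in>affine_weyl_group R. Q w f = f}"

definition zero_dimensional :: "('a \<Rightarrow> complex) set \<Rightarrow> bool" where
  "zero_dimensional S \<longleftrightarrow> S = {\<lambda>v. 0}"

definition one_dimensional :: "('a \<Rightarrow> complex) set \<Rightarrow> bool" where
  "one_dimensional S \<longleftrightarrow> (\<exists>f. f \<noteq> (\<lambda>v. 0) \<and> S = {(\<lambda>v. c * f v) |c. True})"


section \<open>Spectral values\<close>

definition regular_value :: "'a::euclidean_space dual set \<Rightarrow> ('a \<Rightarrow> complex) \<Rightarrow> bool" where
  "regular_value R \<Lambda> \<longleftrightarrow> (\<forall>\<alpha>\<in>R. \<Lambda> (coroot \<alpha>) \<noteq> 0)"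

definition purely_imaginary :: "('a::euclidean_space \<Rightarrow> complex) \<Rightarrow> bool" where
  "purely_imaginary \<Lambda> \<longleftrightarrow> (\<exists>\<xi> :: 'a dual. \<Lambda> = (\<lambda>v. \<i> * complexify \<xi> v))"

definition c_function ::
    "'a::euclidean_space dual set \<Rightarrow> 'a dual set \<Rightarrow> ('a dual \<times> real \<Rightarrow> real)
       \<Rightarrow> ('a \<Rightarrow> complex) \<Rightarrow> complex" where
  "c_function R B k \<Lambda> =
     (\<Prod>\<alpha>\<in>positive_roots R B. (\<Lambda> (coroot \<alpha>) + complex_of_real (k (\<alpha>, 0))) / \<Lambda> (coroot \<alpha>))"

text \<open>
  The exponents \<open>\<alpha>(\<phi>\<^sup>\<or>)\<close> are integers because the root system is crystallographic, so the floor
  only changes their type.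
\<close>

definition bethe_equations ::
    "'a::euclidean_space dual set \<Rightarrow> 'a dual set \<Rightarrow> 'a dual \<Rightarrow> ('a dual \<times> real \<Rightarrow> real)
       \<Rightarrow> ('a \<Rightarrow> complex) \<Rightarrow> bool" where
  "bethe_equations R B \<phi> k \<Lambda> \<longleftrightarrow>
     (\<forall>w\<in>weyl_group R.
        exp (weyl_act w \<Lambda> (coroot \<phi>)) =
        (\<Prod>\<alpha>\<in>positive_roots R B.
           ((weyl_act w \<Lambda> (coroot \<alpha>) - complex_of_real (k (\<alpha>, 0))) /
            (weyl_act w \<Lambda> (coroot \<alpha>) + complex_of_real (k (\<alpha>, 0))))
           powi \<lfloor>blinfun_apply \<alpha> (coroot \<phi>)\<rfloor>))"

definition bethe_eigenfunction ::
    "'a::euclidean_space dual set \<Rightarrow> 'a dual set \<Rightarrow> ('a dual \<times> real \<Rightarrow> real)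
       \<Rightarrow> ('a \<Rightarrow> complex) \<Rightarrow> 'a \<Rightarrow> complex" where
  "bethe_eigenfunction R B k \<Lambda> v =
     (1 / of_nat (card (weyl_group R))) *
     (\<Sum>w\<in>weyl_group R. c_function R B k (weyl_act w \<Lambda>) * exp (weyl_act w \<Lambda> v))"

end

theory Submission
  imports Defs "HOL-Computational_Algebra.Polynomial" "HOL-Library.Function_Algebras"
begin

text \<open>
  On a line in the direction \<open>\<alpha>\<^sup>\<or>\<close> the equation \<open>Q\<^sub>a f = f\<close> says that \<open>(\<partial> - k) f\<close> is antisymmetric
  under \<open>s\<^sub>a\<close>, that is, \<open>(\<partial> - k) f = (\<partial> + k) (f \<circ> s\<^sub>a)\<close>. In terms of the tuple \<open>(f \<circ> w)\<close> indexed by the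
  finite Weyl group these equations have constant coefficients, so that derivatives of a solution are
  solutions, and the invariant differential equations make the space of solutions a sum of joint
  generalized eigenspaces of the \<open>\<partial>\<^sub>v\<close>. Two maximum principles control it. For an eigentuple
  \<open>c\<^sub>w e\<^sup>\<mu>\<close>, an index \<open>w\<close> at which \<open>|c\<^sub>w|\<close> is maximal makes \<open>w Re \<mu>\<close> dominant but nonpositive on
  \<open>\<phi>\<^sup>\<or>\<close>, hence \<open>Re \<mu> = 0\<close>. For a generalized eigentuple \<open>e\<^sup>\<mu> (a\<^sub>w + l\<^sub>w)\<close> of rank two with \<open>\<mu>\<close>
  imaginary, the same argument applied to \<open>Re (a\<^sub>w / l\<^sub>w)\<close> makes the linear part vanish. So a nonzero
  \<open>f\<close> is a combination of the \<open>e\<^sup>\<mu>\<close> with \<open>\<mu>\<close> in the orbit of an imaginary \<open>\<lambda>\<close>; comparing coefficients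
  gives regularity, the \<open>c\<close>-function and the Bethe ansatz equations. The normalization
  \<open>\<psi>(0) = 1\<close> is obtained along a generic complex line through \<open>\<lambda>\<close>, where it is an identity between
  polynomials in one variable.
\<close>

section \<open>Differentiation of multivariate power series\<close>

text \<open>\<lambda> is not assumed regular, so E(\<lambda>) may contain polynomials times
  exponentials. They can be excluded only by the reflection equations, which is why generalized
  eigentuples have to be faced. Applying the operators \<partial>_b - c_b to one that is not an
  eigentuple ends at one of rank two, so that this case is enough. The differential equations enter
  through the invariants \<Prod>(z - w v), w in W: a Cayley-Hamilton argument in z turns them into
  \<Prod>(\<partial>_v - \<lambda>(w v)) f = 0. The affine simple reflection is s_\<phi> combined
  with a translation, and its gradient is - \<phi>, which interchanges k and - k in its equation. A
  maximal index therefore gives an inequality at \<phi> opposite to those at the simple roots, and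
  the two kinds are incompatible unless the functional vanishes, because \<phi> - \<alpha> is a
  nonnegative combination of simple roots for every root \<alpha>. In rank two the shift of a_w /
  l_w is governed by the logarithmic derivative of (m - k) / (m + k), which is real with fixed sign
  for imaginary m; for the affine reflection the translation adds 1 with the favourable
  sign.\<close>

lemma has_derivative_has_sum:
  fixes f :: "'i \<Rightarrow> 'a::real_normed_vector \<Rightarrow> complex"
  assumes M: "countable M" "infinite M" and S: "open S" "convex S"
    and deriv: "\<And>m x. m \<in> M \<Longrightarrow> x \<in> S \<Longrightarrow> (f m has_derivative f' m x) (at x)"
    and bound: "\<And>m x h. m \<in> M \<Longrightarrow> x \<in> S \<Longrightarrow> norm (f' m x h) \<le> K m * norm h"
    and K: "K summable_on M"
    and F: "\<And>x. x \<in> S \<Longrightarrow> ((\<lambda>m. f m x) has_sum F x) M"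
    and x: "x \<in> S"
  shows "(F has_derivative (\<lambda>h. infsum (\<lambda>m. f' m x h) M)) (at x)"
    and "\<And>h. ((\<lambda>m. f' m x h) has_sum infsum (\<lambda>m. f' m x h) M) M"
proof -
  have sm: "((\<lambda>m. f' m y h) has_sum infsum (\<lambda>m. f' m y h) M) M" if "y \<in> S" for y h
  proof -
    have "(\<lambda>m. norm (f' m y h)) summable_on M"
      by (rule Infinite_Sum.abs_summable_on_comparison_test'[where g = "\<lambda>m. K m * norm h"])
        (rule summable_on_cmult_left[OF K], rule bound[OF _ that])
    then show ?thesis
      by (rule has_sum_infsum[OF abs_summable_summable])
  qed
  show "((\<lambda>m. f' m x h) has_sum infsum (\<lambda>m. f' m x h) M) M" for h
    by (rule sm[OF x])
  \<comment> \<open>An enumeration turns the unordered sum into a series, so that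
    \<open>has_derivative_series\<close> applies.\<close>
  define e where "e = from_nat_into M"
  have e: "bij_betw e UNIV M"
    unfolding e_def using M by (rule bij_betw_from_nat_into)
  have eM: "e n \<in> M" for n using e by (auto simp: bij_betw_def)
  have e_sums: "(\<lambda>n. g (e n)) sums s" if "(g has_sum s) M" for g :: "'i \<Rightarrow> complex" and s
    using has_sum_reindex_bij_betw[OF e, of g s] that by (auto intro: has_sum_imp_sums)
  have Ke: "(\<lambda>n. K (e n)) summable_on UNIV"
    using summable_on_reindex_bij_betw[OF e, of K] K by simp
  have Kn: "0 \<le> K m * norm h" if "m \<in> M" for m and h :: 'a
    using bound[OF that x, of h] norm_ge_zero by (rule order_trans[rotated])
  have Ks: "summable (\<lambda>n. K (e n))" by (rule summable_on_imp_summable[OF Ke])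
  define g' where "g' y h = infsum (\<lambda>m. f' m y h) M" for y h
  \<comment> \<open>Uniformity in x and h: the remainder after n terms is dominated by the tail of
    the sum of K, whatever the point of S.\<close>
  have ev: "\<forall>\<^sub>F n in sequentially. \<forall>x\<in>S. \<forall>h. norm (sum (\<lambda>i. f' (e i) x h) {..<n} - g' x h) \<le> \<epsilon> * norm h"
    if "\<epsilon> > 0" for \<epsilon>
  proof -
    have "(\<lambda>n. \<Sum>i. K (e (i + n))) \<longlonglongrightarrow> 0"
      using Ks by (rule suminf_exist_split2)
    then have "\<forall>\<^sub>F n in sequentially. (\<Sum>i. K (e (i + n))) < \<epsilon>"
      using that by (auto dest: order_tendstoD)
    then show ?thesis
    proof eventually_elim
      case (elim n)
      show ?case
      proof (intro ballI allI)
        fix y h assume y: "y \<in> S"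
        have s: "(\<lambda>i. f' (e i) y h) sums g' y h"
          unfolding g'_def by (rule e_sums[OF sm[OF y]])
        have "g' y h - sum (\<lambda>i. f' (e i) y h) {..<n} = (\<Sum>i. f' (e (i + n)) y h)"
          using suminf_minus_initial_segment[OF sums_summable[OF s], of n] sums_unique[OF s] by simp
        moreover have "norm (\<Sum>i. f' (e (i + n)) y h) \<le> (\<Sum>i. K (e (i + n)) * norm h)"
        proof (rule norm_suminf_le)
          show "norm (f' (e (i + n)) y h) \<le> K (e (i + n)) * norm h" for i
            by (rule bound[OF eM y])
          show "summable (\<lambda>i. K (e (i + n)) * norm h)"
            by (intro summable_mult2 summable_ignore_initial_segment Ks)
        qed
        moreover have "(\<Sum>i. K (e (i + n)) * norm h) = (\<Sum>i. K (e (i + n))) * norm h"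
          by (intro suminf_mult2[symmetric] summable_ignore_initial_segment Ks)
        moreover have "(\<Sum>i. K (e (i + n))) * norm h \<le> \<epsilon> * norm h"
          using elim by (intro mult_right_mono) auto
        ultimately have "norm (g' y h - sum (\<lambda>i. f' (e i) y h) {..<n}) \<le> \<epsilon> * norm h"
          by (metis (no_types, lifting) order_trans)
        then show "norm (sum (\<lambda>i. f' (e i) y h) {..<n} - g' y h) \<le> \<epsilon> * norm h"
          by (subst norm_minus_commute)
      qed
    qed
  qed
  have "\<exists>g. \<forall>x\<in>S. (\<lambda>n. f (e n) x) sums (g x) \<and> (g has_derivative g' x) (at x within S)"
    by (rule has_derivative_series[OF S(2) has_derivative_at_withinI[OF deriv[OF eM]] ev x e_sums[OF F[OF x]]])
  then obtain g where g: "\<And>x. x \<in> S \<Longrightarrow> (\<lambda>n. f (e n) x) sums (g x)"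
    "\<And>x. x \<in> S \<Longrightarrow> (g has_derivative g' x) (at x within S)" by blast
  have gF: "g y = F y" if "y \<in> S" for y
    using g(1)[OF that] e_sums[OF F[OF that]] by (rule sums_unique2)
  have "(g has_derivative g' x) (at x)"
    using g(2)[OF x] at_within_open[OF x S(1)] by simp
  then have "(F has_derivative g' x) (at x)"
    by (rule has_derivative_transform_within_open[OF _ S(1) x gF])
  then show "(F has_derivative (\<lambda>h. infsum (\<lambda>m. f' m x h) M)) (at x)"
    by (simp add: g'_def[abs_def])
qed

section \<open>Power series with absolutely summable coefficients\<close>

definition multi_indices :: "('a::euclidean_space \<Rightarrow> nat) set" where
  "multi_indices = Basis \<rightarrow>\<^sub>E UNIV"

definition weight :: "('a::euclidean_space \<Rightarrow> nat) \<Rightarrow> nat" where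
  "weight m = (\<Sum>b\<in>Basis. m b)"

definition monomial :: "('a::euclidean_space \<Rightarrow> nat) \<Rightarrow> 'a \<Rightarrow> real" where
  "monomial m h = (\<Prod>b\<in>Basis. (h \<bullet> b) ^ m b)"

lemma countable_multi_indices: "countable (multi_indices :: ('a::euclidean_space \<Rightarrow> nat) set)"
  unfolding multi_indices_def by (intro countable_PiE) auto

lemma infinite_multi_indices: "infinite (multi_indices :: ('a::euclidean_space \<Rightarrow> nat) set)"
proof
  assume "finite (multi_indices :: ('a \<Rightarrow> nat) set)"
  moreover have "inj (\<lambda>n::nat. \<lambda>b\<in>(Basis::'a set). n)"
  proof (rule injI)
    fix n n' :: nat assume eq: "(\<lambda>b\<in>(Basis::'a set). n) = (\<lambda>b\<in>Basis. n')"
    obtain b :: 'a where "b \<in> Basis" using nonempty_Basis by blast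
    then show "n = n'" using fun_cong[OF eq, of b] by simp
  qed
  moreover have "range (\<lambda>n::nat. \<lambda>b\<in>(Basis::'a set). n) \<subseteq> multi_indices"
    by (auto simp: multi_indices_def)
  ultimately show False
    by (meson finite_subset infinite_UNIV_nat finite_imageD)
qed

text \<open>\<open>real_analytic\<close> asks only for convergence on a ball. Summability of the
  coefficients against powers of \<rho> is recorded in addition, because it is the majorant that
  termwise differentiation needs.\<close>

definition expands :: "('a::euclidean_space \<Rightarrow> complex) \<Rightarrow> 'a \<Rightarrow> real \<Rightarrow> (('a \<Rightarrow> nat) \<Rightarrow> complex) \<Rightarrow> bool" where
  "expands f x \<rho> c \<longleftrightarrow> 0 < \<rho> \<and> (\<lambda>m. norm (c m) * \<rho> ^ weight m) summable_on multi_indices \<and>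
     (\<forall>h. norm h < \<rho> \<longrightarrow> ((\<lambda>m. c m * complex_of_real (monomial m h)) has_sum f (x + h)) multi_indices)"

lemma abs_monomial_le:
  assumes "norm h \<le> \<rho>"
  shows "\<bar>monomial m h\<bar> \<le> \<rho> ^ weight m"
proof -
  have "\<bar>monomial m h\<bar> = (\<Prod>b\<in>Basis. \<bar>h \<bullet> b\<bar> ^ m b)"
    by (simp add: monomial_def abs_prod power_abs)
  also have "\<dots> \<le> (\<Prod>b\<in>Basis. \<rho> ^ m b)"
    by (intro prod_mono conjI power_mono) (auto intro: order_trans[OF Basis_le_norm assms])
  also have "\<dots> = \<rho> ^ weight m"
    by (simp add: weight_def power_sum)
  finally show ?thesis .
qed

text \<open>Convergence at one point with all coordinates equal to \<rho> already makes the
  coefficients summable against powers of \<rho>; the only price is a smaller radius.\<close>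

lemma real_analytic_iff_expands:
  fixes f :: "'a::euclidean_space \<Rightarrow> complex"
  shows "real_analytic f \<longleftrightarrow> (\<forall>x. \<exists>\<rho> c. expands f x \<rho> c)"
proof
  assume "\<forall>x. \<exists>\<rho> c. expands f x \<rho> c"
  then show "real_analytic f"
    unfolding real_analytic_def expands_def multi_indices_def monomial_def by fast
next
  assume f: "real_analytic f"
  show "\<forall>x. \<exists>\<rho> c. expands f x \<rho> c"
  proof
    fix x
    from f obtain r c where r: "r > 0" and c: "\<And>h. norm h < r \<Longrightarrow>
        ((\<lambda>m. c m * complex_of_real (monomial m h)) has_sum f (x + h)) multi_indices"
      unfolding real_analytic_def monomial_def multi_indices_def by metis
    \<comment> \<open>The point with all coordinates \<rho> then has norm at most r / 2 and lies in
      the ball of convergence.\<close>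
    define \<rho> where "\<rho> = r / (2 * DIM('a))"
    have \<rho>: "0 < \<rho>" "\<rho> < r"
    proof -
      show "0 < \<rho>" using r by (simp add: \<rho>_def)
      have "1 \<le> real DIM('a)" using DIM_positive[where 'a='a] by linarith
      then have "1 < 2 * real DIM('a)" by linarith
      then have "r * 1 < r * (2 * real DIM('a))" using r by (rule mult_strict_left_mono)
      then show "\<rho> < r" unfolding \<rho>_def using \<open>1 \<le> real DIM('a)\<close> by (simp only: pos_divide_less_eq mult_1_right)
    qed
    define H :: 'a where "H = (\<Sum>b\<in>Basis. \<rho> *\<^sub>R b)"
    have "norm H \<le> (\<Sum>b\<in>(Basis::'a set). \<rho>)"
      unfolding H_def using \<rho> by (intro order_trans[OF norm_sum] sum_mono) auto
    also have "\<dots> < r" using r by (simp add: \<rho>_def)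
    finally have H: "norm H < r" .
    have mono: "monomial m H = \<rho> ^ weight m" for m
    proof -
      have "H \<bullet> b = \<rho>" if "b \<in> Basis" for b
        using that by (simp add: H_def inner_sum_left inner_Basis if_distrib cong: if_cong)
      then show ?thesis by (simp add: monomial_def weight_def power_sum)
    qed
    have "(\<lambda>m. c m * complex_of_real (\<rho> ^ weight m)) summable_on multi_indices"
      using c[OF H] unfolding mono summable_on_def by blast
    \<comment> \<open>Unconditional summability of complex numbers is absolute summability.\<close>
    then have "(\<lambda>m. norm (c m * complex_of_real (\<rho> ^ weight m))) summable_on multi_indices"
      by (simp only: summable_on_iff_abs_summable_on_complex)
    then have "(\<lambda>m. norm (c m) * \<rho> ^ weight m) summable_on multi_indices"
      using \<rho> by (simp add: norm_mult norm_power)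
    then have "expands f x \<rho> c"
      unfolding expands_def using \<rho> c by auto
    then show "\<exists>\<rho> c. expands f x \<rho> c" by blast
  qed
qed

lemma expands_mono:
  assumes "expands f x \<rho> c" "0 < \<rho>'" "\<rho>' \<le> \<rho>"
  shows "expands f x \<rho>' c"
proof -
  have "(\<lambda>m. norm (c m) * \<rho>' ^ weight m) summable_on multi_indices"
    by (rule summable_on_comparison_test[where f = "\<lambda>m. norm (c m) * \<rho> ^ weight m"])
      (use assms in \<open>auto simp: expands_def intro!: mult_left_mono power_mono\<close>)
  then show ?thesis using assms by (auto simp: expands_def)
qed

lemma real_analytic_add:
  assumes "real_analytic f" "real_analytic g"
  shows "real_analytic (\<lambda>x. f x + g x)"
  unfolding real_analytic_iff_expands
proof
  fix x
  from assms obtain \<rho>1 c1 \<rho>2 c2 where "expands f x \<rho>1 c1" "expands g x \<rho>2 c2"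
    unfolding real_analytic_iff_expands by metis
  note exp = this
  have "0 < min \<rho>1 \<rho>2" using exp by (simp add: expands_def)
  then have e: "expands f x (min \<rho>1 \<rho>2) c1" "expands g x (min \<rho>1 \<rho>2) c2"
    using expands_mono[OF exp(1)] expands_mono[OF exp(2)] by simp_all
  let ?\<rho> = "min \<rho>1 \<rho>2"
  have pos: "0 < ?\<rho>" using e by (simp add: expands_def)
  have "(\<lambda>m. norm (c1 m + c2 m) * ?\<rho> ^ weight m) summable_on multi_indices"
  proof (rule summable_on_comparison_test)
    show "(\<lambda>m. norm (c1 m) * ?\<rho> ^ weight m + norm (c2 m) * ?\<rho> ^ weight m) summable_on multi_indices"
      using e by (intro summable_on_add) (auto simp: expands_def)
    show "norm (c1 m + c2 m) * ?\<rho> ^ weight m \<le> norm (c1 m) * ?\<rho> ^ weight m + norm (c2 m) * ?\<rho> ^ weight m" for m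
      unfolding distrib_right[symmetric] using pos by (intro mult_right_mono norm_triangle_ineq) auto
    show "0 \<le> norm (c1 m + c2 m) * ?\<rho> ^ weight m" for m using pos by simp
  qed
  then have "expands (\<lambda>x. f x + g x) x ?\<rho> (\<lambda>m. c1 m + c2 m)"
    using e unfolding expands_def distrib_right by (auto intro!: has_sum_add)
  then show "\<exists>\<rho> c. expands (\<lambda>x. f x + g x) x \<rho> c" by blast
qed

lemma real_analytic_cmult:
  assumes "real_analytic f"
  shows "real_analytic (\<lambda>x. a * f x)"
  unfolding real_analytic_def
proof
  fix x
  from assms obtain r c where "r > 0" and c: "\<And>h. norm h < r \<Longrightarrow>
      ((\<lambda>m. c m * complex_of_real (\<Prod>b\<in>Basis. (h \<bullet> b) ^ m b)) has_sum f (x + h)) (Basis \<rightarrow>\<^sub>E UNIV)"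
    unfolding real_analytic_def by metis
  have "((\<lambda>m. (a * c m) * complex_of_real (\<Prod>b\<in>Basis. (h \<bullet> b) ^ m b)) has_sum a * f (x + h)) (Basis \<rightarrow>\<^sub>E UNIV)"
    if "norm h < r" for h
    unfolding mult.assoc by (rule has_sum_cmult_right[OF c[OF that]])
  with \<open>r > 0\<close> show "\<exists>r>0. \<exists>c. \<forall>h. norm h < r \<longrightarrow>
      ((\<lambda>m. c m * complex_of_real (\<Prod>b\<in>Basis. (h \<bullet> b) ^ m b)) has_sum a * f (x + h)) (Basis \<rightarrow>\<^sub>E UNIV)"
    by (intro exI[of _ r] conjI exI[of _ "\<lambda>m. a * c m"]) auto
qed

lemma real_analytic_zero: "real_analytic (\<lambda>x. 0)"
  unfolding real_analytic_def
  by (intro allI exI[of _ 1] conjI exI[of _ "\<lambda>_. 0"]) (simp_all add: has_sum_0)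

lemma real_analytic_sum:
  assumes "finite S" "\<And>s. s \<in> S \<Longrightarrow> real_analytic (f s)"
  shows "real_analytic (\<lambda>x. \<Sum>s\<in>S. f s x)"
  using assms by (induction S rule: finite_induct) (auto intro: real_analytic_zero real_analytic_add)

section \<open>Directional derivatives of analytic functions\<close>

lemma dir_deriv_has_derivative:
  assumes "(f has_derivative f') (at x)"
  shows "dir_deriv v f x = f' v"
proof -
  have "((\<lambda>t. f (x + t *\<^sub>R v)) has_derivative (\<lambda>t. f' (t *\<^sub>R v))) (at 0)"
    by (rule has_derivative_compose[where g = f, unfolded o_def])
      (use assms in \<open>auto intro!: derivative_eq_intros\<close>)
  moreover have "f' (t *\<^sub>R v) = t *\<^sub>R f' v" for t
    using assms by (simp add: has_derivative_def bounded_linear.linear linear_scale)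
  ultimately have "((\<lambda>t. f (x + t *\<^sub>R v)) has_vector_derivative f' v) (at 0)"
    by (simp add: has_vector_derivative_def)
  then show ?thesis by (simp add: dir_deriv_def vector_derivative_at)
qed

lemma differentiable_dir_deriv:
  assumes "f differentiable (at x)"
  shows "(f has_derivative (\<lambda>v. dir_deriv v f x)) (at x)"
proof -
  from assms obtain f' where f': "(f has_derivative f') (at x)"
    by (auto simp: differentiable_def)
  then have "f' = (\<lambda>v. dir_deriv v f x)"
    by (auto simp: dir_deriv_has_derivative)
  with f' show ?thesis by simp
qed

lemma weight_upd:
  assumes "b \<in> Basis"
  shows "weight (m(b := j)) + m b = weight m + j"
proof -
  have "weight m' = m' b + (\<Sum>i\<in>Basis - {b}. m' i)" for m' :: "'a::euclidean_space \<Rightarrow> nat"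
    unfolding weight_def using assms by (simp add: sum.remove)
  from this[of m] this[of "m(b := j)"] show ?thesis by simp
qed

lemma monomial_has_derivative:
  "((\<lambda>h. complex_of_real (monomial m h)) has_derivative
    (\<lambda>u. complex_of_real (\<Sum>b\<in>Basis. (u \<bullet> b) * (real (m b) * monomial (m(b := m b - 1)) h)))) (at h)"
proof -
  have "(monomial m has_derivative
     (\<lambda>u. \<Sum>b\<in>Basis. (real (m b) * (u \<bullet> b) * (h \<bullet> b) ^ (m b - 1)) * (\<Prod>j\<in>Basis - {b}. (h \<bullet> j) ^ m j))) (at h)"
    unfolding monomial_def[abs_def]
    by (rule has_derivative_prod) (auto intro!: derivative_eq_intros)
  moreover have "(real (m b) * (u \<bullet> b) * (h \<bullet> b) ^ (m b - 1)) * (\<Prod>j\<in>Basis - {b}. (h \<bullet> j) ^ m j)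
      = (u \<bullet> b) * (real (m b) * monomial (m(b := m b - 1)) h)" if "b \<in> Basis" for b u
  proof -
    have "monomial (m(b := m b - 1)) h = (h \<bullet> b) ^ (m b - 1) * (\<Prod>j\<in>Basis - {b}. (h \<bullet> j) ^ m j)"
      unfolding monomial_def using that by (subst prod.remove[of _ b]) (auto intro!: prod.cong)
    then show ?thesis by simp
  qed
  ultimately have "(monomial m has_derivative
     (\<lambda>u. \<Sum>b\<in>Basis. (u \<bullet> b) * (real (m b) * monomial (m(b := m b - 1)) h))) (at h)"
    by (simp only: cong: sum.cong)
  then show ?thesis by (rule has_derivative_of_real)
qed

definition deriv_coeff :: "'a::euclidean_space \<Rightarrow> (('a \<Rightarrow> nat) \<Rightarrow> complex) \<Rightarrow> ('a \<Rightarrow> nat) \<Rightarrow> complex" where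
  "deriv_coeff b c m = of_nat (Suc (m b)) * c (m(b := Suc (m b)))"

lemma bij_betw_raise:
  assumes "b \<in> Basis"
  shows "bij_betw (\<lambda>m. m(b := Suc (m b))) multi_indices {m \<in> multi_indices. m b \<noteq> 0}"
proof (rule bij_betw_byWitness[where f' = "\<lambda>m. m(b := m b - 1)"])
  show "(\<lambda>m. m(b := Suc (m b))) ` multi_indices \<subseteq> {m \<in> multi_indices. m b \<noteq> 0}"
    "(\<lambda>m. m(b := m b - 1)) ` {m \<in> multi_indices. m b \<noteq> 0} \<subseteq> multi_indices"
    using assms by (auto simp: multi_indices_def PiE_iff extensional_def)
qed auto

text \<open>Differentiation multiplies the size of the term at m by at most \<open>weight m\<close>
  up to a constant, and n \<le> 2^n; shrinking the radius from 2\<rho> to \<rho> absorbs this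
  factor.\<close>

lemma expands_deriv:
  fixes f :: "'a::euclidean_space \<Rightarrow> complex"
  assumes "expands f x (2 * \<rho>) c"
  shows "norm h < \<rho> \<Longrightarrow> f differentiable (at (x + h))"
    and "b \<in> Basis \<Longrightarrow> expands (dir_deriv b f) x \<rho> (deriv_coeff b c)"
proof -
  have \<rho>: "0 < \<rho>" and c: "(\<lambda>m. norm (c m) * (2 * \<rho>) ^ weight m) summable_on multi_indices"
    and F: "\<And>h. norm h < 2 * \<rho> \<Longrightarrow> ((\<lambda>m. c m * complex_of_real (monomial m h)) has_sum f (x + h)) multi_indices"
    using assms by (auto simp: expands_def)
  define d where "d m h u = c m * complex_of_real (\<Sum>b\<in>Basis. (u \<bullet> b) * (real (m b) * monomial (m(b := m b - 1)) h))" for m h u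
  define K where "K m = norm (c m) * (2 * \<rho>) ^ weight m / \<rho>" for m
  have K: "K summable_on multi_indices"
    unfolding K_def[abs_def] divide_inverse by (intro summable_on_cmult_left c)
  \<comment> \<open>The factor m b makes the truncated subtraction harmless: for m b = 0 both sides
    vanish.\<close>
  have deg: "real (m b) * \<rho> ^ weight (m(b := m b - 1)) = real (m b) * \<rho> ^ weight m / \<rho>" if "b \<in> Basis" for m b
  proof (cases "m b = 0")
    case False
    then have "weight m = Suc (weight (m(b := m b - 1)))"
      using weight_upd[OF that, of m "m b - 1"] by simp
    then show ?thesis using \<rho> by simp
  qed simp
  have two: "real (weight m) * \<rho> ^ weight m / \<rho> * norm (c m) \<le> K m" for m :: "'a \<Rightarrow> nat"
  proof -
    have "real (weight m) \<le> 2 ^ weight m"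
      by (metis less_imp_le of_nat_less_two_power)
    then have "real (weight m) * (\<rho> ^ weight m / \<rho> * norm (c m)) \<le> 2 ^ weight m * (\<rho> ^ weight m / \<rho> * norm (c m))"
      using \<rho> by (intro mult_right_mono) auto
    then show ?thesis by (simp add: K_def power_mult_distrib mult_ac)
  qed
  have bound: "norm (d m h u) \<le> K m * norm u" if "norm h < \<rho>" for m h u
  proof -
    have "\<bar>\<Sum>b\<in>Basis. (u \<bullet> b) * (real (m b) * monomial (m(b := m b - 1)) h)\<bar>
        \<le> (\<Sum>b\<in>Basis. norm u * (real (m b) * \<rho> ^ weight m / \<rho>))"
    proof (rule order_trans[OF sum_abs sum_mono])
      fix b :: 'a assume b: "b \<in> Basis"
      have "\<bar>u \<bullet> b\<bar> * (real (m b) * \<bar>monomial (m(b := m b - 1)) h\<bar>) \<le> norm u * (real (m b) * \<rho> ^ weight (m(b := m b - 1)))"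
        using that \<rho> by (intro mult_mono Basis_le_norm b abs_monomial_le) auto
      then show "\<bar>(u \<bullet> b) * (real (m b) * monomial (m(b := m b - 1)) h)\<bar> \<le> norm u * (real (m b) * \<rho> ^ weight m / \<rho>)"
        unfolding deg[OF b] by (simp add: abs_mult)
    qed
    also have "\<dots> = norm u * (real (weight m) * \<rho> ^ weight m / \<rho>)"
      by (simp add: weight_def sum_distrib_left sum_distrib_right sum_divide_distrib)
    finally have "norm (d m h u) \<le> norm (c m) * (norm u * (real (weight m) * \<rho> ^ weight m / \<rho>))"
      unfolding d_def norm_mult norm_of_real by (rule mult_left_mono) simp
    also have "\<dots> = norm u * (real (weight m) * \<rho> ^ weight m / \<rho> * norm (c m))" by (simp add: mult_ac)
    also have "\<dots> \<le> norm u * K m" by (rule mult_left_mono[OF two]) simp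
    finally show ?thesis by (simp add: mult.commute)
  qed
  have D: "((\<lambda>y. f (x + y)) has_derivative (\<lambda>u. infsum (\<lambda>m. d m h u) multi_indices)) (at h)"
    "\<And>u. ((\<lambda>m. d m h u) has_sum infsum (\<lambda>m. d m h u) multi_indices) multi_indices"
    if h: "norm h < \<rho>" for h
  proof -
    have deriv: "((\<lambda>h. c m * complex_of_real (monomial m h)) has_derivative d m y) (at y)" for m y
      unfolding d_def[abs_def] by (rule has_derivative_mult_right[OF monomial_has_derivative])
    have F': "((\<lambda>m. c m * complex_of_real (monomial m y)) has_sum f (x + y)) multi_indices"
      if "y \<in> ball 0 \<rho>" for y
      using that \<rho> by (intro F) auto
    have bd: "norm (d m y u) \<le> K m * norm u" if "y \<in> ball 0 \<rho>" for m y u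
      using that by (intro bound) auto
    note T = has_derivative_has_sum[where f = "\<lambda>m h. c m * complex_of_real (monomial m h)" and f' = d and S = "ball 0 \<rho>",
      OF countable_multi_indices infinite_multi_indices open_ball convex_ball deriv bd K F']
    have h': "h \<in> ball 0 \<rho>" using h by simp
    show "((\<lambda>y. f (x + y)) has_derivative (\<lambda>u. infsum (\<lambda>m. d m h u) multi_indices)) (at h)"
      by (rule T(1), assumption, assumption, rule h')
    show "\<And>u. ((\<lambda>m. d m h u) has_sum infsum (\<lambda>m. d m h u) multi_indices) multi_indices"
      by (rule T(2), assumption, assumption, rule h')
  qed
  have Df: "(f has_derivative (\<lambda>u. infsum (\<lambda>m. d m h u) multi_indices)) (at (x + h))"
    if h: "norm h < \<rho>" for h
  proof -
    have "((\<lambda>z. z - x) has_derivative (\<lambda>u. u)) (at (x + h))"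
      by (auto intro!: derivative_eq_intros)
    from has_derivative_compose[OF this, of "\<lambda>y. f (x + y)" "\<lambda>u. infsum (\<lambda>m. d m h u) multi_indices"] D(1)[OF h]
    show ?thesis by simp
  qed
  show "norm h < \<rho> \<Longrightarrow> f differentiable (at (x + h))"
    using Df by (auto simp: differentiable_def)
  assume b: "b \<in> Basis"
  have db: "d m h b = c m * complex_of_real (real (m b) * monomial (m(b := m b - 1)) h)" for m h
  proof -
    have "(\<Sum>b'\<in>Basis. (b \<bullet> b') * (real (m b') * monomial (m(b' := m b' - 1)) h)) =
        (\<Sum>b'\<in>Basis. if b' = b then real (m b) * monomial (m(b := m b - 1)) h else 0)"
      by (rule sum.cong) (use b in \<open>auto simp: inner_Basis\<close>)
    then show ?thesis unfolding d_def using b by simp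
  qed
  have "(\<lambda>m. norm (deriv_coeff b c m) * \<rho> ^ weight m) summable_on multi_indices"
  proof -
    have "(\<lambda>m. norm (c m) * (real (m b) * \<rho> ^ weight (m(b := m b - 1)))) summable_on {m \<in> multi_indices. m b \<noteq> 0}"
    proof (rule summable_on_comparison_test)
      show "K summable_on {m \<in> multi_indices. m b \<noteq> 0}"
        by (rule summable_on_subset_banach[OF K]) auto
      fix m :: "'a \<Rightarrow> nat"
      have "m b \<le> weight m" unfolding weight_def using b by (intro member_le_sum) auto
      then have "real (m b) * (\<rho> ^ weight m / \<rho> * norm (c m)) \<le> real (weight m) * (\<rho> ^ weight m / \<rho> * norm (c m))"
        using \<rho> by (intro mult_right_mono) auto
      then show "norm (c m) * (real (m b) * \<rho> ^ weight (m(b := m b - 1))) \<le> K m"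
        unfolding deg[OF b] using two[of m] by (simp add: mult_ac)
    qed (use \<rho> in auto)
    from this[folded summable_on_reindex_bij_betw[OF bij_betw_raise[OF b]]]
    show ?thesis
      by (simp add: deriv_coeff_def norm_mult mult_ac del: of_nat_Suc)
  qed
  moreover have "((\<lambda>m. deriv_coeff b c m * complex_of_real (monomial m h)) has_sum dir_deriv b f (x + h)) multi_indices"
    if h: "norm h < \<rho>" for h
  proof -
    have "((\<lambda>m. d m h b) has_sum dir_deriv b f (x + h)) multi_indices"
      using D(2)[OF h, of b] dir_deriv_has_derivative[OF Df[OF h], of b] by simp
    \<comment> \<open>Terms with m b = 0 have derivative zero, so the sum may be restricted to the
      image of the index shift in \<open>bij_betw_raise\<close>.\<close>
    then have "((\<lambda>m. d m h b) has_sum dir_deriv b f (x + h)) {m \<in> multi_indices. m b \<noteq> 0}"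
      by (rule has_sum_cong_neutral[THEN iffD1, rotated -1]) (auto simp: db)
    from this[folded has_sum_reindex_bij_betw[OF bij_betw_raise[OF b]]]
    show ?thesis
      by (simp add: deriv_coeff_def db mult_ac del: of_nat_Suc)
  qed
  ultimately show "expands (dir_deriv b f) x \<rho> (deriv_coeff b c)"
    using \<rho> by (simp add: expands_def)
qed

lemma expands_center:
  assumes "expands f x \<rho> c"
  shows "f x = c (\<lambda>b\<in>Basis. 0)"
proof -
  let ?z = "(\<lambda>b\<in>Basis. 0) :: 'a \<Rightarrow> nat"
  have "((\<lambda>m. c m * complex_of_real (monomial m 0)) has_sum f (x + 0)) multi_indices"
    using assms unfolding expands_def by (metis norm_zero)
  moreover have "((\<lambda>m. c m * complex_of_real (monomial m 0)) has_sum c ?z) multi_indices"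
  proof (rule has_sum_finite_neutralI[where B = "{?z}"])
    show "c ?z = (\<Sum>m\<in>{?z}. c m * complex_of_real (monomial m 0))"
      by (simp add: monomial_def)
    fix m assume m: "m \<in> multi_indices - {?z}"
    then have "m \<in> extensional Basis" "m \<noteq> ?z" by (auto simp: multi_indices_def PiE_iff)
    then have "\<exists>b\<in>Basis. m b \<noteq> 0"
      by (metis (no_types, lifting) extensionalityI restrict_apply' restrict_extensional)
    then obtain b where "b \<in> Basis" "m b \<noteq> 0" by blast
    then show "c m * complex_of_real (monomial m 0) = 0"
      by (auto simp: monomial_def)
  qed (auto simp: multi_indices_def)
  ultimately show ?thesis by (simp add: has_sum_unique)
qed

lemma real_analytic_differentiable:
  assumes "real_analytic f"
  shows "f differentiable (at x)"
proof -
  from assms obtain \<rho> c where "expands f x \<rho> c" unfolding real_analytic_iff_expands by blast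
  then have "expands f x (2 * (\<rho> / 2)) c" "0 < \<rho>" by (auto simp: expands_def)
  from expands_deriv(1)[OF this(1), of 0] this(2) show ?thesis by simp
qed

lemma real_analytic_dir_deriv_Basis:
  assumes "real_analytic f" "b \<in> Basis"
  shows "real_analytic (dir_deriv b f)"
  unfolding real_analytic_iff_expands
proof
  fix x
  from assms obtain \<rho> c where "expands f x \<rho> c" unfolding real_analytic_iff_expands by blast
  then have "expands f x (2 * (\<rho> / 2)) c" by simp
  from expands_deriv(2)[OF this assms(2)] show "\<exists>\<rho> c. expands (dir_deriv b f) x \<rho> c" by blast
qed

lemma dir_deriv_Basis_expansion:
  assumes "f differentiable (at x)"
  shows "dir_deriv v f x = (\<Sum>b\<in>Basis. complex_of_real (v \<bullet> b) * dir_deriv b f x)"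
proof -
  have lin: "linear (\<lambda>v. dir_deriv v f x)"
    using differentiable_dir_deriv[OF assms] has_derivative_linear by blast
  have "dir_deriv v f x = dir_deriv (\<Sum>b\<in>Basis. (v \<bullet> b) *\<^sub>R b) f x"
    by (simp add: euclidean_representation)
  also have "\<dots> = (\<Sum>b\<in>Basis. complex_of_real (v \<bullet> b) * dir_deriv b f x)"
    using lin by (simp add: linear_sum[OF lin] linear_scale[OF lin] scaleR_conv_of_real)
  finally show ?thesis .
qed

lemma real_analytic_dir_deriv:
  assumes "real_analytic f"
  shows "real_analytic (dir_deriv v f)"
proof -
  have "dir_deriv v f = (\<lambda>x. \<Sum>b\<in>Basis. complex_of_real (v \<bullet> b) * dir_deriv b f x)"
    by (rule ext) (rule dir_deriv_Basis_expansion[OF real_analytic_differentiable[OF assms]])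
  then show ?thesis
    by (auto intro!: real_analytic_sum real_analytic_cmult real_analytic_dir_deriv_Basis assms)
qed

lemma dir_deriv_sum_cmult:
  assumes "finite S" "\<And>s. s \<in> S \<Longrightarrow> f s differentiable (at x)"
  shows "dir_deriv v (\<lambda>y. \<Sum>s\<in>S. c s * f s y) x = (\<Sum>s\<in>S. c s * dir_deriv v (f s) x)"
proof (rule dir_deriv_has_derivative)
  show "((\<lambda>y. \<Sum>s\<in>S. c s * f s y) has_derivative (\<lambda>v. \<Sum>s\<in>S. c s * dir_deriv v (f s) x)) (at x)"
    by (intro has_derivative_sum has_derivative_mult_right differentiable_dir_deriv assms)
qed

text \<open>At the centre of an expansion both mixed partial derivatives are the same coefficient,
  that of the index raised once at each of the two basis vectors; general directions follow by
  bilinearity.\<close>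

lemma real_analytic_dir_deriv_commute:
  assumes f: "real_analytic f"
  shows "dir_deriv u (dir_deriv v f) = dir_deriv v (dir_deriv u f)"
proof (rule ext)
  fix x
  have basis: "dir_deriv a (dir_deriv b f) x = dir_deriv b (dir_deriv a f) x"
    if ab: "a \<in> Basis" "b \<in> Basis" for a b
  proof (cases "a = b")
    case False
    from f obtain \<rho> c where "expands f x \<rho> c" unfolding real_analytic_iff_expands by blast
    \<comment> \<open>Two differentiations, each of which halves the radius.\<close>
    then have e: "expands f x (2 * (2 * (\<rho> / 4))) c" by simp
    have "dir_deriv a (dir_deriv b f) x = deriv_coeff a (deriv_coeff b c) (\<lambda>b\<in>Basis. 0)"
      "dir_deriv b (dir_deriv a f) x = deriv_coeff b (deriv_coeff a c) (\<lambda>b\<in>Basis. 0)"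
      using ab by (metis expands_center expands_deriv(2) e)+
    then show ?thesis
      using ab False by (simp add: deriv_coeff_def fun_upd_twist)
  qed simp
  have *: "dir_deriv u (dir_deriv v f) x =
      (\<Sum>b\<in>Basis. \<Sum>a\<in>Basis. complex_of_real (v \<bullet> b) * (complex_of_real (u \<bullet> a) * dir_deriv a (dir_deriv b f) x))" for u v
  proof -
    have "dir_deriv v f = (\<lambda>x. \<Sum>b\<in>Basis. complex_of_real (v \<bullet> b) * dir_deriv b f x)"
      by (rule ext) (rule dir_deriv_Basis_expansion[OF real_analytic_differentiable[OF f]])
    then have "dir_deriv u (dir_deriv v f) x = (\<Sum>b\<in>Basis. complex_of_real (v \<bullet> b) * dir_deriv u (dir_deriv b f) x)"
      by (simp only: dir_deriv_sum_cmult[OF finite_Basis real_analytic_differentiable[OF real_analytic_dir_deriv[OF f]]])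
    also have "\<dots> = (\<Sum>b\<in>Basis. complex_of_real (v \<bullet> b) * (\<Sum>a\<in>Basis. complex_of_real (u \<bullet> a) * dir_deriv a (dir_deriv b f) x))"
      by (simp only: dir_deriv_Basis_expansion[OF real_analytic_differentiable[OF real_analytic_dir_deriv[OF f]], of u])
    finally show ?thesis by (simp add: sum_distrib_left)
  qed
  show "dir_deriv u (dir_deriv v f) x = dir_deriv v (dir_deriv u f) x"
    by (subst *[of u v], subst *[of v u], subst sum.swap) (intro sum.cong refl, simp add: basis mult_ac)
qed

section \<open>Smooth functions and exponentials\<close>

definition derivation_closed :: "('a::euclidean_space \<Rightarrow> complex) set \<Rightarrow> bool" where
  "derivation_closed C \<longleftrightarrow> (\<forall>g\<in>C. (\<forall>x. g differentiable (at x)) \<and> (\<forall>u. dir_deriv u g \<in> C) \<and>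
     (\<forall>u v. dir_deriv u (dir_deriv v g) = dir_deriv v (dir_deriv u g)))"

text \<open>Infinite differentiability in coinductive form: closure properties are proved by
  exhibiting a single class that contains the function and is stable under all directional
  derivatives. Symmetry of second derivatives is built into the class.\<close>

definition smooth :: "('a::euclidean_space \<Rightarrow> complex) \<Rightarrow> bool" where
  "smooth f \<longleftrightarrow> (\<exists>C. f \<in> C \<and> derivation_closed C)"

lemma smoothI: "derivation_closed C \<Longrightarrow> f \<in> C \<Longrightarrow> smooth f"
  unfolding smooth_def by blast

lemma smooth_differentiable: "smooth f \<Longrightarrow> f differentiable (at x)"
  and smooth_dir_deriv: "smooth f \<Longrightarrow> smooth (dir_deriv u f)"
  and smooth_commute: "smooth f \<Longrightarrow> dir_deriv u (dir_deriv v f) = dir_deriv v (dir_deriv u f)"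
  unfolding smooth_def derivation_closed_def by blast+

lemma smooth_has_derivative: "smooth f \<Longrightarrow> (f has_derivative (\<lambda>v. dir_deriv v f x)) (at x)"
  by (rule differentiable_dir_deriv[OF smooth_differentiable])

lemma real_analytic_smooth:
  assumes "real_analytic f"
  shows "smooth f"
  unfolding smooth_def derivation_closed_def
  by (intro exI[of _ "Collect real_analytic"] conjI ballI allI)
    (use assms in \<open>simp_all add: real_analytic_differentiable real_analytic_dir_deriv
      real_analytic_dir_deriv_commute\<close>)

lemma dir_deriv_lincomb:
  assumes "smooth f" "smooth g"
  shows "dir_deriv v (\<lambda>x. a * f x + b * g x) = (\<lambda>x. a * dir_deriv v f x + b * dir_deriv v g x)"
proof
  fix x
  show "dir_deriv v (\<lambda>x. a * f x + b * g x) x = a * dir_deriv v f x + b * dir_deriv v g x"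
    by (rule dir_deriv_has_derivative)
      (intro has_derivative_add has_derivative_mult_right smooth_has_derivative assms)
qed

lemma smooth_lincomb:
  assumes "smooth f" "smooth g"
  shows "smooth (\<lambda>x. a * f x + b * g x)"
proof -
  let ?C = "{h. \<exists>f g. h = (\<lambda>x. a * f x + b * g x) \<and> smooth f \<and> smooth g}"
  have "derivation_closed ?C"
    unfolding derivation_closed_def
  proof
    fix h assume "h \<in> ?C"
    then obtain f g where h: "h = (\<lambda>x. a * f x + b * g x)" and fg: "smooth f" "smooth g" by blast
    have "h differentiable (at x)" for x
      unfolding h differentiable_def
      using has_derivative_add[OF has_derivative_mult_right[OF smooth_has_derivative[OF fg(1)]]
          has_derivative_mult_right[OF smooth_has_derivative[OF fg(2)]]] by blast
    moreover have d: "dir_deriv u h = (\<lambda>x. a * dir_deriv u f x + b * dir_deriv u g x)" for u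
      unfolding h by (rule dir_deriv_lincomb[OF fg])
    moreover have "dir_deriv u h \<in> ?C" for u
      unfolding d using fg smooth_dir_deriv by blast
    moreover have "dir_deriv u (dir_deriv v h) = dir_deriv v (dir_deriv u h)" for u v
      unfolding d dir_deriv_lincomb[OF smooth_dir_deriv[OF fg(1)] smooth_dir_deriv[OF fg(2)]]
      by (simp add: smooth_commute[OF fg(1), of u] smooth_commute[OF fg(2), of u])
    ultimately show "(\<forall>x. h differentiable (at x)) \<and> (\<forall>u. dir_deriv u h \<in> ?C) \<and>
       (\<forall>u v. dir_deriv u (dir_deriv v h) = dir_deriv v (dir_deriv u h))" by blast
  qed
  then show ?thesis by (rule smoothI) (use assms in blast)
qed

lemma dir_deriv_compose_affine:
  assumes "linear L"
  shows "dir_deriv v (\<lambda>x. f (L x + y)) = (\<lambda>x. dir_deriv (L v) f (L x + y))"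
  by (simp add: fun_eq_iff dir_deriv_def linear_add[OF assms] linear_scale[OF assms] algebra_simps)

lemma smooth_compose_affine:
  fixes f :: "'a::euclidean_space \<Rightarrow> complex"
  assumes "smooth f" and L: "linear L"
  shows "smooth (\<lambda>x. f (L x + y))"
proof -
  let ?C = "{h. \<exists>f. h = (\<lambda>x. f (L x + y)) \<and> smooth f}"
  have "derivation_closed ?C"
    unfolding derivation_closed_def
  proof
    fix h assume "h \<in> ?C"
    then obtain f where h: "h = (\<lambda>x. f (L x + y))" and f: "smooth f" by blast
    have "((\<lambda>x. L x + y) has_derivative L) (at x)" for x
      using linear_imp_has_derivative[OF L] has_derivative_add_const by blast
    then have "h differentiable (at x)" for x
      unfolding h differentiable_def
      using has_derivative_compose[OF _ smooth_has_derivative[OF f], of "\<lambda>x. L x + y" L] by blast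
    moreover have d: "dir_deriv u h = (\<lambda>x. dir_deriv (L u) f (L x + y))" for u
      unfolding h by (rule dir_deriv_compose_affine[OF L])
    moreover have "dir_deriv u h \<in> ?C" for u
      unfolding d using f smooth_dir_deriv by blast
    moreover have "dir_deriv u (dir_deriv v h) = dir_deriv v (dir_deriv u h)" for u v
      unfolding d dir_deriv_compose_affine[OF L] by (simp add: smooth_commute[OF f, of "L u"])
    ultimately show "(\<forall>x. h differentiable (at x)) \<and> (\<forall>u. dir_deriv u h \<in> ?C) \<and>
       (\<forall>u v. dir_deriv u (dir_deriv v h) = dir_deriv v (dir_deriv u h))" by blast
  qed
  then show ?thesis by (rule smoothI) (use assms in blast)
qed

lemma smooth_zero: "smooth (\<lambda>x. 0)"
  by (rule real_analytic_smooth[OF real_analytic_zero])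

lemma dir_deriv_direction_linear:
  assumes "smooth f"
  shows "linear (\<lambda>v. dir_deriv v f x)"
  using has_derivative_linear[OF smooth_has_derivative[OF assms]] .

lemma exp_linear_has_derivative:
  fixes \<mu> :: "'a::euclidean_space \<Rightarrow> complex"
  assumes "linear \<mu>"
  shows "((\<lambda>x. exp (\<mu> x)) has_derivative (\<lambda>v. \<mu> v * exp (\<mu> x))) (at x)"
proof -
  have "(exp has_derivative (\<lambda>y. exp (\<mu> x) * y)) (at (\<mu> x))"
    by (rule has_field_derivative_imp_has_derivative[OF DERIV_exp])
  with linear_imp_has_derivative[OF assms]
  have "((\<lambda>x. exp (\<mu> x)) has_derivative (\<lambda>v. exp (\<mu> x) * \<mu> v)) (at x)"
    by (rule has_derivative_compose)
  then show ?thesis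
    unfolding mult.commute[of "exp (\<mu> x)"] .
qed

lemma dir_deriv_exp:
  assumes "linear \<mu>"
  shows "dir_deriv v (\<lambda>x. exp (\<mu> x)) = (\<lambda>x. \<mu> v * exp (\<mu> x))"
  by (rule ext) (rule dir_deriv_has_derivative[OF exp_linear_has_derivative[OF assms]])

text \<open>A finite set of functions lies in the box of its coordinate projections, and over a box
  the sum of the products factors.\<close>

lemma summable_on_PiE_prod:
  fixes f :: "'i \<Rightarrow> 'j \<Rightarrow> real"
  assumes I: "finite I" and f: "\<And>i. f i summable_on UNIV" and nonneg: "\<And>i j. 0 \<le> f i j"
  shows "(\<lambda>m. \<Prod>i\<in>I. f i (m i)) summable_on (I \<rightarrow>\<^sub>E UNIV)"
proof (rule nonneg_bdd_above_summable_on)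
  show "bdd_above (sum (\<lambda>m. \<Prod>i\<in>I. f i (m i)) ` {F. F \<subseteq> I \<rightarrow>\<^sub>E UNIV \<and> finite F})"
  proof (rule bdd_aboveI2)
    fix F assume "F \<in> {F. F \<subseteq> I \<rightarrow>\<^sub>E (UNIV :: 'j set) \<and> finite F}"
    then have F: "F \<subseteq> I \<rightarrow>\<^sub>E UNIV" "finite F" by auto
    define A where "A i = (\<lambda>m. m i) ` F" for i
    have A: "finite (A i)" for i using F by (simp add: A_def)
    have "F \<subseteq> Pi\<^sub>E I A"
    proof
      fix m assume "m \<in> F"
      then show "m \<in> Pi\<^sub>E I A" using subsetD[OF F(1), of m] by (simp add: A_def PiE_iff)
    qed
    then have "(\<Sum>m\<in>F. \<Prod>i\<in>I. f i (m i)) \<le> (\<Sum>m\<in>Pi\<^sub>E I A. \<Prod>i\<in>I. f i (m i))"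
      by (intro sum_mono2 finite_PiE I A prod_nonneg nonneg)
    also have "\<dots> = (\<Prod>i\<in>I. \<Sum>j\<in>A i. f i j)"
      by (rule prod_sum_PiE[symmetric]) (use I A in auto)
    also have "\<dots> \<le> (\<Prod>i\<in>I. infsum (f i) UNIV)"
      by (intro prod_mono conjI sum_nonneg finite_sum_le_infsum f A nonneg subset_UNIV)
    finally show "(\<Sum>m\<in>F. \<Prod>i\<in>I. f i (m i)) \<le> (\<Prod>i\<in>I. infsum (f i) UNIV)" .
  qed
qed (simp add: prod_nonneg nonneg)

text \<open>exp (\<mu> h) is the product over the basis of one-variable exponential series, and
  multiplying out gives a sum over multi-indices. The radius 1 is an arbitrary choice, since the
  series converges everywhere.\<close>

lemma real_analytic_exp:
  fixes \<mu> :: "'a::euclidean_space \<Rightarrow> complex"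
  assumes \<mu>: "linear \<mu>"
  shows "real_analytic (\<lambda>x. exp (\<mu> x))"
  unfolding real_analytic_def
proof (rule allI, rule exI[of _ "1::real"], rule conjI)
  fix x :: 'a
  define c where "c m = exp (\<mu> x) * (\<Prod>b\<in>Basis. \<mu> b ^ m b / fact (m b))" for m :: "'a \<Rightarrow> nat"
  show "\<exists>c. \<forall>h. norm h < 1 \<longrightarrow> ((\<lambda>m. c m * complex_of_real (\<Prod>b\<in>Basis. (h \<bullet> b) ^ m b)) has_sum exp (\<mu> (x + h)))
         (Basis \<rightarrow>\<^sub>E UNIV)"
  proof (intro exI[of _ c] allI impI)
    fix h :: 'a
    define t where "t b n = (complex_of_real (h \<bullet> b) * \<mu> b) ^ n / fact n" for b :: 'a and n
    have t: "(t b has_sum exp (complex_of_real (h \<bullet> b) * \<mu> b)) UNIV"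
      and abs_t: "(\<lambda>n. norm (t b n)) summable_on UNIV" for b
    proof -
      have "summable (\<lambda>n. norm (t b n))"
        using summable_norm_exp[of "complex_of_real (h \<bullet> b) * \<mu> b"]
        by (simp add: t_def scaleR_conv_of_real field_simps norm_mult norm_divide norm_power)
      then show s: "(\<lambda>n. norm (t b n)) summable_on UNIV"
        by (rule summable_nonneg_imp_summable_on) simp
      have "t b sums exp (complex_of_real (h \<bullet> b) * \<mu> b)"
        unfolding t_def[abs_def] using exp_converges[of "complex_of_real (h \<bullet> b) * \<mu> b"]
        by (simp add: scaleR_conv_of_real field_simps)
      moreover have "(t b has_sum infsum (t b) UNIV) UNIV"
        by (rule has_sum_infsum[OF abs_summable_summable[OF s]])
      ultimately show "(t b has_sum exp (complex_of_real (h \<bullet> b) * \<mu> b)) UNIV"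
        by (metis has_sum_imp_sums sums_unique2)
    qed
    have "(\<lambda>m. \<Prod>b\<in>Basis. t b (m b)) summable_on (Basis \<rightarrow>\<^sub>E UNIV)"
    proof (rule abs_summable_summable)
      have "(\<lambda>m. \<Prod>b\<in>(Basis::'a set). norm (t b (m b))) summable_on (Basis \<rightarrow>\<^sub>E UNIV)"
        by (rule summable_on_PiE_prod[where f = "\<lambda>b n. norm (t b n)"]) (simp_all add: abs_t)
      then show "(\<lambda>m. norm (\<Prod>b\<in>Basis. t b (m b))) summable_on (Basis \<rightarrow>\<^sub>E UNIV)"
        by (simp add: prod_norm)
    qed
    then have "((\<lambda>m. \<Prod>b\<in>Basis. t b (m b)) has_sum (\<Prod>b\<in>Basis. exp (complex_of_real (h \<bullet> b) * \<mu> b))) (Basis \<rightarrow>\<^sub>E UNIV)"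
      using infsum_prod_PiE_abs[of "Basis :: 'a set" t "\<lambda>_. UNIV"] abs_t infsumI[OF t]
      by (simp add: has_sum_iff)
    then have "((\<lambda>m. exp (\<mu> x) * (\<Prod>b\<in>Basis. t b (m b))) has_sum exp (\<mu> x) * (\<Prod>b\<in>Basis. exp (complex_of_real (h \<bullet> b) * \<mu> b))) (Basis \<rightarrow>\<^sub>E UNIV)"
      by (rule has_sum_cmult_right)
    moreover have "exp (\<mu> x) * (\<Prod>b\<in>Basis. exp (complex_of_real (h \<bullet> b) * \<mu> b)) = exp (\<mu> (x + h))"
    proof -
      have "\<mu> h = \<mu> (\<Sum>b\<in>Basis. (h \<bullet> b) *\<^sub>R b)" by (simp add: euclidean_representation)
      also have "\<dots> = (\<Sum>b\<in>Basis. complex_of_real (h \<bullet> b) * \<mu> b)"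
        by (simp add: linear_sum[OF \<mu>] linear_scale[OF \<mu>] scaleR_conv_of_real)
      finally show ?thesis
        by (simp add: linear_add[OF \<mu>] exp_add exp_sum)
    qed
    moreover have "exp (\<mu> x) * (\<Prod>b\<in>Basis. t b (m b)) = c m * complex_of_real (\<Prod>b\<in>Basis. (h \<bullet> b) ^ m b)" for m
      by (simp add: c_def t_def prod_dividef power_mult_distrib prod.distrib)
    ultimately show "((\<lambda>m. c m * complex_of_real (\<Prod>b\<in>Basis. (h \<bullet> b) ^ m b)) has_sum exp (\<mu> (x + h))) (Basis \<rightarrow>\<^sub>E UNIV)"
      by simp
  qed
qed simp

section \<open>Commuting families of operators\<close>

text \<open>Linearity and commutation are required on S only, since directional derivatives have
  these properties only on sufficiently regular functions. Annihilating products of the operators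
  \<open>X v c\<close> take the place of finite dimension.\<close>

locale commuting_family = vector_space scale
  for scale :: "'k::field \<Rightarrow> 'm::ab_group_add \<Rightarrow> 'm" (infixr "*s" 75) +
  fixes S :: "'m set" and T :: "'v \<Rightarrow> 'm \<Rightarrow> 'm"
  assumes subspace: "subspace S"
    and closed: "x \<in> S \<Longrightarrow> T v x \<in> S"
    and T_add: "x \<in> S \<Longrightarrow> y \<in> S \<Longrightarrow> T v (x + y) = T v x + T v y"
    and T_scale: "x \<in> S \<Longrightarrow> T v (c *s x) = c *s T v x"
    and T_commute: "x \<in> S \<Longrightarrow> T u (T v x) = T v (T u x)"
begin

definition X :: "'v \<Rightarrow> 'k \<Rightarrow> 'm \<Rightarrow> 'm" where
  "X v c x = T v x - c *s x"

lemma zero_in: "0 \<in> S" by (rule subspace_0[OF subspace])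

lemma add_in: "x \<in> S \<Longrightarrow> y \<in> S \<Longrightarrow> x + y \<in> S" by (rule subspace_add[OF subspace])

lemma scale_in: "x \<in> S \<Longrightarrow> c *s x \<in> S" by (rule subspace_scale[OF subspace])

lemma diff_in: "x \<in> S \<Longrightarrow> y \<in> S \<Longrightarrow> x - y \<in> S" by (rule subspace_diff[OF subspace])

lemma T_diff: "x \<in> S \<Longrightarrow> y \<in> S \<Longrightarrow> T v (x - y) = T v x - T v y"
  using T_add[of "x - y" y v] by (simp add: diff_in eq_diff_eq)

lemma X_in: "x \<in> S \<Longrightarrow> X v c x \<in> S"
  unfolding X_def by (intro diff_in closed scale_in)

lemma X_diff: "x \<in> S \<Longrightarrow> y \<in> S \<Longrightarrow> X v c (x - y) = X v c x - X v c y"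
  by (simp add: X_def T_diff algebra_simps)

lemma X_add: "x \<in> S \<Longrightarrow> y \<in> S \<Longrightarrow> X v c (x + y) = X v c x + X v c y"
  by (simp add: X_def T_add algebra_simps)

lemma X_scale: "x \<in> S \<Longrightarrow> X v c (d *s x) = d *s X v c x"
  by (simp add: X_def T_scale algebra_simps)

lemma X_zero: "X v c 0 = 0"
  using X_diff[OF zero_in zero_in, of v c] by simp

lemma X_commute: "x \<in> S \<Longrightarrow> X u c (X v d x) = X v d (X u c x)"
  by (simp add: X_def T_diff T_scale closed scale_in T_commute[of x u v] algebra_simps)

lemma X_T: "x \<in> S \<Longrightarrow> X v d (T u x) = T u (X v d x)"
  by (simp add: X_def T_diff T_scale closed scale_in T_commute[of x v u])

lemma X_sum: "finite A \<Longrightarrow> (\<And>a. a \<in> A \<Longrightarrow> f a \<in> S) \<Longrightarrow> X v c (sum f A) = (\<Sum>a\<in>A. X v c (f a)) \<and> sum f A \<in> S"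
  by (induction A rule: finite_induct) (simp_all add: X_zero X_add zero_in add_in)

lemma Xn_in: "x \<in> S \<Longrightarrow> (X v c ^^ n) x \<in> S"
  by (induction n) (simp_all add: X_in)

lemma Xn_diff: "x \<in> S \<Longrightarrow> y \<in> S \<Longrightarrow> (X v c ^^ n) (x - y) = (X v c ^^ n) x - (X v c ^^ n) y"
  by (induction n) (simp_all add: X_diff Xn_in)

lemma Xn_add: "x \<in> S \<Longrightarrow> y \<in> S \<Longrightarrow> (X v c ^^ n) (x + y) = (X v c ^^ n) x + (X v c ^^ n) y"
  by (induction n) (simp_all add: X_add Xn_in)

lemma Xn_scale: "x \<in> S \<Longrightarrow> (X v c ^^ n) (d *s x) = d *s (X v c ^^ n) x"
  by (induction n) (simp_all add: X_scale Xn_in)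

lemma Xn_zero: "(X v c ^^ n) 0 = 0"
  by (induction n) (simp_all add: X_zero)

lemma Xn_commute: "x \<in> S \<Longrightarrow> (X u c ^^ n) (X v d x) = X v d ((X u c ^^ n) x)"
  by (induction n) (simp_all add: X_commute Xn_in)

lemma Xn_mono: "x \<in> S \<Longrightarrow> (X v c ^^ n) x = 0 \<Longrightarrow> n \<le> m \<Longrightarrow> (X v c ^^ m) x = 0"
  by (induction m) (auto simp: le_Suc_eq X_zero)

text \<open>On the generalized d-eigenspace T v - c is the nonzero scalar d - c plus a nilpotent
  operator, hence onto.\<close>

lemma generalized_eigen_solve:
  assumes "G \<in> S" "(X v d ^^ n) G = 0" "c \<noteq> d"
  shows "\<exists>G'\<in>S. (X v d ^^ n) G' = 0 \<and> X v c G' = G"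
  using assms(1,2)
proof (induction n arbitrary: G)
  case 0
  then show ?case by (auto intro!: bexI[of _ 0] simp: X_zero zero_in)
next
  case (Suc n)
  have XG: "X v d G \<in> S" "(X v d ^^ n) (X v d G) = 0"
    using Suc.prems by (simp_all add: X_in funpow_swap1)
  from Suc.IH[OF this] obtain G1 where G1: "G1 \<in> S" "(X v d ^^ n) G1 = 0" "X v c G1 = X v d G" by blast
  \<comment> \<open>(T v - c) G = (T v - d) G + (d - c) G, and G1 removes the first summand.\<close>
  define G' where "G' = inverse (d - c) *s (G - G1)"
  have "X v c G - X v d G = (d - c) *s G"
    by (simp add: X_def algebra_simps)
  then have "X v c G' = inverse (d - c) *s ((d - c) *s G)"
    unfolding G'_def by (simp add: X_scale X_diff diff_in Suc.prems G1)
  then have "X v c G' = G" using \<open>c \<noteq> d\<close> by simp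
  moreover have "(X v d ^^ Suc n) G1 = 0"
    by (rule Xn_mono[OF G1(1,2)]) simp
  then have "(X v d ^^ Suc n) G' = 0"
    unfolding G'_def using Suc.prems G1(1) by (simp only: Xn_scale Xn_diff diff_in) simp
  moreover have "G' \<in> S" unfolding G'_def by (intro scale_in diff_in Suc.prems G1)
  ultimately show ?case by blast
qed

lemma foldr_X_commute: "H \<in> S \<Longrightarrow> foldr (X v) cs (X v c H) = X v c (foldr (X v) cs H) \<and> foldr (X v) cs H \<in> S"
  by (induction cs) (auto simp: X_commute X_in)

text \<open>Induction on the factors: decompose (T v - c) H, pull the components with d \<noteq> c
  back through T v - c, and what is left of H is a generalized c-eigenvector. The exponent
  \<open>length cs\<close> bounds the multiplicity of every root.\<close>

lemma primary_decomposition: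
  assumes "H \<in> S" "foldr (X v) cs H = 0"
  shows "\<exists>G. (\<forall>c\<in>set cs. G c \<in> S \<and> (X v c ^^ length cs) (G c) = 0) \<and> H = (\<Sum>c\<in>set cs. G c)"
  using assms
proof (induction cs arbitrary: H)
  case Nil
  then show ?case by simp
next
  case (Cons c cs)
  have "X v c H \<in> S" "foldr (X v) cs (X v c H) = 0"
    using Cons.prems by (simp_all add: X_in foldr_X_commute)
  from Cons.IH[OF this] obtain G where
    G: "\<And>d. d \<in> set cs \<Longrightarrow> G d \<in> S" "\<And>d. d \<in> set cs \<Longrightarrow> (X v d ^^ length cs) (G d) = 0"
    and XH: "X v c H = (\<Sum>d\<in>set cs. G d)" by blast
  have "\<exists>G'\<in>S. (X v d ^^ length cs) G' = 0 \<and> X v c G' = G d" if "d \<in> set cs - {c}" for d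
    using that by (intro generalized_eigen_solve G) auto
  then obtain G' where G': "\<And>d. d \<in> set cs - {c} \<Longrightarrow> G' d \<in> S"
    "\<And>d. d \<in> set cs - {c} \<Longrightarrow> (X v d ^^ length cs) (G' d) = 0"
    "\<And>d. d \<in> set cs - {c} \<Longrightarrow> X v c (G' d) = G d" by metis
  define K where "K = H - (\<Sum>d\<in>set cs - {c}. G' d)"
  have sumG': "(\<Sum>d\<in>set cs - {c}. G' d) \<in> S" "X v c (\<Sum>d\<in>set cs - {c}. G' d) = (\<Sum>d\<in>set cs - {c}. G d)"
    using X_sum[of "set cs - {c}" G' v c] G' by simp_all
  have K: "K \<in> S" unfolding K_def by (intro diff_in Cons.prems sumG')
  have "X v c K = (\<Sum>d\<in>set cs. G d) - (\<Sum>d\<in>set cs - {c}. G d)"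
    unfolding K_def by (simp only: X_diff[OF Cons.prems(1) sumG'(1)] XH sumG'(2))
  also have "\<dots> = (if c \<in> set cs then G c else 0)"
    using sum.remove[of "set cs" c G] by (cases "c \<in> set cs") simp_all
  finally have "(X v c ^^ length cs) (X v c K) = 0"
    using G(2) by (simp add: Xn_zero)
  then have Kn: "(X v c ^^ Suc (length cs)) K = 0"
    by (simp add: funpow_swap1)
  define G'' where "G'' = G'(c := K)"
  have "(\<Sum>d\<in>insert c (set cs). G'' d) = K + (\<Sum>d\<in>set cs - {c}. G'' d)"
    by (simp add: sum.insert_remove G''_def)
  also have "(\<Sum>d\<in>set cs - {c}. G'' d) = (\<Sum>d\<in>set cs - {c}. G' d)"
    by (rule sum.cong) (auto simp: G''_def)
  finally have "H = (\<Sum>d\<in>set (c # cs). G'' d)" by (simp add: K_def)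
  moreover have "G'' d \<in> S \<and> (X v d ^^ length (c # cs)) (G'' d) = 0" if "d \<in> set (c # cs)" for d
  proof (cases "d = c")
    case True
    then show ?thesis using K Kn by (simp add: G''_def)
  next
    case False
    then have "d \<in> set cs - {c}" using that by auto
    then show ?thesis using G'[of d] False Xn_mono[of "G' d" "length cs" v d "Suc (length cs)"] by (simp add: G''_def)
  qed
  ultimately show ?case by blast
qed

definition joint_gen_eigen :: "'v set \<Rightarrow> 'm set" where
  "joint_gen_eigen B = {G \<in> S. \<forall>v\<in>B. \<exists>c n. (X v c ^^ n) G = 0}"

text \<open>The operators are treated one at a time: a joint generalized eigenvector for B is split
  further by the next operator.\<close>

lemma in_span_joint_gen_eigen:
  assumes "finite B" and ann: "\<And>v. v \<in> B \<Longrightarrow> \<exists>cs. \<forall>H\<in>S. foldr (X v) cs H = 0" and "H \<in> S"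
  shows "H \<in> span (joint_gen_eigen B)"
  using assms
proof (induction B arbitrary: H rule: finite_induct)
  case empty
  then show ?case by (auto intro!: span_base simp: joint_gen_eigen_def)
next
  case (insert b B)
  have "joint_gen_eigen B \<subseteq> span (joint_gen_eigen (insert b B))"
  proof
    fix G assume "G \<in> joint_gen_eigen B"
    then obtain c n where GS: "G \<in> S" and G: "\<And>v. v \<in> B \<Longrightarrow> (X v (c v) ^^ n v) G = 0"
      unfolding joint_gen_eigen_def by simp metis
    \<comment> \<open>Vectors annihilated by the same powers as G form an invariant subspace, so the
      primary decomposition for b stays inside it.\<close>
    define S' where "S' = {G \<in> S. \<forall>v\<in>B. (X v (c v) ^^ n v) G = 0}"
    have Tn: "(X v d ^^ m) (T u x) = T u ((X v d ^^ m) x)" if "x \<in> S" for v d m u x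
      using that by (induction m) (simp_all add: X_T Xn_in)
    interpret S': commuting_family scale S' T
    proof
      show "subspace S'"
        by (rule subspaceI) (auto simp: S'_def zero_in add_in scale_in Xn_add Xn_scale Xn_zero)
      show "T v x \<in> S'" if "x \<in> S'" for v x
      proof -
        have "T v 0 = 0" for v using T_scale[OF zero_in, of v 0] by simp
        then show ?thesis using that by (auto simp: S'_def closed Tn)
      qed
    qed (auto simp: S'_def T_add T_scale T_commute)

    obtain cs where "\<forall>H\<in>S. foldr (X b) cs H = 0" using insert.prems(1)[OF insertI1] by (elim exE)
    note cs = bspec[OF this]
    have "G \<in> S'" using GS G by (auto simp: S'_def)
    moreover have "foldr (X b) cs G = 0" by (rule cs[OF GS])
    ultimately have "\<exists>F. (\<forall>c\<in>set cs. F c \<in> S' \<and> (X b c ^^ length cs) (F c) = 0) \<and> G = (\<Sum>c\<in>set cs. F c)"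
      by (rule S'.primary_decomposition)
    then obtain F where FS: "\<forall>c\<in>set cs. F c \<in> S' \<and> (X b c ^^ length cs) (F c) = 0"
      and GF: "G = (\<Sum>c\<in>set cs. F c)" by (elim exE conjE)
    have "F d \<in> joint_gen_eigen (insert b B)" if "d \<in> set cs" for d
    proof -
      have "F d \<in> S" "\<forall>v\<in>B. (X v (c v) ^^ n v) (F d) = 0" "(X b d ^^ length cs) (F d) = 0"
        using bspec[OF FS that] by (simp_all add: S'_def)
      then have "\<exists>c n. (X v c ^^ n) (F d) = 0" if "v \<in> insert b B" for v
        using that by (cases "v = b") auto
      then show ?thesis using \<open>F d \<in> S\<close> by (simp add: joint_gen_eigen_def)
    qed
    then show "G \<in> span (joint_gen_eigen (insert b B))"
      unfolding GF by (intro span_sum span_base)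
  qed
  moreover have "H \<in> span (joint_gen_eigen B)"
    using insert by blast
  ultimately show ?case
    by (metis span_mono span_span subset_iff)
qed

text \<open>From a vector that is not a joint eigenvector, applying the operators
  \<open>X a (c a)\<close> as long as the result is still not one leads to a vector of rank two,
  which \<open>no_rank_two\<close> forbids.\<close>

lemma joint_gen_eigen_semisimple:
  assumes B: "finite B"
    and gen: "\<And>v. v \<in> B \<Longrightarrow> (X v (c v) ^^ n v) G = 0" and G: "G \<in> S"
    and no_rank_two: "\<And>H. H \<in> S \<Longrightarrow> (\<And>u v. u \<in> B \<Longrightarrow> v \<in> B \<Longrightarrow> X u (c u) (X v (c v) H) = 0) \<Longrightarrow>
      (\<And>v. v \<in> B \<Longrightarrow> X v (c v) H = 0)"
    and v: "v \<in> B"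
  shows "X v (c v) G = 0"
proof (rule ccontr)
  assume non: "X v (c v) G \<noteq> 0"
  \<comment> \<open>H is not a joint eigenvector, but the operators of A already annihilate all its
    images under the \<open>X v (c v)\<close>; A grows to B one element at a time.\<close>
  define P where "P A H \<longleftrightarrow> H \<in> S \<and> (\<forall>v\<in>B. (X v (c v) ^^ n v) H = 0) \<and> (\<exists>v\<in>B. X v (c v) H \<noteq> 0) \<and>
    (\<forall>a\<in>A. \<forall>v\<in>B. X a (c a) (X v (c v) H) = 0)" for A H
  have "\<exists>H. P A H" if "finite A" "A \<subseteq> B" for A
    using that
  proof (induction A rule: finite_induct)
    case empty
    then show ?case using G gen non v by (auto simp: P_def)
  next
    case (insert a A)
    then obtain H where H: "P A H" by auto
    have HS: "H \<in> S" using H by (simp add: P_def)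
    define alive where "alive m \<longleftrightarrow> (\<exists>v\<in>B. X v (c v) ((X a (c a) ^^ m) H) \<noteq> 0)" for m
    have "alive 0" using H by (simp add: alive_def P_def)
    have dead: "m < n a" if "alive m" for m
    proof (rule ccontr)
      assume "\<not> m < n a"
      moreover have "(X a (c a) ^^ n a) H = 0" using H insert.prems by (simp add: P_def)
      ultimately have "(X a (c a) ^^ m) H = 0" using Xn_mono[OF HS] by simp
      then show False using that by (simp add: alive_def X_zero)
    qed
    \<comment> \<open>The last power that still fails to give a joint eigenvector; nilpotency on H
      bounds it by n a.\<close>
    define m where "m = (GREATEST m. alive m)"
    have m: "alive m" "\<not> alive (Suc m)"
    proof -
      show "alive m" unfolding m_def using \<open>alive 0\<close> dead by (intro GreatestI_nat[of alive 0 "n a"]) (auto intro: less_imp_le)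
      show "\<not> alive (Suc m)"
        unfolding m_def using Greatest_le_nat[of alive "Suc (GREATEST m. alive m)" "n a"] dead by (force intro: less_imp_le)
    qed
    define K where "K = (X a (c a) ^^ m) H"
    have KS: "K \<in> S" unfolding K_def by (rule Xn_in[OF HS])
    have "(X v (c v) ^^ l) ((X a (c a) ^^ m) H) = (X a (c a) ^^ m) ((X v (c v) ^^ l) H)" for v l
      by (induction l) (simp_all add: HS Xn_in Xn_commute)
    then have "(X v (c v) ^^ n v) K = 0" if "v \<in> B" for v
      using H that by (simp add: K_def P_def Xn_zero)
    moreover have "\<exists>v\<in>B. X v (c v) K \<noteq> 0" using m(1) by (simp add: alive_def K_def)
    moreover have "X a (c a) (X v (c v) K) = 0" if "v \<in> B" for v
    proof -
      have "X v (c v) (X a (c a) K) = 0" using m(2) that by (simp add: alive_def K_def)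
      then show ?thesis by (simp add: X_commute[OF KS])
    qed
    moreover have "X a' (c a') (X v (c v) K) = 0" if "a' \<in> A" "v \<in> B" for a' v
    proof -
      have "X a' (c a') (X v (c v) K) = (X a (c a) ^^ m) (X a' (c a') (X v (c v) H))"
        unfolding K_def by (simp add: HS Xn_commute X_in)
      then show ?thesis using H that by (simp add: P_def Xn_zero)
    qed
    ultimately have "P (insert a A) K" using KS by (auto simp: P_def)
    then show ?case by blast
  qed
  from this[OF B order_refl] obtain H where "P B H" by blast
  then show False using no_rank_two[of H] by (auto simp: P_def)
qed

end

section \<open>Roots and reflections\<close>

text \<open>The vector that represents \<alpha> through the inner product of V. Coroots are positive
  multiples of it, so pairings of roots can be computed and compared in sign inside V.\<close>

definition riesz :: "'a::euclidean_space dual \<Rightarrow> 'a" where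
  "riesz \<alpha> = (\<Sum>b\<in>Basis. \<alpha> b *\<^sub>R b)"

lemma apply_eq_inner: "blinfun_apply \<alpha> v = riesz \<alpha> \<bullet> v"
  unfolding riesz_def by (rule blinfun_eq_inner)

lemma riesz_eq_iff: "riesz \<alpha> = riesz \<beta> \<longleftrightarrow> \<alpha> = \<beta>"
  by (metis apply_eq_inner blinfun_eqI)

lemma linear_riesz: "linear riesz"
  by (rule linearI) (simp_all add: riesz_def blinfun.add_left blinfun.scaleR_left scaleR_add_left
      sum.distrib scaleR_sum_right)

lemma norm_riesz: "norm (riesz \<alpha>) = norm \<alpha>"
proof -
  have "(norm (riesz \<alpha>))\<^sup>2 = (norm \<alpha>)\<^sup>2"
    unfolding dual_inner_self[symmetric] blinfun_eq_dual_inner[symmetric] riesz_def[symmetric]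
    by (simp add: apply_eq_inner dot_square_norm)
  then show ?thesis by simp
qed

lemma coroot_eq_riesz: "coroot \<alpha> = (2 / (norm \<alpha>)\<^sup>2) *\<^sub>R riesz \<alpha>"
  by (simp add: coroot_def riesz_def)

lemma apply_coroot_self: "\<alpha> \<noteq> 0 \<Longrightarrow> blinfun_apply \<alpha> (coroot \<alpha>) = 2"
  by (simp add: coroot_characterization dual_inner_self)

lemma apply_coroot_pos_iff: "\<alpha> \<noteq> 0 \<Longrightarrow> 0 < blinfun_apply \<xi> (coroot \<alpha>) \<longleftrightarrow> 0 < riesz \<xi> \<bullet> riesz \<alpha>"
  by (simp add: coroot_eq_riesz apply_eq_inner zero_less_divide_iff)

lemma linear_reflection: "linear (reflection \<alpha>)"
  by (rule linearI) (simp_all add: reflection_def blinfun.add_right blinfun.scaleR_right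
      scaleR_add_left scaleR_diff_right)

lemma inv_reflection: "inv (reflection \<alpha>) = reflection \<alpha>"
  by (rule inv_unique_comp) (auto simp: fun_eq_iff reflection_reflection)

lemma bij_reflection: "bij (reflection \<alpha>)"
  by (rule o_bij[of "reflection \<alpha>"]) (auto simp: fun_eq_iff reflection_reflection)

lemma dual_reflection_apply: "blinfun_apply (dual_reflection \<alpha> \<xi>) v = \<xi> (reflection \<alpha> v)"
  by (simp add: dual_reflection_def reflection_def blinfun.diff_left blinfun.scaleR_left
      blinfun.diff_right blinfun.scaleR_right)

lemma dual_reflection_dual_reflection: "dual_reflection \<alpha> (dual_reflection \<alpha> \<xi>) = \<xi>"
  by (rule blinfun_eqI) (simp add: dual_reflection_apply reflection_reflection)

lemma reflection_inner: "reflection \<alpha> u \<bullet> v = u \<bullet> reflection \<alpha> v"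
  by (simp add: reflection_def coroot_eq_riesz apply_eq_inner inner_diff_left inner_diff_right inner_commute)

lemma riesz_dual_reflection: "riesz (dual_reflection \<alpha> \<xi>) = reflection \<alpha> (riesz \<xi>)"
proof (rule vector_eq_rdot[THEN iffD1, rule_format])
  fix v show "riesz (dual_reflection \<alpha> \<xi>) \<bullet> v = reflection \<alpha> (riesz \<xi>) \<bullet> v"
    by (simp add: dual_reflection_apply reflection_inner flip: apply_eq_inner)
qed

lemma norm_dual_reflection: "norm (dual_reflection \<alpha> \<xi>) = norm \<xi>"
proof -
  have "norm (reflection \<alpha> (riesz \<xi>)) = norm (riesz \<xi>)"
    by (simp add: norm_eq_sqrt_inner reflection_inner reflection_reflection)
  then show ?thesis by (simp add: riesz_dual_reflection flip: norm_riesz)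
qed

lemma coroot_dual_reflection: "coroot (dual_reflection \<alpha> \<xi>) = reflection \<alpha> (coroot \<xi>)"
  by (simp add: coroot_eq_riesz norm_dual_reflection riesz_dual_reflection linear_scale[OF linear_reflection])

lemma coroot_uminus: "coroot (- \<alpha>) = - coroot \<alpha>"
  by (simp add: coroot_eq_riesz linear_neg[OF linear_riesz])

lemma reflection_dual_reflection:
  "reflection (dual_reflection \<alpha> \<xi>) = reflection \<alpha> \<circ> reflection \<xi> \<circ> reflection \<alpha>"
  by (simp add: fun_eq_iff reflection_def[of "dual_reflection \<alpha> \<xi>"] dual_reflection_apply coroot_dual_reflection
      reflection_def[of \<xi>] linear_diff[OF linear_reflection] linear_scale[OF linear_reflection] reflection_reflection)

lemma reflection_uminus: "reflection (- \<alpha>) = reflection \<alpha>"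
  by (simp add: fun_eq_iff reflection_def coroot_uminus blinfun.minus_left)

section \<open>Reflections of affine functionals\<close>

definition affine_dual_reflection :: "'a::euclidean_space dual \<times> real \<Rightarrow> 'a dual \<times> real \<Rightarrow> 'a dual \<times> real" where
  "affine_dual_reflection b z = z - fst z (coroot (fst b)) *\<^sub>R b"

lemma fst_affine_dual_reflection: "fst (affine_dual_reflection b z) = dual_reflection (fst b) (fst z)"
  by (simp add: affine_dual_reflection_def dual_reflection_def)

lemma aff_eval_affine_dual_reflection: "aff_eval (affine_dual_reflection b z) v = aff_eval z (aff_reflection b v)"
  by (simp add: aff_eval_def affine_dual_reflection_def aff_reflection_def blinfun.diff_left blinfun.scaleR_left
      blinfun.diff_right blinfun.scaleR_right blinfun.add_right algebra_simps)

lemma aff_reflection_aff_reflection: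
  assumes "fst b \<noteq> 0" shows "aff_reflection b (aff_reflection b v) = v"
proof -
  have "aff_eval b (aff_reflection b v) = - aff_eval b v"
    by (simp add: aff_reflection_def aff_eval_def blinfun.diff_right blinfun.scaleR_right
        apply_coroot_self[OF assms])
  then show ?thesis by (simp add: aff_reflection_def[of b "aff_reflection b v"]) (simp add: aff_reflection_def)
qed

lemma aff_reflection_affine_dual_reflection:
  assumes "fst b \<noteq> 0"
  shows "aff_reflection (affine_dual_reflection b z) = aff_reflection b \<circ> aff_reflection z \<circ> aff_reflection b"
proof
  fix v
  have lin: "aff_reflection b (u - c *\<^sub>R y) = aff_reflection b u - c *\<^sub>R reflection (fst b) y" for u y c
    by (simp add: aff_reflection_def aff_eval_def reflection_def blinfun.diff_right blinfun.scaleR_right algebra_simps)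
  have "(aff_reflection b \<circ> aff_reflection z \<circ> aff_reflection b) v =
      aff_reflection b (aff_reflection b v - aff_eval z (aff_reflection b v) *\<^sub>R coroot (fst z))"
    by (simp add: aff_reflection_def[of z])
  also have "\<dots> = v - aff_eval z (aff_reflection b v) *\<^sub>R reflection (fst b) (coroot (fst z))"
    by (simp only: lin aff_reflection_aff_reflection[OF assms])
  also have "\<dots> = aff_reflection (affine_dual_reflection b z) v"
    by (simp add: aff_reflection_def[of "affine_dual_reflection b z"] aff_eval_affine_dual_reflection
        fst_affine_dual_reflection coroot_dual_reflection)
  finally show "aff_reflection (affine_dual_reflection b z) v = (aff_reflection b \<circ> aff_reflection z \<circ> aff_reflection b) v" by simp
qed

lemma aff_reflection_linear_root: "aff_reflection (\<alpha>, 0) = reflection \<alpha>"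
  by (simp add: fun_eq_iff aff_reflection_def reflection_def aff_eval_def)

lemma aff_reflection_uminus: "aff_reflection (- z) = aff_reflection z"
  by (simp add: fun_eq_iff aff_reflection_def aff_eval_def coroot_uminus blinfun.minus_left algebra_simps)

text \<open>Descent on the height of a positive root, simultaneously for the finite and the affine root system.\<close>

lemma positive_root_induct:
  fixes Bs Z :: "('a::euclidean_space dual \<times> real) set"
  assumes fin: "finite Bs"
    and indep: "\<And>e. (\<Sum>b\<in>Bs. e b *\<^sub>R b) = 0 \<Longrightarrow> (\<And>b. b \<in> Bs \<Longrightarrow> e b = 0)"
    and Bs: "Bs \<subseteq> Z" and nonzero: "\<And>z. z \<in> Z \<Longrightarrow> fst z \<noteq> 0"
    and sign: "\<And>z. z \<in> Z \<Longrightarrow> (\<exists>c :: _ \<Rightarrow> nat. z = (\<Sum>b\<in>Bs. real (c b) *\<^sub>R b)) \<or> (\<exists>c :: _ \<Rightarrow> nat. - z = (\<Sum>b\<in>Bs. real (c b) *\<^sub>R b))"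
    and stable: "\<And>b z. b \<in> Bs \<Longrightarrow> z \<in> Z \<Longrightarrow> affine_dual_reflection b z \<in> Z"
    and crystallographic: "\<And>b z. b \<in> Bs \<Longrightarrow> z \<in> Z \<Longrightarrow> fst z (coroot (fst b)) \<in> \<int>"
    and reduced: "\<And>b c. b \<in> Bs \<Longrightarrow> c *\<^sub>R b \<in> Z \<Longrightarrow> c = 1 \<or> c = -1"
    and base: "\<And>b. b \<in> Bs \<Longrightarrow> P b"
    and step: "\<And>b z. b \<in> Bs \<Longrightarrow> z \<in> Z \<Longrightarrow> P (affine_dual_reflection b z) \<Longrightarrow> P z"
    and uminus: "\<And>z. z \<in> Z \<Longrightarrow> P (- z) \<Longrightarrow> P z"
    and Zneg: "\<And>z. z \<in> Z \<Longrightarrow> - z \<in> Z"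
    and "z \<in> Z"
  shows "P z"
proof -
  have pos: "P z" if "z \<in> Z" "z = (\<Sum>b\<in>Bs. real (c b) *\<^sub>R b)" for z and c :: "_ \<Rightarrow> nat"
    using that
  proof (induction "sum c Bs" arbitrary: z c rule: less_induct)
    case less
    have z: "riesz (fst z) = (\<Sum>b\<in>Bs. real (c b) *\<^sub>R riesz (fst b))"
      by (subst less.prems(2)) (simp add: fst_sum linear_sum[OF linear_riesz] linear_scale[OF linear_riesz])
    \<comment> \<open>The squared length of the gradient is positive, so some basis element with
      positive coefficient pairs positively with z. The gradients of an affine basis are linearly
      dependent, but this step does not compare their coefficients.\<close>
    have "riesz (fst z) \<noteq> 0"
      using nonzero[OF less.prems(1)] norm_riesz[of "fst z"] by auto
    then have "0 < riesz (fst z) \<bullet> riesz (fst z)" by simp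
    also have "riesz (fst z) \<bullet> riesz (fst z) = (\<Sum>b\<in>Bs. real (c b) * (riesz (fst z) \<bullet> riesz (fst b)))"
      by (subst (2) z) (simp add: inner_sum_right)
    finally obtain b where b: "b \<in> Bs" and "0 < real (c b) * (riesz (fst z) \<bullet> riesz (fst b))"
      by (metis (no_types, lifting) not_less sum_nonpos)
    then have inner: "0 < riesz (fst z) \<bullet> riesz (fst b)" by (simp add: zero_less_mult_iff)
    define n where "n = fst z (coroot (fst b))"
    have "0 < n" unfolding n_def using inner nonzero[OF subsetD[OF Bs b]] by (subst apply_coroot_pos_iff) simp_all
    moreover have "n \<in> \<int>" unfolding n_def by (rule crystallographic[OF b less.prems(1)])
    ultimately obtain m :: nat where m: "n = real m" "0 < m"
      by (metis Ints_cases less_imp_le of_int_0_less_iff of_int_of_nat_eq of_nat_0_less_iff zero_le_imp_eq_int)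
    let ?z = "affine_dual_reflection b z"
    have zZ: "?z \<in> Z" by (rule stable[OF b less.prems(1)])
    have z': "?z = z - n *\<^sub>R b" by (simp add: affine_dual_reflection_def n_def)
    have nb: "n *\<^sub>R b = (\<Sum>a\<in>Bs. (if a = b then n else 0) *\<^sub>R a)"
    proof -
      have "(\<Sum>a\<in>Bs. (if a = b then n else 0) *\<^sub>R a) = (\<Sum>a\<in>Bs. if a = b then n *\<^sub>R b else 0)"
        by (rule sum.cong) auto
      then show ?thesis using fin b by simp
    qed
    from sign[OF zZ] show "P z"
    proof (elim disjE exE)
      fix c' :: "_ \<Rightarrow> nat" assume c': "?z = (\<Sum>b\<in>Bs. real (c' b) *\<^sub>R b)"
      have "(\<Sum>a\<in>Bs. (real (c' a) + (if a = b then n else 0) - real (c a)) *\<^sub>R a) = ?z + n *\<^sub>R b - z"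
        by (simp add: c' nb scaleR_add_left scaleR_diff_left sum.distrib sum_subtractf flip: less.prems(2))
      also have "\<dots> = 0" by (simp add: z')
      finally have "real (c' a) + (if a = b then n else 0) - real (c a) = 0" if "a \<in> Bs" for a
        using that by (rule indep)
      then have eq: "c a = c' a + (if a = b then m else 0)" if "a \<in> Bs" for a
        using that by (fastforce simp: m)
      then have "sum c' Bs < sum c Bs"
        using fin b m(2) by (intro sum_strict_mono_ex1) auto
      then have "P ?z" using zZ c' by (rule less.hyps)
      then show "P z" by (rule step[OF b less.prems(1)])
    next
      \<comment> \<open>The reflection has made z negative: by comparison of coefficients all of
        them except that of b vanish, and reducedness leaves z = b.\<close>
      fix d :: "_ \<Rightarrow> nat" assume d: "- ?z = (\<Sum>b\<in>Bs. real (d b) *\<^sub>R b)"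
      have "(\<Sum>a\<in>Bs. (real (c a) + real (d a) - (if a = b then n else 0)) *\<^sub>R a) = z + (- ?z) - n *\<^sub>R b"
        by (simp add: d nb scaleR_add_left scaleR_diff_left sum.distrib sum_subtractf flip: less.prems(2))
      also have "\<dots> = 0" by (simp add: z')
      finally have eq: "real (c a) + real (d a) - (if a = b then n else 0) = 0" if "a \<in> Bs" for a
        using that by (rule indep)
      have "c a = 0" if "a \<in> Bs" "a \<noteq> b" for a using eq[OF that(1)] that(2) by simp
      then have "z = (\<Sum>a\<in>Bs. if a = b then real (c b) *\<^sub>R b else 0)"
        by (subst less.prems(2)) (rule sum.cong, auto)
      then have zb: "z = real (c b) *\<^sub>R b" using fin b by simp
      have "real (c b) *\<^sub>R b \<in> Z" using less.prems(1) zb by simp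
      from reduced[OF b this] have "real (c b) = 1" by linarith
      then have "z = b" using zb by simp
      then show "P z" using base[OF b] by simp
    qed
  qed
  from sign[OF \<open>z \<in> Z\<close>] show "P z"
    using pos[OF \<open>z \<in> Z\<close>] pos[OF Zneg[OF \<open>z \<in> Z\<close>]] uminus[OF \<open>z \<in> Z\<close>] by blast
qed

lemma transformation_group_mono:
  assumes "S \<subseteq> transformation_group S'" shows "transformation_group S \<subseteq> transformation_group S'"
proof
  fix w assume "w \<in> transformation_group S"
  then show "w \<in> transformation_group S'"
  proof induction
    case (generator s) then show ?case using assms by (rule subsetD[rotated])
  qed (rule transformation_group.intros; assumption)+
qed

section \<open>Root data\<close>

text \<open>\<open>inv\<close> is defined by choice; bijectivity of all group elements makes it a
  genuine inverse.\<close>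

lemma inv_in_involutions:
  assumes "\<And>s. s \<in> S \<Longrightarrow> s \<circ> s = id" "w \<in> transformation_group S"
  shows "bij w"
  using assms(2)
proof induction
  case (generator s)
  then show ?case using assms(1) by (intro o_bij[of s s]) auto
qed (rule bij_id bij_comp bij_imp_bij_inv; assumption?)+

text \<open>The inductive definition closes under products and inverses in any order; with
  involutive generators every element arises by multiplying generators on the left.\<close>

lemma transformation_group_left_induct:
  assumes inv: "\<And>s. s \<in> S \<Longrightarrow> s \<circ> s = id" and w: "w \<in> transformation_group S"
    and id: "P id" and step: "\<And>s w. s \<in> S \<Longrightarrow> w \<in> transformation_group S \<Longrightarrow> P w \<Longrightarrow> P (s \<circ> w)"
  shows "P w"
proof -
  let ?T = "transformation_group S"
  \<comment> \<open>Left multiplication by u is carried together with that by \<open>inv u\<close>,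
    since the constructor \<open>inverse\<close> exchanges the two.\<close>
  have "\<forall>w\<in>?T. P w \<longrightarrow> P (u \<circ> w) \<and> P (inv u \<circ> w)" if "u \<in> ?T" for u
    using that
  proof induction
    case (generator s)
    then have "inv s = s" using inv by (intro inv_unique_comp) auto
    then show ?case using step[OF generator] by metis
  next
    case identity
    then show ?case by (metis comp_id fun.map_id id_comp inv_id)
  next
    case (product u v)
    have "inv (u \<circ> v) = inv v \<circ> inv u"
      using product inv_in_involutions[OF inv] by (intro o_inv_distrib) auto
    show ?case
    proof (intro ballI impI)
      fix w assume w: "w \<in> ?T" "P w"
      have "v \<circ> w \<in> ?T" "inv u \<circ> w \<in> ?T"
        using product.hyps w(1) by (auto intro: transformation_group.intros)
      then have "P (u \<circ> (v \<circ> w)) \<and> P (inv v \<circ> (inv u \<circ> w))"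
        using product.IH w by blast
      then show "P ((u \<circ> v) \<circ> w) \<and> P (inv (u \<circ> v) \<circ> w)"
        unfolding \<open>inv (u \<circ> v) = inv v \<circ> inv u\<close> comp_assoc .
    qed
  next
    case (inverse u)
    then have "inv (inv u) = u" using inv_in_involutions[OF inv] by (intro inv_inv_eq) auto
    then show ?case using inverse by metis
  qed
  from this[OF w] have "P (w \<circ> id)" using id transformation_group.identity by blast
  then show ?thesis by (simp only: comp_id)
qed

lemma nonneg_comb_add: "nonneg_comb B x \<Longrightarrow> nonneg_comb B y \<Longrightarrow> nonneg_comb B (x + y)"
proof -
  assume "nonneg_comb B x" "nonneg_comb B y"
  then obtain c d where "x = (\<Sum>\<beta>\<in>B. real (c \<beta>) *\<^sub>R \<beta>)" "y = (\<Sum>\<beta>\<in>B. real (d \<beta>) *\<^sub>R \<beta>)"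
    unfolding nonneg_comb_def by blast
  then have "x + y = (\<Sum>\<beta>\<in>B. real (c \<beta> + d \<beta>) *\<^sub>R \<beta>)"
    by (simp add: scaleR_add_left sum.distrib)
  then show ?thesis unfolding nonneg_comb_def by (intro exI[of _ "\<lambda>\<beta>. c \<beta> + d \<beta>"])
qed

lemma nonneg_comb_scale: "nonneg_comb B x \<Longrightarrow> nonneg_comb B (real n *\<^sub>R x)"
proof -
  assume "nonneg_comb B x"
  then obtain c where "x = (\<Sum>\<beta>\<in>B. real (c \<beta>) *\<^sub>R \<beta>)" unfolding nonneg_comb_def by blast
  then have "real n *\<^sub>R x = (\<Sum>\<beta>\<in>B. real (n * c \<beta>) *\<^sub>R \<beta>)"
    by (simp add: scaleR_sum_right)
  then show ?thesis unfolding nonneg_comb_def by (intro exI[of _ "\<lambda>\<beta>. n * c \<beta>"])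
qed

lemma nonneg_comb_base: "finite B \<Longrightarrow> \<beta> \<in> B \<Longrightarrow> nonneg_comb B \<beta>"
proof -
  assume B: "finite B" "\<beta> \<in> B"
  have "(\<Sum>b\<in>B. real (if b = \<beta> then 1 else 0) *\<^sub>R b) = (\<Sum>b\<in>B. if b = \<beta> then b else 0)"
    by (rule sum.cong) auto
  also have "\<dots> = \<beta>" using B by simp
  finally show ?thesis unfolding nonneg_comb_def by (intro exI[of _ "\<lambda>b. if b = \<beta> then 1 else 0"]) simp
qed

locale root_data =
  fixes R B :: "'a::euclidean_space dual set" and \<phi> :: "'a dual" and k :: "'a dual \<times> real \<Rightarrow> real"
  assumes root_system: "root_system R" and reduced_roots: "reduced_roots R"
    and root_basis: "root_basis R B" and highest_root: "highest_root R B \<phi>"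
    and multiplicity: "multiplicity_function R k"
begin

abbreviation "W \<equiv> weyl_group R"

lemma finite_R: "finite R" and R_nonzero: "\<alpha> \<in> R \<Longrightarrow> \<alpha> \<noteq> 0" and span_R: "span R = UNIV"
  using root_system by (auto simp: root_system_def)

lemma R_reflection: "\<alpha> \<in> R \<Longrightarrow> \<beta> \<in> R \<Longrightarrow> dual_reflection \<alpha> \<beta> \<in> R"
  using root_system unfolding root_system_def by blast

lemma R_integer: "\<alpha> \<in> R \<Longrightarrow> \<beta> \<in> R \<Longrightarrow> blinfun_apply \<beta> (coroot \<alpha>) \<in> \<int>"
  using root_system unfolding root_system_def by blast

lemma coroot_pairing: "\<alpha> \<in> R \<Longrightarrow> blinfun_apply \<alpha> (coroot \<alpha>) = 2"
  by (rule apply_coroot_self[OF R_nonzero])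

lemma dual_reflection_self: "\<alpha> \<in> R \<Longrightarrow> dual_reflection \<alpha> \<alpha> = - \<alpha>"
  by (simp add: dual_reflection_def coroot_pairing scaleR_2)

lemma R_uminus: "\<alpha> \<in> R \<Longrightarrow> - \<alpha> \<in> R"
  using R_reflection[of \<alpha> \<alpha>] by (simp add: dual_reflection_self)

lemma R_scaleR: "\<alpha> \<in> R \<Longrightarrow> c *\<^sub>R \<alpha> \<in> R \<Longrightarrow> c = 1 \<or> c = -1"
  using reduced_roots unfolding reduced_roots_def by blast

lemma B_sub: "\<beta> \<in> B \<Longrightarrow> \<beta> \<in> R" and finite_B: "finite B" and independent_B: "independent B"
  and R_sign: "\<alpha> \<in> R \<Longrightarrow> nonneg_comb B \<alpha> \<or> nonneg_comb B (- \<alpha>)"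
  using root_basis finite_R by (auto simp: root_basis_def intro: finite_subset)

lemma phi_in: "\<phi> \<in> R" and phi_highest: "\<alpha> \<in> R \<Longrightarrow> nonneg_comb B (\<phi> - \<alpha>)"
  using highest_root by (auto simp: highest_root_def)

lemma B_coeffs_zero: "(\<Sum>\<beta>\<in>B. e \<beta> *\<^sub>R \<beta>) = 0 \<Longrightarrow> \<beta> \<in> B \<Longrightarrow> e \<beta> = 0"
  using independentD[OF independent_B finite_B order_refl] by blast

lemma nonneg_comb_antisym:
  assumes "nonneg_comb B x" "nonneg_comb B (- x)"
  shows "x = 0"
proof -
  from assms obtain c d where c: "x = (\<Sum>\<beta>\<in>B. real (c \<beta>) *\<^sub>R \<beta>)" and d: "- x = (\<Sum>\<beta>\<in>B. real (d \<beta>) *\<^sub>R \<beta>)"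
    unfolding nonneg_comb_def by blast
  have "(\<Sum>\<beta>\<in>B. (real (c \<beta>) + real (d \<beta>)) *\<^sub>R \<beta>) = x + - x"
    unfolding d by (subst c) (simp add: scaleR_add_left sum.distrib)
  then have "real (c \<beta>) + real (d \<beta>) = 0" if "\<beta> \<in> B" for \<beta>
    using B_coeffs_zero[OF _ that] by simp
  then have "c \<beta> = 0" if "\<beta> \<in> B" for \<beta>
    using that by fastforce
  then show ?thesis using c by simp
qed

lemma kernel_zero:
  assumes "\<And>\<alpha>. \<alpha> \<in> R \<Longrightarrow> blinfun_apply \<alpha> y = 0"
  shows "y = 0"
proof -
  have "linear (\<lambda>\<alpha> :: 'a dual. blinfun_apply \<alpha> y)"
    by (rule linearI) (simp_all add: blinfun.add_left blinfun.scaleR_left)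
  then have "blinfun_apply (blinfun_inner_left y) y = 0"
    using linear_eq_0_on_span[of "\<lambda>\<alpha>. blinfun_apply \<alpha> y" R] assms span_R by blast
  then show ?thesis by simp
qed

text \<open>A vector orthogonal to all coroots is annihilated by all roots, and these span the
  dual.\<close>

lemma span_coroots: "span (coroot ` R) = UNIV"
proof (rule ccontr)
  assume "span (coroot ` R) \<noteq> UNIV"
  then have "span (coroot ` R) \<subset> span UNIV" by auto
  then obtain y where y: "y \<noteq> 0" "\<And>z. z \<in> span (coroot ` R) \<Longrightarrow> orthogonal y z"
    using orthogonal_to_subspace_exists_gen by metis
  have "blinfun_apply \<alpha> y = 0" if "\<alpha> \<in> R" for \<alpha>
  proof -
    have "y \<bullet> coroot \<alpha> = 0" using y(2)[OF span_base] that by (simp add: orthogonal_def)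
    then show ?thesis using R_nonzero[OF that] by (simp add: coroot_eq_riesz apply_eq_inner inner_commute)
  qed
  then show False using kernel_zero y(1) by blast
qed

lemma linear_zero_coroots:
  assumes "linear f" "\<And>\<alpha>. \<alpha> \<in> R \<Longrightarrow> f (coroot \<alpha>) = 0"
  shows "f v = 0"
  using linear_eq_0_on_span[OF assms(1), of "coroot ` R" v] assms(2) by (auto simp: span_coroots)

text \<open>Evaluated at the vectors \<open>riesz \<alpha>\<close>, f is largest at \<phi> because
  every \<phi> - \<alpha> is a nonnegative combination of simple roots. So f \<le> 0 at all roots,
  and the symmetry R = - R turns this into f = 0. Both maximum principles end here.\<close>

lemma dominant_nonpos_zero:
  fixes f :: "'a \<Rightarrow> real"
  assumes f: "linear f" and dom: "\<And>\<beta>. \<beta> \<in> B \<Longrightarrow> 0 \<le> f (coroot \<beta>)" and phi: "f (coroot \<phi>) \<le> 0"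
  shows "f v = 0"
proof (rule linear_zero_coroots[OF f])
  have fr: "f (riesz \<alpha>) = (norm \<alpha>)\<^sup>2 / 2 * f (coroot \<alpha>)" if "\<alpha> \<in> R" for \<alpha>
    using R_nonzero[OF that] by (simp add: coroot_eq_riesz linear_scale[OF f])
  have comb: "0 \<le> f (riesz x)" if x: "nonneg_comb B x" for x
  proof -
    from x obtain c where c: "x = (\<Sum>\<beta>\<in>B. real (c \<beta>) *\<^sub>R \<beta>)" unfolding nonneg_comb_def by blast
    have "0 \<le> f (riesz \<beta>)" if "\<beta> \<in> B" for \<beta>
      unfolding fr[OF B_sub[OF that]] using dom[OF that] by (intro mult_nonneg_nonneg) auto
    then show ?thesis
      unfolding c by (simp add: linear_sum[OF linear_riesz] linear_scale[OF linear_riesz]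
          linear_sum[OF f] linear_scale[OF f] sum_nonneg)
  qed
  have le: "f (riesz \<alpha>) \<le> 0" if "\<alpha> \<in> R" for \<alpha>
  proof -
    have "f (riesz \<phi>) \<le> 0" unfolding fr[OF phi_in] using phi by (simp add: mult_nonneg_nonpos)
    then show ?thesis
      using comb[OF phi_highest[OF that]] by (simp add: linear_diff[OF linear_riesz] linear_diff[OF f])
  qed
  fix \<alpha> assume \<alpha>: "\<alpha> \<in> R"
  have "f (riesz \<alpha>) = 0"
    using le[OF \<alpha>] le[OF R_uminus[OF \<alpha>]] by (simp add: linear_neg[OF linear_riesz] linear_neg[OF f])
  then show "f (coroot \<alpha>) = 0" by (simp add: coroot_eq_riesz linear_scale[OF f])
qed

section \<open>The finite Weyl group\<close>

lemma W_id: "id \<in> W" and W_comp: "u \<in> W \<Longrightarrow> w \<in> W \<Longrightarrow> u \<circ> w \<in> W"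
  and W_inv: "w \<in> W \<Longrightarrow> inv w \<in> W" and W_reflection: "\<alpha> \<in> R \<Longrightarrow> reflection \<alpha> \<in> W"
  unfolding weyl_group_def by (auto intro: transformation_group.intros)

lemma W_roots:
  assumes "w \<in> W"
  shows "bij w \<and> linear w \<and> (\<forall>\<alpha>\<in>R. \<exists>\<beta>\<in>R. (\<forall>v. blinfun_apply \<beta> (w v) = blinfun_apply \<alpha> v) \<and> coroot \<beta> = w (coroot \<alpha>))"
  using assms unfolding weyl_group_def
proof induction
  case (generator s)
  then obtain \<gamma> where s: "s = reflection \<gamma>" "\<gamma> \<in> R" by blast
  have "\<exists>\<beta>\<in>R. (\<forall>v. blinfun_apply \<beta> (s v) = blinfun_apply \<alpha> v) \<and> coroot \<beta> = s (coroot \<alpha>)" if "\<alpha> \<in> R" for \<alpha>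
    using s that R_reflection[of \<gamma> \<alpha>]
    by (intro bexI[of _ "dual_reflection \<gamma> \<alpha>"]) (auto simp: dual_reflection_apply reflection_reflection coroot_dual_reflection)
  then show ?case using s by (simp add: bij_reflection linear_reflection)
next
  case identity
  show ?case by (intro conjI bij_id linear_id ballI) auto
next
  case (product u w)
  have "\<exists>\<beta>\<in>R. (\<forall>v. blinfun_apply \<beta> ((u \<circ> w) v) = blinfun_apply \<alpha> v) \<and> coroot \<beta> = (u \<circ> w) (coroot \<alpha>)" if "\<alpha> \<in> R" for \<alpha>
  proof -
    obtain \<beta> where \<beta>: "\<beta> \<in> R" "\<And>v. blinfun_apply \<beta> (w v) = blinfun_apply \<alpha> v" "coroot \<beta> = w (coroot \<alpha>)"
      using product.IH(2) \<open>\<alpha> \<in> R\<close> by blast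
    obtain \<gamma> where \<gamma>: "\<gamma> \<in> R" "\<And>v. blinfun_apply \<gamma> (u v) = blinfun_apply \<beta> v" "coroot \<gamma> = u (coroot \<beta>)"
      using product.IH(1) \<open>\<beta> \<in> R\<close> by blast
    show ?thesis using \<beta> \<gamma> by (intro bexI[of _ \<gamma>]) auto
  qed
  moreover have "bij (u \<circ> w)" "linear (u \<circ> w)"
    using product.IH by (blast intro: bij_comp linear_compose)+
  ultimately show ?case by blast
next
  case (inverse w)
  then obtain F where F: "\<And>\<alpha>. \<alpha> \<in> R \<Longrightarrow> F \<alpha> \<in> R" "\<And>\<alpha> v. \<alpha> \<in> R \<Longrightarrow> blinfun_apply (F \<alpha>) (w v) = blinfun_apply \<alpha> v"
      "\<And>\<alpha>. \<alpha> \<in> R \<Longrightarrow> coroot (F \<alpha>) = w (coroot \<alpha>)" by metis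
  have bij: "bij w" and lin: "linear w" using inverse.IH by auto
  \<comment> \<open>An injective self-map of the finite set R is a permutation; this supplies the
    preimage root needed for the inverse.\<close>
  have "inj_on F R"
  proof (rule inj_onI)
    fix \<alpha> \<beta> assume "\<alpha> \<in> R" "\<beta> \<in> R" "F \<alpha> = F \<beta>"
    then show "\<alpha> = \<beta>" using F(2) by (metis blinfun_eqI)
  qed
  moreover have "F ` R \<subseteq> R" using F(1) by blast
  ultimately have FR: "F ` R = R" using finite_R by (simp add: endo_inj_surj)
  have "\<exists>\<beta>\<in>R. (\<forall>v. blinfun_apply \<beta> (inv w v) = blinfun_apply \<alpha> v) \<and> coroot \<beta> = inv w (coroot \<alpha>)" if \<alpha>: "\<alpha> \<in> R" for \<alpha>
  proof -
    obtain \<beta> where \<beta>: "\<beta> \<in> R" "\<alpha> = F \<beta>" using FR \<alpha> by blast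
    have "blinfun_apply \<beta> (inv w v) = blinfun_apply \<alpha> v" for v
      using F(2)[OF \<beta>(1), of "inv w v"] \<beta>(2) bij by (simp add: bij_is_surj surj_f_inv_f)
    moreover have "coroot \<beta> = inv w (coroot \<alpha>)"
      using F(3)[OF \<beta>(1)] \<beta>(2) bij by (simp add: bij_is_inj inv_f_f)
    ultimately show ?thesis using \<beta>(1) by blast
  qed
  moreover have "linear (inv w)" using lin bij by (metis bij_is_inj bij_is_surj inj_linear_imp_inv_linear)
  ultimately show ?case using bij by (simp add: bij_imp_bij_inv)
qed

lemma W_bij: "w \<in> W \<Longrightarrow> bij w" and W_linear: "w \<in> W \<Longrightarrow> linear w"
  using W_roots by blast+

lemma W_inv_apply: "w \<in> W \<Longrightarrow> inv w (w v) = v" and W_apply_inv: "w \<in> W \<Longrightarrow> w (inv w v) = v"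
  using W_bij by (simp_all add: bij_is_inj bij_is_surj surj_f_inv_f)

lemma W_inv_inv: "w \<in> W \<Longrightarrow> inv (inv w) = w"
  using W_bij by (simp add: inv_inv_eq)

lemma W_inv_comp: "u \<in> W \<Longrightarrow> w \<in> W \<Longrightarrow> inv (u \<circ> w) = inv w \<circ> inv u"
  using W_bij by (simp add: o_inv_distrib)

text \<open>A group element is determined by the permutation that it induces on the finite spanning
  set of coroots.\<close>

lemma finite_W: "finite W"
proof -
  let ?C = "coroot ` R"
  have "inj_on (\<lambda>w. restrict w ?C) W"
  proof (rule inj_onI)
    fix u w assume uw: "u \<in> W" "w \<in> W" and eq: "restrict u ?C = restrict w ?C"
    have "u v - w v = 0" for v
    proof (rule linear_zero_coroots[where f = "\<lambda>v. u v - w v"])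
      show "linear (\<lambda>v. u v - w v)" by (intro linear_compose_sub W_linear uw)
      show "u (coroot \<alpha>) - w (coroot \<alpha>) = 0" if "\<alpha> \<in> R" for \<alpha>
        using fun_cong[OF eq, of "coroot \<alpha>"] that by simp
    qed
    then show "u = w" by (simp add: fun_eq_iff)
  qed
  moreover have "(\<lambda>w. restrict w ?C) ` W \<subseteq> ?C \<rightarrow>\<^sub>E ?C"
  proof
    fix f assume "f \<in> (\<lambda>w. restrict w ?C) ` W"
    then obtain w where w: "w \<in> W" "f = restrict w ?C" by blast
    have "w (coroot \<alpha>) \<in> ?C" if "\<alpha> \<in> R" for \<alpha>
      using W_roots[OF w(1)] that by (metis imageI)
    then show "f \<in> ?C \<rightarrow>\<^sub>E ?C" using w(2) by auto
  qed
  moreover have "finite (?C \<rightarrow>\<^sub>E ?C)"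
    by (intro finite_PiE finite_imageI finite_R)
  ultimately show ?thesis by (rule inj_on_finite)
qed

lemma bij_betw_comp_W: "u \<in> W \<Longrightarrow> bij_betw (\<lambda>w. w \<circ> u) W W"
  by (rule bij_betw_byWitness[where f' = "\<lambda>w. w \<circ> inv u"])
    (auto simp: W_comp W_inv fun_eq_iff W_inv_apply W_apply_inv)

text \<open>A positive root \<gamma> \<noteq> \<alpha> involves a second simple root, since R is
  reduced. The reflection keeps that coefficient, and one positive coefficient decides the
  sign.\<close>

lemma dual_reflection_simple_positive:
  assumes "\<alpha> \<in> B" "\<gamma> \<in> positive_roots R B" "\<gamma> \<noteq> \<alpha>"
  shows "dual_reflection \<alpha> \<gamma> \<in> positive_roots R B - {\<alpha>}"
proof -
  have \<gamma>: "\<gamma> \<in> R" and \<alpha>: "\<alpha> \<in> R" using assms B_sub by (auto simp: positive_roots_def)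
  from assms obtain c where c: "\<gamma> = (\<Sum>\<beta>\<in>B. real (c \<beta>) *\<^sub>R \<beta>)"
    by (auto simp: positive_roots_def nonneg_comb_def)
  have single: "(\<Sum>\<beta>\<in>B. (if \<beta> = \<alpha> then x else 0) *\<^sub>R \<beta>) = x *\<^sub>R \<alpha>" for x
  proof -
    have "(\<Sum>\<beta>\<in>B. (if \<beta> = \<alpha> then x else 0) *\<^sub>R \<beta>) = (\<Sum>\<beta>\<in>B. if \<beta> = \<alpha> then x *\<^sub>R \<alpha> else 0)"
      by (rule sum.cong) auto
    then show ?thesis using finite_B assms(1) by simp
  qed
  have "\<exists>\<beta>\<in>B. \<beta> \<noteq> \<alpha> \<and> c \<beta> \<noteq> 0"
  proof (rule ccontr)
    assume "\<not> ?thesis"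
    then have "(\<Sum>\<beta>\<in>B. real (c \<beta>) *\<^sub>R \<beta>) = (\<Sum>\<beta>\<in>B. (if \<beta> = \<alpha> then real (c \<alpha>) else 0) *\<^sub>R \<beta>)"
      by (intro sum.cong) auto
    then have eq: "\<gamma> = real (c \<alpha>) *\<^sub>R \<alpha>" using c single by simp
    then have "real (c \<alpha>) *\<^sub>R \<alpha> \<in> R" using \<gamma> by simp
    from R_scaleR[OF \<alpha> this] have "real (c \<alpha>) = 1" by linarith
    then show False using eq assms(3) by simp
  qed
  then obtain \<beta> where \<beta>: "\<beta> \<in> B" "\<beta> \<noteq> \<alpha>" "c \<beta> \<noteq> 0" by blast
  let ?\<gamma> = "dual_reflection \<alpha> \<gamma>"
  define n where "n = blinfun_apply \<gamma> (coroot \<alpha>)"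
  have n: "?\<gamma> = \<gamma> - n *\<^sub>R \<alpha>" by (simp add: dual_reflection_def n_def)
  have "\<not> nonneg_comb B (- ?\<gamma>)"
  proof
    assume "nonneg_comb B (- ?\<gamma>)"
    then obtain d where d: "- ?\<gamma> = (\<Sum>\<beta>\<in>B. real (d \<beta>) *\<^sub>R \<beta>)" by (auto simp: nonneg_comb_def)
    have "(\<Sum>\<beta>\<in>B. (real (d \<beta>) + real (c \<beta>) - (if \<beta> = \<alpha> then n else 0)) *\<^sub>R \<beta>) = - ?\<gamma> + \<gamma> - n *\<^sub>R \<alpha>"
      unfolding d by (subst c) (simp only: scaleR_add_left scaleR_diff_left sum.distrib sum_subtractf single)
    also have "\<dots> = 0" by (simp add: n)
    finally have "real (d \<beta>) + real (c \<beta>) - (if \<beta> = \<alpha> then n else 0) = 0"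
      using \<beta>(1) by (rule B_coeffs_zero)
    then show False using \<beta> by simp
  qed
  then have "nonneg_comb B ?\<gamma>" using R_sign[OF R_reflection[OF \<alpha> \<gamma>]] by blast
  moreover have "?\<gamma> \<noteq> \<alpha>"
  proof
    assume "?\<gamma> = \<alpha>"
    then have "\<gamma> = - \<alpha>" using dual_reflection_dual_reflection[of \<alpha> \<gamma>] dual_reflection_self[OF \<alpha>] by simp
    then have "nonneg_comb B (- \<alpha>)" using assms(2) by (simp add: positive_roots_def)
    then have "\<alpha> = 0" using nonneg_comb_antisym nonneg_comb_base[OF finite_B assms(1)] by blast
    then show False using R_nonzero[OF \<alpha>] by simp
  qed
  ultimately show ?thesis using R_reflection[OF \<alpha> \<gamma>] by (simp add: positive_roots_def)
qed

text \<open>A negative pairing would make \<open>dual_reflection \<beta> \<phi>\<close> strictly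
  higher than \<phi>.\<close>

lemma phi_dominant: "\<beta> \<in> B \<Longrightarrow> 0 \<le> blinfun_apply \<beta> (coroot \<phi>)"
proof (rule ccontr)
  assume \<beta>: "\<beta> \<in> B" and "\<not> 0 \<le> blinfun_apply \<beta> (coroot \<phi>)"
  then have "riesz \<beta> \<bullet> riesz \<phi> < 0"
    using R_nonzero[OF phi_in] by (auto simp: coroot_eq_riesz apply_eq_inner mult_less_0_iff divide_less_0_iff not_le)
  then have "blinfun_apply \<phi> (coroot \<beta>) < 0"
    using R_nonzero[OF B_sub[OF \<beta>]] by (simp add: coroot_eq_riesz apply_eq_inner inner_commute mult_less_0_iff divide_less_0_iff)
  moreover have "blinfun_apply \<phi> (coroot \<beta>) \<in> \<int>" by (rule R_integer[OF B_sub[OF \<beta>] phi_in])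
  ultimately obtain m :: int where m: "blinfun_apply \<phi> (coroot \<beta>) = of_int m" "m < 0"
    by (metis Ints_cases of_int_less_0_iff)
  have "nonneg_comb B (\<phi> - dual_reflection \<beta> \<phi>)"
    by (rule phi_highest[OF R_reflection[OF B_sub[OF \<beta>] phi_in]])
  then have "nonneg_comb B (- (real (nat (- m)) *\<^sub>R \<beta>))"
    using m by (simp add: dual_reflection_def)
  then have "real (nat (- m)) *\<^sub>R \<beta> = 0"
    using nonneg_comb_antisym nonneg_comb_scale[OF nonneg_comb_base[OF finite_B \<beta>]] by blast
  then show False using m(2) R_nonzero[OF B_sub[OF \<beta>]] by simp
qed

text \<open>2\<phi> = \<phi> - (- \<phi>) is a nonnegative combination, which excludes the negative
  sign.\<close>

lemma phi_positive: "\<phi> \<in> positive_roots R B"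
proof -
  have "nonneg_comb B (\<phi> + \<phi>)" using phi_highest[OF R_uminus[OF phi_in]] by simp
  moreover have "\<not> nonneg_comb B (- \<phi>)"
  proof
    assume "nonneg_comb B (- \<phi>)"
    then have "nonneg_comb B (- (\<phi> + \<phi>))" using nonneg_comb_add[of B "- \<phi>" "- \<phi>"] by simp
    then have "\<phi> + \<phi> = 0" using nonneg_comb_antisym \<open>nonneg_comb B (\<phi> + \<phi>)\<close> by blast
    then have "2 *\<^sub>R \<phi> = 0" by (simp add: scaleR_2)
    then show False using R_nonzero[OF phi_in] by simp
  qed
  ultimately show ?thesis using R_sign[OF phi_in] phi_in by (auto simp: positive_roots_def)
qed

text \<open>The exponents in the Bethe ansatz equations are therefore 0, 1 and, at \<phi> alone, 2.
  Maximality of \<phi> is applied to the root - s_\<phi> \<gamma> to rule out larger values.\<close>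

lemma positive_roots_phi_cases:
  assumes "\<gamma> \<in> positive_roots R B"
  shows "blinfun_apply \<gamma> (coroot \<phi>) = 0 \<and> dual_reflection \<phi> \<gamma> = \<gamma>
    \<or> blinfun_apply \<gamma> (coroot \<phi>) = 1 \<and> \<gamma> \<noteq> \<phi> \<and> - dual_reflection \<phi> \<gamma> \<in> positive_roots R B
    \<or> \<gamma> = \<phi> \<and> blinfun_apply \<gamma> (coroot \<phi>) = 2"
proof -
  have \<gamma>: "\<gamma> \<in> R" "nonneg_comb B \<gamma>" using assms by (auto simp: positive_roots_def)
  from \<gamma>(2) obtain c where c: "\<gamma> = (\<Sum>\<beta>\<in>B. real (c \<beta>) *\<^sub>R \<beta>)" by (auto simp: nonneg_comb_def)
  have "0 \<le> blinfun_apply \<gamma> (coroot \<phi>)"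
    by (subst c) (simp add: blinfun.sum_left blinfun.scaleR_left phi_dominant sum_nonneg)
  then obtain n :: nat where n: "blinfun_apply \<gamma> (coroot \<phi>) = real n"
    using R_integer[OF phi_in \<gamma>(1)] by (metis Ints_cases of_int_0_le_iff of_int_of_nat_eq zero_le_imp_eq_int)
  have refl: "dual_reflection \<phi> \<gamma> = \<gamma> - real n *\<^sub>R \<phi>" by (simp add: dual_reflection_def n)
  have mem: "- dual_reflection \<phi> \<gamma> \<in> R" by (intro R_uminus R_reflection phi_in \<gamma>)
  have le: "nonneg_comb B (\<phi> - \<gamma>)" by (rule phi_highest[OF \<gamma>(1)])
  have pos_phi: "nonneg_comb B \<phi>" using phi_positive by (simp add: positive_roots_def)
  consider "n = 0" | "\<gamma> = \<phi>" | "n = 1" "\<gamma> \<noteq> \<phi>" | "n \<ge> 2" "\<gamma> \<noteq> \<phi>" by linarith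
  then show ?thesis
  proof cases
    case 1 then show ?thesis using n refl by simp
  next
    case 2 then show ?thesis using coroot_pairing[OF phi_in] by simp
  next
    case 3 then show ?thesis using n refl le mem by (simp add: positive_roots_def)
  next
    case 4
    \<comment> \<open>\<phi> dominates the root n \<phi> - \<gamma>; adding (n - 2) \<phi> gives
      \<gamma> - \<phi>. Hence \<phi> - \<gamma> is a nonnegative combination with both signs and
      vanishes.\<close>
    have "nonneg_comb B (\<phi> - - dual_reflection \<phi> \<gamma>)" by (rule phi_highest[OF mem])
    moreover have "nonneg_comb B (real (n - 2) *\<^sub>R \<phi>)" by (rule nonneg_comb_scale[OF pos_phi])
    ultimately have "nonneg_comb B (\<phi> - - dual_reflection \<phi> \<gamma> + real (n - 2) *\<^sub>R \<phi>)"
      by (rule nonneg_comb_add)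
    moreover have "\<phi> - - dual_reflection \<phi> \<gamma> + real (n - 2) *\<^sub>R \<phi> = - (\<phi> - \<gamma>)"
      using 4 by (simp add: refl of_nat_diff algebra_simps scaleR_2)
    ultimately have "\<phi> - \<gamma> = 0" using nonneg_comb_antisym[OF le] by simp
    then show ?thesis using 4 by simp
  qed
qed

lemma positive_roots_subset: "\<gamma> \<in> positive_roots R B \<Longrightarrow> \<gamma> \<in> R"
  by (simp add: positive_roots_def)

lemma finite_positive_roots: "finite (positive_roots R B)"
  using finite_R by (simp add: positive_roots_def)

section \<open>Induction over roots and generation by simple reflections\<close>

lemma finite_root_induct [consumes 1, case_names base step uminus]:
  assumes \<alpha>: "\<alpha> \<in> R"
    and base: "\<And>\<beta>. \<beta> \<in> B \<Longrightarrow> P \<beta>"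
    and step: "\<And>\<beta> \<alpha>. \<beta> \<in> B \<Longrightarrow> \<alpha> \<in> R \<Longrightarrow> P (dual_reflection \<beta> \<alpha>) \<Longrightarrow> P \<alpha>"
    and uminus: "\<And>\<alpha>. \<alpha> \<in> R \<Longrightarrow> P (- \<alpha>) \<Longrightarrow> P \<alpha>"
  shows "P \<alpha>"
proof -
  \<comment> \<open>Finite roots are treated as affine functionals with constant term 0, so that
    \<open>positive_root_induct\<close> serves both root systems.\<close>
  define Bs where "Bs = (\<lambda>\<beta>. (\<beta>, 0::real)) ` B"
  have sumBs: "(\<Sum>b\<in>Bs. g b) = (\<Sum>\<beta>\<in>B. g (\<beta>, 0))" for g :: "_ \<Rightarrow> 'a dual \<times> real"
    unfolding Bs_def by (subst sum.reindex) (auto simp: inj_on_def)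
  have comb: "\<exists>c :: 'a dual \<times> real \<Rightarrow> nat. (\<xi>, 0) = (\<Sum>b\<in>Bs. real (c b) *\<^sub>R b)" if "nonneg_comb B \<xi>" for \<xi>
  proof -
    from that obtain c where c: "\<xi> = (\<Sum>\<beta>\<in>B. real (c \<beta>) *\<^sub>R \<beta>)" by (auto simp: nonneg_comb_def)
    show ?thesis
      by (intro exI[of _ "\<lambda>b. c (fst b)"]) (simp add: sumBs c prod_eq_iff fst_sum snd_sum)
  qed
  have "P (fst z)" if "z \<in> R \<times> {0::real}" for z
    using that
  proof (rule positive_root_induct[where P = "\<lambda>z. P (fst z)" and Bs = Bs and Z = "R \<times> {0::real}", rotated -1])
    show "finite Bs" by (simp add: Bs_def finite_B)
    show "e b = 0" if "(\<Sum>b\<in>Bs. e b *\<^sub>R b) = 0" "b \<in> Bs" for e b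
    proof -
      have "(\<Sum>\<beta>\<in>B. e (\<beta>, 0) *\<^sub>R \<beta>) = fst (\<Sum>b\<in>Bs. e b *\<^sub>R b)" by (simp add: sumBs fst_sum)
      then show ?thesis using B_coeffs_zero[of "\<lambda>\<beta>. e (\<beta>, 0)"] that by (auto simp: Bs_def)
    qed
    show "Bs \<subseteq> R \<times> {0::real}" using B_sub by (auto simp: Bs_def)
    show "fst z \<noteq> 0" if "z \<in> R \<times> {0::real}" for z using that R_nonzero by auto
    show "(\<exists>c :: _ \<Rightarrow> nat. z = (\<Sum>b\<in>Bs. real (c b) *\<^sub>R b)) \<or> (\<exists>c :: _ \<Rightarrow> nat. - z = (\<Sum>b\<in>Bs. real (c b) *\<^sub>R b))"
      if "z \<in> R \<times> {0::real}" for z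
    proof -
      obtain \<xi> where \<xi>: "z = (\<xi>, 0)" "\<xi> \<in> R" using \<open>z \<in> R \<times> {0::real}\<close> by auto
      have "- z = (- \<xi>, 0)" using \<xi> by simp
      then show ?thesis using R_sign[OF \<xi>(2)] comb[of \<xi>] comb[of "- \<xi>"] \<xi>(1) by metis
    qed
    show "affine_dual_reflection b z \<in> R \<times> {0::real}" if "b \<in> Bs" "z \<in> R \<times> {0::real}" for b z
      using that R_reflection B_sub by (auto simp: affine_dual_reflection_def Bs_def dual_reflection_def)
    show "blinfun_apply (fst z) (coroot (fst b)) \<in> \<int>" if "b \<in> Bs" "z \<in> R \<times> {0::real}" for b z
      using that R_integer B_sub by (auto simp: Bs_def)
    show "c = 1 \<or> c = -1" if "b \<in> Bs" "c *\<^sub>R b \<in> R \<times> {0::real}" for b c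
    proof -
      have "fst b \<in> R" "c *\<^sub>R fst b \<in> R" using that B_sub by (auto simp: Bs_def)
      then show ?thesis by (rule R_scaleR)
    qed
    show "P (fst b)" if "b \<in> Bs" for b using that base by (auto simp: Bs_def)
    show "P (fst z)" if "b \<in> Bs" "z \<in> R \<times> {0::real}" "P (fst (affine_dual_reflection b z))" for b z
      using that step by (auto simp: Bs_def fst_affine_dual_reflection)
    show "P (fst z)" if "z \<in> R \<times> {0::real}" "P (fst (- z))" for z
      using that uminus by auto
    show "- z \<in> R \<times> {0::real}" if "z \<in> R \<times> {0::real}" for z using that R_uminus by auto
  qed
  from this[of "(\<alpha>, 0)"] \<alpha> show ?thesis by simp
qed

lemma finite_affine_basis: "finite (affine_basis B \<phi>)"
  by (simp add: affine_basis_def finite_B)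

lemma affine_basis_subset: "affine_basis B \<phi> \<subseteq> affine_roots R"
  using B_sub R_uminus[OF phi_in] by (auto simp: affine_basis_def affine_roots_def)

lemma sum_affine_basis:
  "(\<Sum>b\<in>affine_basis B \<phi>. g b) = g (- \<phi>, 1) + (\<Sum>\<beta>\<in>B. g (\<beta>, 0))"
  unfolding affine_basis_def
  by (subst sum.insert) (auto simp: finite_B sum.reindex inj_on_def)

text \<open>(\<xi>, m) = m (- \<phi>, 1) + (\<xi> + m \<phi>, 0), and for m > 0 the second part is
  the sum of \<phi> - (- \<xi>) and (m - 1) \<phi>, both nonnegative combinations.\<close>

lemma affine_root_nonneg_comb:
  assumes "\<xi> \<in> R" "0 < (m::int) \<or> m = 0 \<and> nonneg_comb B \<xi>"
  shows "\<exists>c :: _ \<Rightarrow> nat. (\<xi>, of_int m) = (\<Sum>b\<in>affine_basis B \<phi>. real (c b) *\<^sub>R b)"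
proof -
  define n where "n = nat m"
  have m: "real n = of_int m" using assms(2) by (auto simp: n_def)
  have "nonneg_comb B (\<xi> + real n *\<^sub>R \<phi>)"
    using assms(2)
  proof
    assume "0 < m"
    then obtain n' where n': "n = Suc n'" by (cases n) (auto simp: n_def)
    have eq: "\<xi> + real n *\<^sub>R \<phi> = (\<phi> - - \<xi>) + real n' *\<^sub>R \<phi>"
      by (simp add: n' scaleR_add_left)
    show ?thesis unfolding eq using phi_positive
      by (intro nonneg_comb_add nonneg_comb_scale phi_highest R_uminus assms) (simp add: positive_roots_def)
  next
    assume "m = 0 \<and> nonneg_comb B \<xi>"
    then show ?thesis by (simp add: n_def)
  qed
  then obtain c where c: "\<xi> + real n *\<^sub>R \<phi> = (\<Sum>\<beta>\<in>B. real (c \<beta>) *\<^sub>R \<beta>)" by (auto simp: nonneg_comb_def)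
  define d where "d b = (if b = (- \<phi>, 1) then n else c (fst b))" for b :: "'a dual \<times> real"
  have "(\<Sum>\<beta>\<in>B. real (d (\<beta>, 0)) *\<^sub>R (\<beta>, 0::real)) = (\<xi> + real n *\<^sub>R \<phi>, 0)"
    unfolding c by (simp add: d_def prod_eq_iff fst_sum snd_sum)
  then have "(\<Sum>b\<in>affine_basis B \<phi>. real (d b) *\<^sub>R b) = (\<xi>, real n)"
    unfolding sum_affine_basis by (simp add: d_def)
  then show ?thesis using m by (intro exI[of _ d]) simp
qed

lemma affine_root_induct [consumes 1, case_names base step uminus]:
  assumes z: "z \<in> affine_roots R"
    and base: "\<And>b. b \<in> affine_basis B \<phi> \<Longrightarrow> P b"
    and step: "\<And>b z. b \<in> affine_basis B \<phi> \<Longrightarrow> z \<in> affine_roots R \<Longrightarrow> P (affine_dual_reflection b z) \<Longrightarrow> P z"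
    and uminus: "\<And>z. z \<in> affine_roots R \<Longrightarrow> P (- z) \<Longrightarrow> P z"
  shows "P z"
  using z
proof (rule positive_root_induct[where P = P and Bs = "affine_basis B \<phi>" and Z = "affine_roots R", rotated -1])
  show "finite (affine_basis B \<phi>)" by (rule finite_affine_basis)
  show "e b = 0" if e: "(\<Sum>b\<in>affine_basis B \<phi>. e b *\<^sub>R b) = 0" and b: "b \<in> affine_basis B \<phi>" for e b
  proof -
    have "snd (\<Sum>b\<in>affine_basis B \<phi>. e b *\<^sub>R b) = e (- \<phi>, 1)"
      unfolding sum_affine_basis by (simp add: snd_sum)
    then have e0: "e (- \<phi>, 1) = 0" using e by simp
    have "fst (\<Sum>b\<in>affine_basis B \<phi>. e b *\<^sub>R b) = (\<Sum>\<beta>\<in>B. e (\<beta>, 0) *\<^sub>R \<beta>)"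
      unfolding sum_affine_basis by (simp add: fst_sum e0)
    then show ?thesis using B_coeffs_zero[of "\<lambda>\<beta>. e (\<beta>, 0)"] e e0 b by (auto simp: affine_basis_def)
  qed
  show "affine_basis B \<phi> \<subseteq> affine_roots R" by (rule affine_basis_subset)
  show "fst z \<noteq> 0" if "z \<in> affine_roots R" for z using that R_nonzero by (auto simp: affine_roots_def)
  show "(\<exists>c :: _ \<Rightarrow> nat. z = (\<Sum>b\<in>affine_basis B \<phi>. real (c b) *\<^sub>R b)) \<or> (\<exists>c :: _ \<Rightarrow> nat. - z = (\<Sum>b\<in>affine_basis B \<phi>. real (c b) *\<^sub>R b))"
    if z: "z \<in> affine_roots R" for z
  proof -
    obtain \<xi> m where \<xi>: "z = (\<xi>, of_int m)" "\<xi> \<in> R" using z by (auto simp: affine_roots_def elim!: Ints_cases)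
    have mz: "- z = (- \<xi>, of_int (- m))" using \<xi> by simp
    consider "0 < m \<or> m = 0 \<and> nonneg_comb B \<xi>" | "0 < - m \<or> - m = 0 \<and> nonneg_comb B (- \<xi>)"
      using R_sign[OF \<xi>(2)] by linarith
    then show ?thesis
    proof cases
      case 1 then show ?thesis using affine_root_nonneg_comb[OF \<xi>(2), of m] \<xi>(1) by blast
    next
      case 2 then show ?thesis using affine_root_nonneg_comb[OF R_uminus[OF \<xi>(2)], of "- m"] mz by metis
    qed
  qed
  show "affine_dual_reflection b z \<in> affine_roots R" if b: "b \<in> affine_basis B \<phi>" and z: "z \<in> affine_roots R" for b z
  proof -
    have bR: "b \<in> affine_roots R" using b affine_basis_subset by blast
    then have "fst z (coroot (fst b)) \<in> \<int>" using z R_integer by (auto simp: affine_roots_def)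
    then have "snd (affine_dual_reflection b z) \<in> \<int>"
      using z bR by (auto simp: affine_dual_reflection_def affine_roots_def)
    moreover have "fst (affine_dual_reflection b z) \<in> R"
      using z bR R_reflection by (auto simp: fst_affine_dual_reflection affine_roots_def)
    ultimately show ?thesis by (simp add: affine_roots_def mem_Times_iff)
  qed
  show "blinfun_apply (fst z) (coroot (fst b)) \<in> \<int>" if "b \<in> affine_basis B \<phi>" "z \<in> affine_roots R" for b z
    using that R_integer affine_basis_subset by (auto simp: affine_roots_def)
  show "c = 1 \<or> c = -1" if b: "b \<in> affine_basis B \<phi>" and c: "c *\<^sub>R b \<in> affine_roots R" for b c
  proof -
    have "fst b \<in> R" "c *\<^sub>R fst b \<in> R" using b c affine_basis_subset by (auto simp: affine_roots_def)
    then show ?thesis by (rule R_scaleR)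
  qed
  show "P b" if "b \<in> affine_basis B \<phi>" for b using that by (rule base)
  show "P z" if "b \<in> affine_basis B \<phi>" "z \<in> affine_roots R" "P (affine_dual_reflection b z)" for b z
    using that by (rule step)
  show "P z" if "z \<in> affine_roots R" "P (- z)" for z using that by (rule uminus)
  show "- z \<in> affine_roots R" if "z \<in> affine_roots R" for z using that R_uminus by (auto simp: affine_roots_def)
qed

text \<open>s_\<alpha> is the conjugate by a simple s_\<beta> of the reflection in s_\<beta>
  \<alpha>, to which the induction over roots applies.\<close>

lemma W_generated: "w \<in> W \<Longrightarrow> w \<in> transformation_group (reflection ` B)"
proof -
  let ?T = "transformation_group (reflection ` B)"
  have "reflection \<alpha> \<in> ?T" if "\<alpha> \<in> R" for \<alpha>
    using that
  proof (induction rule: finite_root_induct)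
    case (base \<beta>) then show ?case by (intro transformation_group.generator imageI)
  next
    case (step \<beta> \<alpha>)
    have "reflection \<alpha> = reflection \<beta> \<circ> reflection (dual_reflection \<beta> \<alpha>) \<circ> reflection \<beta>"
      by (metis reflection_dual_reflection dual_reflection_dual_reflection)
    moreover have "reflection \<beta> \<in> ?T" using step(1) by (intro transformation_group.generator imageI)
    ultimately show ?case using step(3) by (simp only: transformation_group.product)
  next
    case (uminus \<alpha>) then show ?case by (simp add: reflection_uminus)
  qed
  then have "reflection ` R \<subseteq> ?T" by blast
  then show "w \<in> W \<Longrightarrow> w \<in> ?T"
    unfolding weyl_group_def using transformation_group_mono by blast
qed

lemma W_induct [consumes 1, case_names id step]:
  assumes "w \<in> W" "P id" and step: "\<And>\<beta> w. \<beta> \<in> B \<Longrightarrow> w \<in> W \<Longrightarrow> P w \<Longrightarrow> P (reflection \<beta> \<circ> w)"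
  shows "P w"
proof (rule transformation_group_left_induct[where P = P, OF _ W_generated[OF assms(1)] assms(2)])
  show "s \<circ> s = id" if "s \<in> reflection ` B" for s
    using that by (auto simp: fun_eq_iff reflection_reflection)
  fix s w assume "s \<in> reflection ` B" "w \<in> transformation_group (reflection ` B)" "P w"
  moreover have "reflection ` B \<subseteq> transformation_group (reflection ` R)"
    using B_sub by (auto intro: transformation_group.generator)
  then have "transformation_group (reflection ` B) \<subseteq> W"
    unfolding weyl_group_def by (rule transformation_group_mono)
  ultimately show "P (s \<circ> w)" using step by blast
qed

text \<open>The group is defined by all affine reflections, while the action \<open>Q\<close> is
  prescribed on the simple ones only; this induction bridges the two.\<close>

lemma affine_weyl_induct [consumes 1, case_names id step]:
  assumes "w \<in> affine_weyl_group R" "P id"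
    and step: "\<And>b w. b \<in> affine_basis B \<phi> \<Longrightarrow> w \<in> affine_weyl_group R \<Longrightarrow> P w \<Longrightarrow> P (aff_reflection b \<circ> w)"
  shows "P w"
proof -
  let ?S = "aff_reflection ` affine_basis B \<phi>"
  have nonzero: "fst b \<noteq> 0" if "b \<in> affine_basis B \<phi>" for b
    using that affine_basis_subset R_nonzero by (auto simp: affine_roots_def)
  have "aff_reflection z \<in> transformation_group ?S" if "z \<in> affine_roots R" for z
    using that
  proof (induction rule: affine_root_induct)
    case (base b) then show ?case by (intro transformation_group.generator imageI)
  next
    case (step b z)
    have "affine_dual_reflection b (affine_dual_reflection b z) = z"
      using nonzero[OF step(1)]
      by (simp add: affine_dual_reflection_def blinfun.diff_left blinfun.scaleR_left apply_coroot_self)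
    then have "aff_reflection z = aff_reflection b \<circ> aff_reflection (affine_dual_reflection b z) \<circ> aff_reflection b"
      by (metis aff_reflection_affine_dual_reflection nonzero step(1))
    moreover have "aff_reflection b \<in> transformation_group ?S" using step(1) by (intro transformation_group.generator imageI)
    ultimately show ?case using step(3) by (simp only: transformation_group.product)
  next
    case (uminus z) then show ?case by (simp only: aff_reflection_uminus)
  qed
  then have "affine_weyl_group R \<subseteq> transformation_group ?S"
    unfolding affine_weyl_group_def by (intro transformation_group_mono) blast
  moreover have "transformation_group ?S \<subseteq> affine_weyl_group R"
    unfolding affine_weyl_group_def using affine_basis_subset
    by (intro transformation_group_mono) (auto intro: transformation_group.generator)
  ultimately have eq: "affine_weyl_group R = transformation_group ?S" by blast
  show ?thesis
  proof (rule transformation_group_left_induct[where P = P and S = ?S, OF _ _ assms(2)])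
    show "s \<circ> s = id" if "s \<in> ?S" for s
      using that nonzero by (auto simp: fun_eq_iff aff_reflection_aff_reflection)
    show "w \<in> transformation_group ?S" using assms(1) eq by simp
    fix s w assume "s \<in> ?S" "w \<in> transformation_group ?S" "P w"
    then show "P (s \<circ> w)" using step eq by blast
  qed
qed

text \<open>Moves a wall through a spectral value to a simple wall through another point of its
  orbit. Walls are the zeros of \<mu> at a coroot, so coroots are all that is tracked.\<close>

lemma root_conjugate_simple:
  assumes "\<alpha> \<in> R" shows "\<exists>w\<in>W. \<exists>\<beta>\<in>B. coroot \<alpha> = w (coroot \<beta>)"
  using assms
proof (induction rule: finite_root_induct)
  case (base \<beta>)
  then show ?case using W_id by (intro bexI[of _ id] bexI[of _ \<beta>]) auto
next
  case (step \<beta> \<alpha>)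
  then obtain w \<gamma> where w: "w \<in> W" "\<gamma> \<in> B" "coroot (dual_reflection \<beta> \<alpha>) = w (coroot \<gamma>)" by blast
  have "coroot \<alpha> = (reflection \<beta> \<circ> w) (coroot \<gamma>)"
    using reflection_reflection[of \<beta> "coroot \<alpha>"] w(3)[unfolded coroot_dual_reflection] by simp
  moreover have "reflection \<beta> \<circ> w \<in> W" by (intro W_comp W_reflection B_sub step w)
  ultimately show ?case using w(2) by blast
next
  case (uminus \<alpha>)
  then obtain w \<gamma> where w: "w \<in> W" "\<gamma> \<in> B" "coroot (- \<alpha>) = w (coroot \<gamma>)" by blast
  have "reflection \<gamma> (coroot \<gamma>) = - coroot \<gamma>"
    using coroot_pairing[OF B_sub[OF w(2)]] by (simp add: reflection_def scaleR_2)
  moreover have "coroot \<alpha> = - w (coroot \<gamma>)"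
    using w(3) unfolding coroot_uminus by (metis minus_minus)
  ultimately have "coroot \<alpha> = (w \<circ> reflection \<gamma>) (coroot \<gamma>)"
    by (simp add: linear_neg[OF W_linear[OF w(1)]])
  moreover have "w \<circ> reflection \<gamma> \<in> W" by (intro W_comp W_reflection B_sub w)
  ultimately show ?case using w(2) by blast
qed

section \<open>Values of the multiplicity function\<close>

lemma k_pos:
  assumes "\<alpha> \<in> R" shows "0 < k (\<alpha>, 0)"
proof -
  have "(\<alpha>, 0) \<in> affine_roots R" using assms by (simp add: affine_roots_def)
  then show ?thesis using multiplicity unfolding multiplicity_function_def by blast
qed

lemma k_dual_reflection:
  assumes "\<beta> \<in> R" "\<alpha> \<in> R" shows "k (dual_reflection \<beta> \<alpha>, 0) = k (\<alpha>, 0)"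
proof -
  have "reflection \<beta> \<in> affine_weyl_group R"
    unfolding affine_weyl_group_def aff_reflection_linear_root[symmetric]
    using assms by (intro transformation_group.generator imageI) (simp add: affine_roots_def)
  moreover have "\<forall>v. aff_eval (dual_reflection \<beta> \<alpha>, 0) v = aff_eval (\<alpha>, 0) (inv (reflection \<beta>) v)"
    by (simp add: aff_eval_def dual_reflection_apply inv_reflection)
  moreover have "(\<alpha>, 0) \<in> affine_roots R" "(dual_reflection \<beta> \<alpha>, 0) \<in> affine_roots R"
    using assms R_reflection by (auto simp: affine_roots_def)
  ultimately show ?thesis using multiplicity unfolding multiplicity_function_def by blast
qed

lemma k_uminus: "\<alpha> \<in> R \<Longrightarrow> k (- \<alpha>, 0) = k (\<alpha>, 0)"
  using k_dual_reflection[of \<alpha> \<alpha>] by (simp add: dual_reflection_self)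

lemma k_affine: "\<alpha> \<in> R \<Longrightarrow> k (- \<alpha>, 1) = k (\<alpha>, 0)"
proof -
  assume "\<alpha> \<in> R"
  then have "(- \<alpha>, 1) \<in> affine_roots R" using R_uminus by (auto simp: affine_roots_def)
  then have "k (- \<alpha>, 1) = k (fst (- \<alpha>, 1::real), 0)" using multiplicity unfolding multiplicity_function_def by blast
  then show ?thesis using k_uminus[OF \<open>\<alpha> \<in> R\<close>] by simp
qed

end

section \<open>The tuple equations\<close>

definition shifted_deriv :: "'a::euclidean_space \<Rightarrow> complex \<Rightarrow> ('a \<Rightarrow> complex) \<Rightarrow> 'a \<Rightarrow> complex" where
  "shifted_deriv y a g = (\<lambda>x. dir_deriv y g x + a * g x)"

lemma shifted_deriv_lincomb:
  assumes "smooth f" "smooth g"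
  shows "shifted_deriv y a (\<lambda>x. c * f x + d * g x) = (\<lambda>x. c * shifted_deriv y a f x + d * shifted_deriv y a g x)"
  unfolding shifted_deriv_def dir_deriv_lincomb[OF assms] by (simp add: algebra_simps)

lemma smooth_shifted_deriv:
  assumes "smooth f" shows "smooth (shifted_deriv y a f)"
  using smooth_lincomb[OF smooth_dir_deriv[OF assms] assms, of 1 y a] by (simp add: shifted_deriv_def)

lemma dir_deriv_shifted_deriv:
  assumes "smooth f"
  shows "dir_deriv u (shifted_deriv y a f) = shifted_deriv y a (dir_deriv u f)"
proof -
  have "dir_deriv u (shifted_deriv y a f) = dir_deriv u (\<lambda>x. 1 * dir_deriv y f x + a * f x)"
    by (simp add: shifted_deriv_def)
  also have "\<dots> = (\<lambda>x. 1 * dir_deriv u (dir_deriv y f) x + a * dir_deriv u f x)"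
    by (rule dir_deriv_lincomb[OF smooth_dir_deriv[OF assms] assms])
  finally show ?thesis by (simp add: shifted_deriv_def smooth_commute[OF assms, of u])
qed

lemma dir_deriv_zero: "dir_deriv u (\<lambda>x. 0) = (\<lambda>x. 0)"
  by (simp add: dir_deriv_def fun_eq_iff vector_derivative_const_at)

lemma dir_deriv_shift: "dir_deriv u (\<lambda>x. g (x - y)) = (\<lambda>x. dir_deriv u g (x - y))"
  using dir_deriv_compose_affine[OF linear_ident, of u g "- y"] by simp

lemma smooth_shift: "smooth g \<Longrightarrow> smooth (\<lambda>x. g (x - y))"
  using smooth_compose_affine[OF _ linear_ident, of g "- y"] by simp

definition iterated_shifted_deriv :: "'a::euclidean_space \<Rightarrow> complex list \<Rightarrow> ('a \<Rightarrow> complex) \<Rightarrow> 'a \<Rightarrow> complex" where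
  "iterated_shifted_deriv v cs g = foldr (\<lambda>c. shifted_deriv v (- c)) cs g"

lemma iterated_shifted_deriv_simps [simp]:
  "iterated_shifted_deriv v [] g = g"
  "iterated_shifted_deriv v (c # cs) g = shifted_deriv v (- c) (iterated_shifted_deriv v cs g)"
  by (simp_all add: iterated_shifted_deriv_def)

lemma smooth_iterated: "smooth f \<Longrightarrow> smooth (iterated_shifted_deriv v cs f)"
  by (induction cs) (simp_all add: smooth_shifted_deriv)

lemma iterated_lincomb:
  assumes "smooth f" "smooth g"
  shows "iterated_shifted_deriv v cs (\<lambda>x. c * f x + d * g x) =
    (\<lambda>x. c * iterated_shifted_deriv v cs f x + d * iterated_shifted_deriv v cs g x)"
  by (induction cs) (simp_all add: shifted_deriv_lincomb smooth_iterated assms)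

lemma dir_deriv_iterated:
  assumes "smooth f"
  shows "dir_deriv u (iterated_shifted_deriv v cs f) = iterated_shifted_deriv v cs (dir_deriv u f)"
  by (induction cs) (simp_all add: dir_deriv_shifted_deriv smooth_iterated assms)

text \<open>Assembles a family of joint eigenvalues of the basis derivatives into the exponent
  \<mu>, the real-linear functional with these values on the basis.\<close>

definition coordinate_form :: "('a::euclidean_space \<Rightarrow> complex) \<Rightarrow> 'a \<Rightarrow> complex" where
  "coordinate_form c x = (\<Sum>b\<in>Basis. complex_of_real (x \<bullet> b) * c b)"

lemma linear_coordinate_form: "linear (coordinate_form c)"
  unfolding coordinate_form_def by (rule linearI) (simp_all add: inner_add_left ring_distribs sum.distrib
        sum_distrib_left scaleR_conv_of_real mult.assoc)

text \<open>Integrating factor: g exp (- \<mu>) minus the linear form of l has derivative zero. The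
  case l = 0 describes eigenfunctions, general l those of rank two.\<close>

lemma generalized_eigenfunction:
  fixes g :: "'a::euclidean_space \<Rightarrow> complex"
  assumes g: "smooth g" and eig: "\<And>b x. b \<in> Basis \<Longrightarrow> dir_deriv b g x = c b * g x + l b * exp (coordinate_form c x)"
  shows "g x = exp (coordinate_form c x) * (g 0 + coordinate_form l x)" (is ?g)
    and "dir_deriv v g x = exp (coordinate_form c x) *
      (coordinate_form c v * (g 0 + coordinate_form l x) + coordinate_form l v)"
proof -
  let ?\<mu> = "coordinate_form c"
  note \<mu> = linear_coordinate_form[of c]
  have dd: "dir_deriv v g x = ?\<mu> v * g x + coordinate_form l v * exp (?\<mu> x)" for v x
  proof -
    have "dir_deriv v g x = (\<Sum>b\<in>Basis. complex_of_real (v \<bullet> b) * dir_deriv b g x)"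
      by (rule dir_deriv_Basis_expansion[OF smooth_differentiable[OF g]])
    also have "\<dots> = (\<Sum>b\<in>Basis. complex_of_real (v \<bullet> b) * c b * g x + complex_of_real (v \<bullet> b) * l b * exp (?\<mu> x))"
      by (rule sum.cong) (simp_all add: eig ring_distribs mult.assoc)
    finally show ?thesis by (simp only: coordinate_form_def sum_distrib_right sum.distrib)
  qed
  have "((\<lambda>x. g x * exp (- ?\<mu> x) - coordinate_form l x) has_derivative (\<lambda>v. 0)) (at x)" for x
  proof -
    have "linear (\<lambda>x. - ?\<mu> x)" using \<mu> by (rule linear_compose_neg)
    from exp_linear_has_derivative[OF this, of x]
    have "((\<lambda>x. g x * exp (- ?\<mu> x)) has_derivative
        (\<lambda>v. g x * (- ?\<mu> v * exp (- ?\<mu> x)) + dir_deriv v g x * exp (- ?\<mu> x))) (at x)"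
      by (rule has_derivative_mult[OF smooth_has_derivative[OF g]])
    then have "((\<lambda>x. g x * exp (- ?\<mu> x) - coordinate_form l x) has_derivative
        (\<lambda>v. g x * (- ?\<mu> v * exp (- ?\<mu> x)) + dir_deriv v g x * exp (- ?\<mu> x) - coordinate_form l v)) (at x)"
      by (rule has_derivative_diff[OF _ linear_imp_has_derivative[OF linear_coordinate_form]])
    moreover have "g x * (- ?\<mu> v * exp (- ?\<mu> x)) + dir_deriv v g x * exp (- ?\<mu> x) - coordinate_form l v = 0" for v
    proof -
      have "exp (?\<mu> x) * exp (- ?\<mu> x) = 1" by (simp add: exp_minus)
      then show ?thesis unfolding dd by (simp add: ring_distribs)
    qed
    ultimately show ?thesis by (simp only:)
  qed
  then have "g x * exp (- ?\<mu> x) - coordinate_form l x = g 0 * exp (- ?\<mu> 0) - coordinate_form l 0" for x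
    by (intro has_derivative_zero_unique[where f = "\<lambda>x. g x * exp (- ?\<mu> x) - coordinate_form l x" and s = UNIV]) simp_all
  then have "g x * exp (- ?\<mu> x) = g 0 + coordinate_form l x" for x
    by (simp add: linear_0[OF linear_coordinate_form] diff_eq_eq)
  note quotient = this
  have g': "g x = exp (?\<mu> x) * (g 0 + coordinate_form l x)" for x
  proof -
    have "g x = exp (?\<mu> x) * (g x * exp (- ?\<mu> x))" by (simp add: exp_minus)
    then show ?thesis unfolding quotient .
  qed
  then show ?g .
  show "dir_deriv v g x = exp (?\<mu> x) * (?\<mu> v * (g 0 + coordinate_form l x) + coordinate_form l v)"
    unfolding dd g'[of x] by (simp only: ring_distribs mult_ac)
qed

text \<open>A proper subspace is negligible, and finitely many of them do not cover V.\<close>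

lemma generic_vector:
  fixes D :: "('a::euclidean_space \<Rightarrow> complex) set"
  assumes "finite D" and D: "\<And>d. d \<in> D \<Longrightarrow> linear d" "\<And>d. d \<in> D \<Longrightarrow> \<exists>v. d v \<noteq> 0"
  shows "\<exists>v. \<forall>d\<in>D. d v \<noteq> 0"
proof (rule ccontr)
  assume "\<not> ?thesis"
  then have "(\<Union>d\<in>D. {v. d v = 0}) = UNIV" by blast
  moreover have "negligible (\<Union>d\<in>D. {v. d v = 0})"
  proof (rule negligible_Union)
    show "finite ((\<lambda>d. {v. d v = 0}) ` D)" using assms(1) by simp
    fix S assume "S \<in> (\<lambda>d. {v. d v = 0}) ` D"
    then obtain d where d: "d \<in> D" "S = {v. d v = 0}" by blast
    have S: "subspace S" unfolding d(2) by (rule linear_subspace_kernel[OF D(1)[OF d(1)]])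
    have "span S = S" using S by (simp add: span_eq_iff)
    moreover obtain v where "v \<notin> S" using D(2)[OF d(1)] d(2) by blast
    ultimately have "span S \<noteq> UNIV" by blast
    then have "dim S \<noteq> DIM('a)" using dim_eq_full[of S] by blast
    then have "dim S < DIM('a)" using dim_subset_UNIV[of S] by linarith
    then show "negligible S" by (rule negligible_lowdim)
  qed
  ultimately show False by simp
qed

section \<open>Tuples of functions indexed by the Weyl group\<close>

type_synonym 'a tuple = "('a \<Rightarrow> 'a) \<Rightarrow> 'a \<Rightarrow> complex"

definition tuple_scale :: "complex \<Rightarrow> 'a tuple \<Rightarrow> 'a tuple" where
  "tuple_scale c H = (\<lambda>w x. c * H w x)"

definition tuple_deriv :: "'a::euclidean_space \<Rightarrow> 'a tuple \<Rightarrow> 'a tuple" where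
  "tuple_deriv v H = (\<lambda>w. dir_deriv v (H w))"

interpretation tuple: vector_space tuple_scale
  by unfold_locales (simp_all add: tuple_scale_def fun_eq_iff algebra_simps)

locale bethe_data = root_data R B \<phi> k
  for R B :: "'a::euclidean_space dual set" and \<phi> k +
  fixes \<Lambda> :: "'a \<Rightarrow> complex"
  assumes linear_Lambda: "linear \<Lambda>"
begin

text \<open>The tuple of a function \<open>f\<close> will be \<open>w \<mapsto> f \<circ> w\<close>. Passing to tuples turns the reflection
  equations into equations with constant coefficients.\<close>

definition solutions :: "'a tuple set" where
  "solutions = {H. (\<forall>w. smooth (H w)) \<and> (\<forall>w. w \<notin> W \<longrightarrow> H w = (\<lambda>x. 0)) \<and>
    (\<forall>w v us. distinct us \<and> set us = W \<longrightarrow> iterated_shifted_deriv v (map (\<lambda>u. \<Lambda> (u v)) us) (H w) = (\<lambda>x. 0)) \<and>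
    (\<forall>w\<in>W. \<forall>\<alpha>\<in>B. shifted_deriv (inv w (coroot \<alpha>)) (- k (\<alpha>, 0)) (H w) =
       shifted_deriv (inv w (coroot \<alpha>)) (k (\<alpha>, 0)) (H (reflection \<alpha> \<circ> w))) \<and>
    (\<forall>w\<in>W. shifted_deriv (inv w (coroot \<phi>)) (k (\<phi>, 0)) (H w) =
       (\<lambda>x. shifted_deriv (inv w (coroot \<phi>)) (- k (\<phi>, 0)) (H (reflection \<phi> \<circ> w)) (x - inv w (coroot \<phi>))))}"

lemma solutions_smooth: "H \<in> solutions \<Longrightarrow> smooth (H w)"
  by (simp add: solutions_def)

lemma solutions_lincomb:
  assumes "H \<in> solutions" "G \<in> solutions"
  shows "(\<lambda>w x. c * H w x + d * G w x) \<in> solutions"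
  unfolding solutions_def mem_Collect_eq
proof (intro conjI allI ballI impI)
  note sm = solutions_smooth[OF assms(1)] solutions_smooth[OF assms(2)]
  show "smooth (\<lambda>x. c * H w x + d * G w x)" for w by (intro smooth_lincomb sm)
  show "(\<lambda>x. c * H w x + d * G w x) = (\<lambda>x. 0)" if "w \<notin> W" for w
    using assms that by (simp add: solutions_def)
  show "iterated_shifted_deriv v (map (\<lambda>u. \<Lambda> (u v)) us) (\<lambda>x. c * H w x + d * G w x) = (\<lambda>x. 0)"
    if "distinct us \<and> set us = W" for w v us
    unfolding iterated_lincomb[OF sm] using assms that by (simp add: solutions_def)
  show "shifted_deriv (inv w (coroot \<alpha>)) (- k (\<alpha>, 0)) (\<lambda>x. c * H w x + d * G w x) =
       shifted_deriv (inv w (coroot \<alpha>)) (k (\<alpha>, 0)) (\<lambda>x. c * H (reflection \<alpha> \<circ> w) x + d * G (reflection \<alpha> \<circ> w) x)"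
    if "w \<in> W" "\<alpha> \<in> B" for w \<alpha>
    unfolding shifted_deriv_lincomb[OF sm] using assms that by (simp add: solutions_def del: o_apply)
  show "shifted_deriv (inv w (coroot \<phi>)) (k (\<phi>, 0)) (\<lambda>x. c * H w x + d * G w x) =
       (\<lambda>x. shifted_deriv (inv w (coroot \<phi>)) (- k (\<phi>, 0)) (\<lambda>x. c * H (reflection \<phi> \<circ> w) x + d * G (reflection \<phi> \<circ> w) x) (x - inv w (coroot \<phi>)))"
    if "w \<in> W" for w
    unfolding shifted_deriv_lincomb[OF sm] using assms that by (simp add: solutions_def del: o_apply)
qed

lemma solutions_deriv:
  assumes H: "H \<in> solutions"
  shows "tuple_deriv u H \<in> solutions"
  unfolding solutions_def mem_Collect_eq tuple_deriv_def
proof (intro conjI allI ballI impI)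
  note sm = solutions_smooth[OF H]
  show "smooth (dir_deriv u (H w))" for w by (intro smooth_dir_deriv sm)
  show "dir_deriv u (H w) = (\<lambda>x. 0)" if "w \<notin> W" for w
    using H that by (simp add: solutions_def dir_deriv_zero)
  show "iterated_shifted_deriv v (map (\<lambda>u. \<Lambda> (u v)) us) (dir_deriv u (H w)) = (\<lambda>x. 0)"
    if "distinct us \<and> set us = W" for w v us
    unfolding dir_deriv_iterated[OF sm, symmetric] using H that by (simp add: solutions_def dir_deriv_zero)
  show "shifted_deriv (inv w (coroot \<alpha>)) (- k (\<alpha>, 0)) (dir_deriv u (H w)) =
       shifted_deriv (inv w (coroot \<alpha>)) (k (\<alpha>, 0)) (dir_deriv u (H (reflection \<alpha> \<circ> w)))"
    if "w \<in> W" "\<alpha> \<in> B" for w \<alpha>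
    unfolding dir_deriv_shifted_deriv[OF sm, symmetric] using H that by (simp add: solutions_def del: o_apply)
  show "shifted_deriv (inv w (coroot \<phi>)) (k (\<phi>, 0)) (dir_deriv u (H w)) =
       (\<lambda>x. shifted_deriv (inv w (coroot \<phi>)) (- k (\<phi>, 0)) (dir_deriv u (H (reflection \<phi> \<circ> w))) (x - inv w (coroot \<phi>)))"
    if "w \<in> W" for w
    unfolding dir_deriv_shifted_deriv[OF sm, symmetric] dir_deriv_shift[symmetric]
    using H that by (simp add: solutions_def del: o_apply)
qed

lemma zero_solution: "(\<lambda>w x. 0) \<in> solutions"
proof -
  have z: "shifted_deriv v a (\<lambda>x. 0) = (\<lambda>x. 0)" for v :: 'a and a by (simp add: shifted_deriv_def dir_deriv_zero)
  have "iterated_shifted_deriv v cs (\<lambda>x. 0) = (\<lambda>x. 0)" for v :: 'a and cs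
    by (induction cs) (simp_all add: z)
  then show ?thesis by (simp add: solutions_def z smooth_zero)
qed

sublocale solutions: commuting_family tuple_scale solutions tuple_deriv
proof
  show "tuple.subspace solutions"
  proof (rule tuple.subspaceI)
    show "0 \<in> solutions" using zero_solution by (simp add: zero_fun_def)
    show "H + G \<in> solutions" if "H \<in> solutions" "G \<in> solutions" for H G
      using solutions_lincomb[OF that, of 1 1] by (simp add: plus_fun_def)
    show "tuple_scale c H \<in> solutions" if "H \<in> solutions" for c H
      using solutions_lincomb[OF that that, of c 0] by (simp add: tuple_scale_def)
  qed
  show "tuple_deriv v H \<in> solutions" if "H \<in> solutions" for H v using that by (rule solutions_deriv)
  show "tuple_deriv v (H + G) = tuple_deriv v H + tuple_deriv v G" if "H \<in> solutions" "G \<in> solutions" for H G v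
    using dir_deriv_lincomb[OF solutions_smooth[OF that(1)] solutions_smooth[OF that(2)], of v 1 _ 1]
    by (simp add: tuple_deriv_def plus_fun_def)
  show "tuple_deriv v (tuple_scale c H) = tuple_scale c (tuple_deriv v H)" if "H \<in> solutions" for H v c
    using dir_deriv_lincomb[OF solutions_smooth[OF that] solutions_smooth[OF that], of v c _ 0]
    by (simp add: tuple_deriv_def tuple_scale_def)
  show "tuple_deriv u (tuple_deriv v H) = tuple_deriv v (tuple_deriv u H)" if "H \<in> solutions" for H u v
    using smooth_commute[OF solutions_smooth[OF that], of u v] by (simp add: tuple_deriv_def)
qed

lemma solutions_X: "solutions.X v c H = (\<lambda>w. shifted_deriv v (- c) (H w))"
  by (simp add: solutions.X_def tuple_deriv_def tuple_scale_def shifted_deriv_def fun_eq_iff)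

lemma solutions_simple:
  assumes "H \<in> solutions" "w \<in> W" "\<alpha> \<in> B"
  shows "shifted_deriv (inv w (coroot \<alpha>)) (- k (\<alpha>, 0)) (H w) x =
       shifted_deriv (inv w (coroot \<alpha>)) (k (\<alpha>, 0)) (H (reflection \<alpha> \<circ> w)) x"
  using assms by (simp add: solutions_def del: o_apply)

lemma solutions_affine:
  assumes "H \<in> solutions" "w \<in> W"
  shows "shifted_deriv (inv w (coroot \<phi>)) (k (\<phi>, 0)) (H w) x =
       shifted_deriv (inv w (coroot \<phi>)) (- k (\<phi>, 0)) (H (reflection \<phi> \<circ> w)) (x - inv w (coroot \<phi>))"
  using assms by (simp add: solutions_def del: o_apply)

end

section \<open>Maximum principles\<close>

text \<open>The squared moduli differ by 4 k Re m. This and its mirror image drive the first maximum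
  principle.\<close>

lemma norm_minus_less_plus:
  assumes "0 < Re m" "0 < (k::real)"
  shows "cmod (m - k) < cmod (m + k)"
proof -
  have "(cmod (m - k))\<^sup>2 < (cmod (m + k))\<^sup>2"
    unfolding cmod_power2 using mult_pos_pos[OF assms] by (simp add: power2_eq_square algebra_simps)
  then show ?thesis by (rule power2_less_imp_less) simp
qed

lemma norm_plus_less_minus:
  assumes "Re m < 0" "0 < (k::real)"
  shows "cmod (m + k) < cmod (m - k)"
proof -
  have "(cmod (m + k))\<^sup>2 < (cmod (m - k))\<^sup>2"
    unfolding cmod_power2 using mult_neg_pos[OF assms] by (simp add: power2_eq_square algebra_simps)
  then show ?thesis by (rule power2_less_imp_less) simp
qed

text \<open>First-order perturbation of q N = p N': when p and q both move by r, the relative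
  perturbations u of N and v of N' differ by the logarithmic derivative of q / p.\<close>

lemma proportional_pair_shift:
  fixes p q N N' u v r :: complex
  assumes "p \<noteq> 0" "q \<noteq> 0" "N \<noteq> 0" and N': "q * N = p * N'"
    and eq: "q * (N * u) + N * r = p * (N' * v) + N' * r"
  shows "v = u + r * (1 / q - 1 / p)"
proof -
  have "(q * N) * (u + r / q) = q * (N * u) + N * r" using assms(2) by (simp add: distrib_left)
  also have "\<dots> = (p * N') * (v + r / p)" unfolding eq using assms(1) by (simp add: distrib_left)
  also have "\<dots> = (q * N) * (v + r / p)" by (simp only: N')
  finally have "u + r / q = v + r / p" using assms(2,3) by simp
  then show ?thesis by (simp add: right_diff_distrib eq_diff_eq diff_eq_eq add_diff_eq)
qed

context bethe_data
begin

lemma nonzero_tuple_component: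
  assumes "H \<in> solutions" "H \<noteq> 0"
  shows "\<exists>w\<in>W. H w \<noteq> (\<lambda>x. 0)"
proof (rule ccontr)
  assume "\<not> ?thesis"
  then have "H w = (\<lambda>x. 0)" for w using assms(1) by (cases "w \<in> W") (auto simp: solutions_def)
  then show False using assms(2) by (simp add: zero_fun_def fun_eq_iff)
qed

lemma eigen_component:
  assumes H: "H \<in> solutions" and eig: "\<And>b. b \<in> Basis \<Longrightarrow> solutions.X b (c b) H = 0"
  shows "H w x = H w 0 * exp (coordinate_form c x)"
    and "shifted_deriv y a (H w) x = H w 0 * (coordinate_form c y + a) * exp (coordinate_form c x)"
proof -
  have "dir_deriv b (H w) x = c b * H w x + 0 * exp (coordinate_form c x)" if "b \<in> Basis" for b x
    using fun_cong[OF fun_cong[OF eig[OF that]], of w x] by (simp add: solutions_X shifted_deriv_def)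
  note g = generalized_eigenfunction[where c = c and l = "\<lambda>b. 0", OF solutions_smooth[OF H, of w] this]
  have z: "coordinate_form (\<lambda>b. 0) v = 0" for v :: 'a by (simp add: coordinate_form_def)
  have H': "H w x = H w 0 * exp (coordinate_form c x)" for x using g(1)[of x] by (simp add: z)
  then show "H w x = H w 0 * exp (coordinate_form c x)" .
  show "shifted_deriv y a (H w) x = H w 0 * (coordinate_form c y + a) * exp (coordinate_form c x)"
  proof -
    have "dir_deriv y (H w) x = exp (coordinate_form c x) * (coordinate_form c y * (H w 0 + 0) + 0)"
      by (rule g(2)[unfolded z])
    then show ?thesis using H'[of x] by (simp add: shifted_deriv_def algebra_simps)
  qed
qed

lemma eigen_exponent_imaginary:
  assumes H: "H \<in> solutions" and eig: "\<And>b. b \<in> Basis \<Longrightarrow> solutions.X b (c b) H = 0" and "H \<noteq> 0"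
  shows "Re (coordinate_form c v) = 0"
proof -
  let ?\<mu> = "coordinate_form c"
  define M where "M = Max ((\<lambda>w. cmod (H w 0)) ` W)"
  have "W \<noteq> {}" using W_id by blast
  then have "M \<in> (\<lambda>w. cmod (H w 0)) ` W" unfolding M_def using finite_W by (intro Max_in) auto
  then obtain w where w: "w \<in> W" "cmod (H w 0) = M" by auto
  have le: "cmod (H u 0) \<le> M" if "u \<in> W" for u unfolding M_def using finite_W that by simp
  have "0 < M"
  proof -
    obtain u where "u \<in> W" "H u \<noteq> (\<lambda>x. 0)" using nonzero_tuple_component[OF H \<open>H \<noteq> 0\<close>] by blast
    then obtain x where u: "u \<in> W" "H u x \<noteq> 0" by (auto simp: fun_eq_iff)
    then have "H u 0 \<noteq> 0" using eigen_component(1)[OF H eig, of u x] by auto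
    then show ?thesis using le[OF u(1)] by (smt (verit) zero_less_norm_iff)
  qed
  \<comment> \<open>With negative real part |m + k| < |m - k|, and the simple equation would force
    the component at \<open>?s\<close> to exceed the maximum M.\<close>
  have "0 \<le> Re (?\<mu> (inv w (coroot \<alpha>)))" if \<alpha>: "\<alpha> \<in> B" for \<alpha>
  proof (rule ccontr)
    let ?y = "inv w (coroot \<alpha>)" and ?s = "reflection \<alpha> \<circ> w"
    assume neg: "\<not> 0 \<le> Re (?\<mu> ?y)"
    have kp: "0 < k (\<alpha>, 0)" by (rule k_pos[OF B_sub[OF \<alpha>]])
    have "H w 0 * (?\<mu> ?y - k (\<alpha>, 0)) = H ?s 0 * (?\<mu> ?y + k (\<alpha>, 0))"
      using solutions_simple[OF H w(1) \<alpha>, of 0] eigen_component(2)[OF H eig, where x = 0]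
      by (simp del: o_apply add: linear_0[OF linear_coordinate_form])
    then have "M * cmod (?\<mu> ?y - k (\<alpha>, 0)) = cmod (H ?s 0) * cmod (?\<mu> ?y + k (\<alpha>, 0))"
      unfolding w(2)[symmetric] norm_mult[symmetric] by (simp only:)
    also have "\<dots> \<le> M * cmod (?\<mu> ?y + k (\<alpha>, 0))"
      by (intro mult_right_mono le W_comp W_reflection B_sub \<alpha> w norm_ge_zero)
    also have "\<dots> < M * cmod (?\<mu> ?y - k (\<alpha>, 0))"
      using norm_plus_less_minus[of "?\<mu> ?y" "k (\<alpha>, 0)"] neg kp \<open>0 < M\<close> by simp
    finally show False by simp
  qed
  \<comment> \<open>Here k and - k are exchanged, and for positive real part the translation factor
    has modulus at most 1, so both effects point the same way.\<close>
  moreover have "Re (?\<mu> (inv w (coroot \<phi>))) \<le> 0"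
  proof (rule ccontr)
    let ?y = "inv w (coroot \<phi>)" and ?s = "reflection \<phi> \<circ> w"
    assume pos: "\<not> Re (?\<mu> ?y) \<le> 0"
    have kp: "0 < k (\<phi>, 0)" by (rule k_pos[OF phi_in])
    have "H w 0 * (?\<mu> ?y + k (\<phi>, 0)) = H ?s 0 * (?\<mu> ?y - k (\<phi>, 0)) * exp (- ?\<mu> ?y)"
      using solutions_affine[OF H w(1), of 0] eigen_component(2)[OF H eig]
      by (simp del: o_apply add: linear_0[OF linear_coordinate_form] linear_neg[OF linear_coordinate_form])
    then have "M * cmod (?\<mu> ?y + k (\<phi>, 0)) = cmod (H ?s 0) * cmod (?\<mu> ?y - k (\<phi>, 0)) * cmod (exp (- ?\<mu> ?y))"
      unfolding w(2)[symmetric] norm_mult[symmetric] by (simp only:)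
    also have "\<dots> \<le> M * cmod (?\<mu> ?y - k (\<phi>, 0)) * 1"
      using pos \<open>0 < M\<close>
      by (intro mult_mono le W_comp W_reflection phi_in w norm_ge_zero mult_nonneg_nonneg) auto
    also have "\<dots> < M * cmod (?\<mu> ?y + k (\<phi>, 0))"
      using norm_minus_less_plus[of "?\<mu> ?y" "k (\<phi>, 0)"] pos kp \<open>0 < M\<close> by simp
    finally show False by simp
  qed
  moreover have lin: "linear (\<lambda>v. Re (?\<mu> (inv w v)))"
    using linear_compose[OF W_linear[OF W_inv[OF w(1)]] linear_compose[OF linear_coordinate_form[of c] bounded_linear.linear[OF bounded_linear_Re]]]
    by (simp add: o_def)
  ultimately have "Re (?\<mu> (inv w (w v))) = 0"
    by (intro dominant_nonpos_zero[where f = "\<lambda>v. Re (?\<mu> (inv w v))"])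
  then show ?thesis using W_inv_apply[OF w(1)] by simp
qed

lemma no_rank_two_solution:
  assumes H: "H \<in> solutions"
    and two: "\<And>a b. a \<in> Basis \<Longrightarrow> b \<in> Basis \<Longrightarrow> solutions.X a (c a) (solutions.X b (c b) H) = 0"
    and b0: "b0 \<in> Basis"
  shows "solutions.X b0 (c b0) H = 0"
proof (rule ccontr)
  assume non: "solutions.X b0 (c b0) H \<noteq> 0"
  let ?\<mu> = "coordinate_form c"
  \<comment> \<open>The images of H under \<partial>_b - c_b are eigentuples by \<open>two\<close>;
    their values at 0 are the coefficients of the linear part of H.\<close>
  define l where "l w b = solutions.X b (c b) H w 0" for w b
  define L where "L w = coordinate_form (l w)" for w
  define A where "A w = H w 0" for w
  have L_lin: "linear (L w)" for w unfolding L_def by (rule linear_coordinate_form)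
  have XH: "solutions.X b (c b) H w x = l w b * exp (?\<mu> x)" if "b \<in> Basis" for b w x
    unfolding l_def by (rule eigen_component(1)[OF solutions.X_in[OF H] two]) (use that in auto)
  \<comment> \<open>One of these eigentuples is nonzero, so the first maximum principle applies;
    afterwards no factor \<mu>(y) + k or \<mu>(y) - k can vanish.\<close>
  have imag: "Re (?\<mu> v) = 0" for v
    by (rule eigen_exponent_imaginary[OF solutions.X_in[OF H] two non]) (use b0 in auto)
  have "dir_deriv b (H w) x = c b * H w x + l w b * exp (?\<mu> x)" if "b \<in> Basis" for b w x
    using XH[OF that, of w x] by (simp add: solutions_X shifted_deriv_def diff_eq_eq)
  note gen = generalized_eigenfunction[where c = c and l = "l w" and g = "H w" for w, OF solutions_smooth[OF H] this, folded L_def A_def]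
  have sd: "shifted_deriv y a (H w) x = exp (?\<mu> x) * ((?\<mu> y + a) * (A w + L w x) + L w y)" for y a w x
  proof -
    have "dir_deriv y (H w) x = exp (?\<mu> x) * (?\<mu> y * (A w + L w x) + L w y)" by (rule gen(2))
    moreover have "H w x = exp (?\<mu> x) * (A w + L w x)" by (rule gen(1))
    ultimately show ?thesis by (simp add: shifted_deriv_def algebra_simps)
  qed
  have nz: "?\<mu> v + complex_of_real t \<noteq> 0" if "t \<noteq> 0" for v t
    using imag[of v] that by (auto simp: complex_eq_iff)
  have simple: "(?\<mu> y - k (\<alpha>, 0)) * (A w + L w x) + L w y = (?\<mu> y + k (\<alpha>, 0)) * (A s + L s x) + L s y"
    if "w \<in> W" "\<alpha> \<in> B" "y = inv w (coroot \<alpha>)" "s = reflection \<alpha> \<circ> w" for w \<alpha> y s x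
    using solutions_simple[OF H that(1,2), of x] unfolding sd that(3,4)[symmetric] by simp
  have affine: "(?\<mu> y + k (\<phi>, 0)) * (A w + L w x) + L w y =
      exp (- ?\<mu> y) * ((?\<mu> y - k (\<phi>, 0)) * (A s + L s x - L s y) + L s y)"
    if "w \<in> W" "y = inv w (coroot \<phi>)" "s = reflection \<phi> \<circ> w" for w y s x
  proof -
    have "exp (?\<mu> x) * ((?\<mu> y + k (\<phi>, 0)) * (A w + L w x) + L w y) =
      exp (?\<mu> (x - y)) * ((?\<mu> y - k (\<phi>, 0)) * (A s + L s (x - y)) + L s y)"
      using solutions_affine[OF H that(1), of x] unfolding sd that(2,3)[symmetric] by simp
    moreover have "exp (?\<mu> (x - y)) = exp (?\<mu> x) * exp (- ?\<mu> y)"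
      by (simp add: linear_diff[OF linear_coordinate_form] exp_diff exp_minus field_simps)
    ultimately show ?thesis by (simp add: linear_diff[OF L_lin] add_diff_eq mult.assoc)
  qed
  have L0: "L w 0 = 0" for w by (rule linear_0[OF L_lin])
  \<comment> \<open>The equations hold for all x; subtracting the instance at 0 isolates the linear
    parts, which satisfy the equations of an eigentuple.\<close>
  have simple_L: "(?\<mu> y - k (\<alpha>, 0)) * L w x = (?\<mu> y + k (\<alpha>, 0)) * L s x"
    if h: "w \<in> W" "\<alpha> \<in> B" "y = inv w (coroot \<alpha>)" "s = reflection \<alpha> \<circ> w" for w \<alpha> y s x
    using arg_cong2[OF simple[OF h, of x] simple[OF h, of 0], of "(-)"] by (simp add: L0 algebra_simps)
  have affine_L: "(?\<mu> y + k (\<phi>, 0)) * L w x = exp (- ?\<mu> y) * (?\<mu> y - k (\<phi>, 0)) * L s x"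
    if h: "w \<in> W" "y = inv w (coroot \<phi>)" "s = reflection \<phi> \<circ> w" for w y s x
    using arg_cong2[OF affine[OF h, of x] affine[OF h, of 0], of "(-)"] by (simp add: L0 algebra_simps)
  obtain w0 where w0: "w0 \<in> W" "solutions.X b0 (c b0) H w0 \<noteq> (\<lambda>x. 0)"
    using nonzero_tuple_component[OF solutions.X_in[OF H] non] by blast
  then have "l w0 b0 \<noteq> 0" using XH[OF b0, of w0] by auto
  moreover have "L w0 b0 = l w0 b0"
  proof -
    have "L w0 b0 = (\<Sum>b\<in>Basis. if b = b0 then l w0 b0 else 0)"
      unfolding L_def coordinate_form_def by (rule sum.cong) (use b0 in \<open>auto simp: inner_Basis\<close>)
    then show ?thesis using b0 by simp
  qed
  ultimately have Lw0: "L w0 b0 \<noteq> 0" by simp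
  have kB: "k (\<alpha>, 0) \<noteq> 0" "0 < k (\<alpha>, 0)" if "\<alpha> \<in> B" for \<alpha> using k_pos[OF B_sub[OF that]] by auto
  have kphi: "k (\<phi>, 0) \<noteq> 0" "0 < k (\<phi>, 0)" using k_pos[OF phi_in] by auto
  have nz': "?\<mu> v - complex_of_real t \<noteq> 0" if "t \<noteq> 0" for v t
    using nz[of "- t" v] that by simp
  have "L w b0 = 0 \<longleftrightarrow> L id b0 = 0" if "w \<in> W" for w
    using that
  proof (induction rule: W_induct)
    case (step \<beta> w)
    have "L (reflection \<beta> \<circ> w) b0 = 0 \<longleftrightarrow> L w b0 = 0"
      using simple_L[OF step(2,1) refl refl, of b0] nz[OF kB(1)[OF step(1)]] nz'[OF kB(1)[OF step(1)]]
      by (metis mult_eq_0_iff)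
    then show ?case using step(3) by blast
  qed (rule refl)
  then have Lid: "L id b0 \<noteq> 0" and Lw: "\<And>w. w \<in> W \<Longrightarrow> L w b0 \<noteq> 0" using Lw0 w0(1) by auto
  define r where "r x = L id x / L id b0" for x
  \<comment> \<open>The relations between neighbouring linear parts have coefficients independent of
    x, so every L w is a multiple of one functional r, normalized by r b0 = 1.\<close>
  have Lr: "L w x = L w b0 * r x" if "w \<in> W" for w x
    using that
  proof (induction rule: W_induct)
    case id
    show ?case unfolding r_def by (simp only: times_divide_eq_right nonzero_mult_div_cancel_left[OF Lid])
  next
    case (step \<beta> w)
    let ?s = "reflection \<beta> \<circ> w" and ?y = "inv w (coroot \<beta>)"
    have "(?\<mu> ?y + k (\<beta>, 0)) * L ?s x = (?\<mu> ?y - k (\<beta>, 0)) * (L w b0 * r x)"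
      using simple_L[OF step(2,1) refl refl, of x] step(3) by simp
    also have "\<dots> = (?\<mu> ?y + k (\<beta>, 0)) * (L ?s b0 * r x)"
      using simple_L[OF step(2,1) refl refl, of b0] by (simp only: mult.assoc[symmetric])
    finally show ?case using nz[OF kB(1)[OF step(1)]] by (metis mult_left_cancel)
  qed
  \<comment> \<open>Constant term relative to the linear term; a reflection changes it by a real
    multiple of a value of r.\<close>
  define h where "h w = A w / L w b0" for w
  have Ah: "A w = L w b0 * h w" if "w \<in> W" for w using Lw[OF that] by (simp add: h_def)
  \<comment> \<open>- \<kappa> is the difference of 1 / (m - t) and 1 / (m + t) at m = \<mu>(y); it
    is real with fixed sign because m is imaginary.\<close>
  define \<kappa> where "\<kappa> y t = 2 * t / (t\<^sup>2 + (Im (?\<mu> y))\<^sup>2)" for y t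
  have \<kappa>: "1 / (?\<mu> y - of_real t) - 1 / (?\<mu> y + of_real t) = - of_real (\<kappa> y t)" if "0 < t" for y t
  proof -
    have m: "?\<mu> y = \<i> * of_real (Im (?\<mu> y))" using imag[of y] by (simp add: complex_eq_iff)
    have pos: "0 < t\<^sup>2 + (Im (?\<mu> y))\<^sup>2" using that by (simp add: add_pos_nonneg)
    have "(?\<mu> y - of_real t) * (?\<mu> y + of_real t) = - of_real (t\<^sup>2 + (Im (?\<mu> y))\<^sup>2)"
      by (subst (1 2) m) (simp add: algebra_simps power2_eq_square complex_eq_iff)
    moreover have "1 / (?\<mu> y - of_real t) - 1 / (?\<mu> y + of_real t) = of_real (2 * t) / ((?\<mu> y - of_real t) * (?\<mu> y + of_real t))"
      using nz[of t y] nz'[of t y] that by (simp add: divide_simps)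
    ultimately show ?thesis by (simp only: \<kappa>_def divide_minus_right of_real_divide)
  qed
  have \<kappa>_pos: "0 < \<kappa> y t" if "0 < t" for y t
    unfolding \<kappa>_def using that by (intro divide_pos_pos add_pos_nonneg) auto
  have h_simple: "h s = h w - of_real (\<kappa> y (k (\<alpha>, 0))) * r y"
    if hh: "w \<in> W" "\<alpha> \<in> B" "y = inv w (coroot \<alpha>)" "s = reflection \<alpha> \<circ> w" for w \<alpha> y s
  proof -
    let ?p = "?\<mu> y + k (\<alpha>, 0)" and ?q = "?\<mu> y - k (\<alpha>, 0)" and ?N = "L w b0" and ?N' = "L s b0"
    have s: "s \<in> W" unfolding hh(4) by (intro W_comp W_reflection B_sub hh)
    have nn: "?p \<noteq> 0" "?q \<noteq> 0" "?N \<noteq> 0" using nz nz' kB(1)[OF hh(2)] Lw[OF hh(1)] by auto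
    have N': "?q * ?N = ?p * ?N'" by (rule simple_L[OF hh])
    have "?q * (?N * h w) + ?N * r y = ?p * (?N' * h s) + ?N' * r y"
      using simple[OF hh, of 0] by (simp add: L0 Ah hh(1) s Lr[OF hh(1), of y] Lr[OF s, of y])
    from proportional_pair_shift[OF nn N' this] have "h s = h w + r y * (1 / ?q - 1 / ?p)" .
    then show ?thesis unfolding \<kappa>[OF kB(2)[OF hh(2)]] by simp
  qed
  \<comment> \<open>The summand 1 is the shift of the linear part under translation by y.\<close>
  have h_affine: "h s = h w + of_real (1 + \<kappa> y (k (\<phi>, 0))) * r y"
    if hh: "w \<in> W" "y = inv w (coroot \<phi>)" "s = reflection \<phi> \<circ> w" for w y s
  proof -
    let ?p = "?\<mu> y + k (\<phi>, 0)" and ?q = "?\<mu> y - k (\<phi>, 0)" and ?N = "L w b0" and ?N' = "exp (- ?\<mu> y) * L s b0"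
    have s: "s \<in> W" unfolding hh(3) by (intro W_comp W_reflection phi_in hh)
    have nn: "?p \<noteq> 0" "?q \<noteq> 0" "?N \<noteq> 0" using nz nz' kphi(1) Lw[OF hh(1)] by auto
    have N': "?p * ?N = ?q * ?N'" using affine_L[OF hh, of b0] by (simp add: mult_ac)
    have "?p * (?N * h w) + ?N * r y = ?q * (?N' * (h s - r y)) + ?N' * r y"
      using affine[OF hh, of 0] by (simp add: L0 Ah hh(1) s Lr[OF hh(1), of y] Lr[OF s, of y] algebra_simps)
    from proportional_pair_shift[OF nn(2,1,3) N' this] have "h s = h w + r y - r y * (1 / ?q - 1 / ?p)"
      by (simp add: right_diff_distrib diff_eq_eq)
    then show ?thesis unfolding \<kappa>[OF kphi(2)] by (simp add: algebra_simps)
  qed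
  \<comment> \<open>Second maximum principle: maximality of Re h at w makes Re (r \<circ>
    \<open>inv w\<close>) dominant and nonpositive at the highest coroot, hence zero, against r b0 =
    1.\<close>
  define M where "M = Max ((\<lambda>w. Re (h w)) ` W)"
  have "W \<noteq> {}" using W_id by blast
  then have "M \<in> (\<lambda>w. Re (h w)) ` W" unfolding M_def using finite_W by (intro Max_in) auto
  then obtain w where w: "w \<in> W" "Re (h w) = M" by auto
  have le: "Re (h u) \<le> Re (h w)" if "u \<in> W" for u unfolding w(2) M_def using finite_W that by simp
  have "0 \<le> Re (r (inv w (coroot \<alpha>)))" if \<alpha>: "\<alpha> \<in> B" for \<alpha>
  proof -
    have "Re (h (reflection \<alpha> \<circ> w)) \<le> Re (h w)"
      by (intro le W_comp W_reflection B_sub \<alpha> w)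
    then show ?thesis
      unfolding h_simple[OF w(1) \<alpha> refl refl] using \<kappa>_pos[OF kB(2)[OF \<alpha>]] by (simp add: zero_le_mult_iff less_le_not_le)
  qed
  moreover have "Re (r (inv w (coroot \<phi>))) \<le> 0"
  proof -
    let ?y = "inv w (coroot \<phi>)"
    have "Re (h (reflection \<phi> \<circ> w)) \<le> Re (h w)"
      by (intro le W_comp W_reflection phi_in w)
    then have "(1 + \<kappa> ?y (k (\<phi>, 0))) * Re (r ?y) \<le> 0"
      unfolding h_affine[OF w(1) refl refl] by simp
    moreover have "0 < 1 + \<kappa> ?y (k (\<phi>, 0))" using \<kappa>_pos[OF kphi(2), of ?y] by simp
    ultimately show ?thesis by (simp add: mult_le_0_iff)
  qed
  moreover have r_lin: "linear r"
    unfolding r_def by (rule linearI) (simp_all add: linear_add[OF L_lin] linear_scale[OF L_lin] add_divide_distrib scaleR_conv_of_real)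
  have "linear (\<lambda>v. Re (r (inv w v)))"
    using linear_compose[OF W_linear[OF W_inv[OF w(1)]] linear_compose[OF r_lin bounded_linear.linear[OF bounded_linear_Re]]]
    by (simp add: o_def)
  ultimately have "Re (r (inv w (w b0))) = 0"
    by (intro dominant_nonpos_zero[where f = "\<lambda>v. Re (r (inv w v))"])
  then show False using Lid by (simp add: W_inv_apply[OF w(1)] r_def)
qed

end

section \<open>Expansion in exponentials\<close>

lemma dir_deriv_cmult_exp:
  assumes "linear \<mu>"
  shows "dir_deriv v (\<lambda>x. a * exp (\<mu> x)) = (\<lambda>x. a * (\<mu> v * exp (\<mu> x)))"
  by (rule ext) (rule dir_deriv_has_derivative[OF has_derivative_mult_right[OF exp_linear_has_derivative[OF assms]]])

lemma iterated_shifted_deriv_exp: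
  assumes "linear \<mu>"
  shows "iterated_shifted_deriv v cs (\<lambda>x. a * exp (\<mu> x)) = (\<lambda>x. prod_list (map (\<lambda>c. \<mu> v - c) cs) * a * exp (\<mu> x))"
proof (induction cs)
  case (Cons c cs)
  have "iterated_shifted_deriv v (c # cs) (\<lambda>x. a * exp (\<mu> x)) =
      shifted_deriv v (- c) (\<lambda>x. prod_list (map (\<lambda>c. \<mu> v - c) cs) * a * exp (\<mu> x))"
    by (simp only: iterated_shifted_deriv_simps Cons.IH)
  also have "\<dots> = (\<lambda>x. prod_list (map (\<lambda>c. \<mu> v - c) (c # cs)) * a * exp (\<mu> x))"
    unfolding shifted_deriv_def dir_deriv_cmult_exp[OF assms] by (simp add: algebra_simps)
  finally show ?case .
qed simp

lemma c_factor_uminus: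
  fixes t c :: complex
  assumes "t \<noteq> 0" "t + c \<noteq> 0"
  shows "(t - c) / (t + c) * ((t + c) / t) = (- t + c) / - t"
proof -
  have "- t + c = - (t - c)" by simp
  then have "(- t + c) / - t = (t - c) / t" by (simp only: minus_divide_divide)
  then show ?thesis using assms by simp
qed

text \<open>Induction on M: translating the relation by y and subtracting exp (\<nu> y) times the
  original eliminates \<nu>.\<close>

lemma exponentials_independent:
  fixes M :: "('a::euclidean_space \<Rightarrow> complex) set"
  assumes "finite M" and lin: "\<And>\<mu>. \<mu> \<in> M \<Longrightarrow> linear \<mu>"
    and zero: "\<And>x. (\<Sum>\<mu>\<in>M. c \<mu> * exp (\<mu> x)) = 0"
  shows "\<mu> \<in> M \<Longrightarrow> c \<mu> = 0"
  using assms
proof (induction M arbitrary: c \<mu> rule: finite_induct)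
  case (insert \<nu> M)
  have zero: "c \<nu> * exp (\<nu> x) + (\<Sum>\<mu>\<in>M. c \<mu> * exp (\<mu> x)) = 0" for x
    using insert.prems(3)[of x] insert.hyps by simp
  have "c \<mu> * (exp (\<mu> y) - exp (\<nu> y)) = 0" if \<mu>: "\<mu> \<in> M" for \<mu> y
  proof (rule insert.IH[OF \<mu>, where c = "\<lambda>\<mu>. c \<mu> * (exp (\<mu> y) - exp (\<nu> y))"])
    fix x
    have add: "\<kappa> (x + y) = \<kappa> x + \<kappa> y" if "\<kappa> \<in> insert \<nu> M" for \<kappa>
      using linear_add[OF insert.prems(2)[OF that]] .
    have "(\<Sum>\<mu>\<in>M. c \<mu> * (exp (\<mu> y) - exp (\<nu> y)) * exp (\<mu> x)) =
        (\<Sum>\<mu>\<in>M. c \<mu> * exp (\<mu> (x + y)) - exp (\<nu> y) * (c \<mu> * exp (\<mu> x)))"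
      by (rule sum.cong) (simp_all add: add exp_add algebra_simps)
    also have "\<dots> = (\<Sum>\<mu>\<in>M. c \<mu> * exp (\<mu> (x + y))) - exp (\<nu> y) * (\<Sum>\<mu>\<in>M. c \<mu> * exp (\<mu> x))"
      by (simp add: sum_subtractf sum_distrib_left)
    also have "(\<Sum>\<mu>\<in>M. c \<mu> * exp (\<mu> (x + y))) = - (c \<nu> * exp (\<nu> (x + y)))"
      using zero[of "x + y"] by (simp add: eq_neg_iff_add_eq_0 add.commute)
    also have "(\<Sum>\<mu>\<in>M. c \<mu> * exp (\<mu> x)) = - (c \<nu> * exp (\<nu> x))"
      using zero[of x] by (simp add: eq_neg_iff_add_eq_0 add.commute)
    also have "- (c \<nu> * exp (\<nu> (x + y))) - exp (\<nu> y) * - (c \<nu> * exp (\<nu> x)) = 0"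
      by (simp add: add exp_add)
    finally show "(\<Sum>\<mu>\<in>M. c \<mu> * (exp (\<mu> y) - exp (\<nu> y)) * exp (\<mu> x)) = 0" .
  qed (use insert.prems in auto)
  \<comment> \<open>As exp is periodic, exponents cannot be compared point by point; the derivatives
    of the two exponentials at 0 recover them.\<close>
  moreover have "\<exists>y. exp (\<mu> y) \<noteq> exp (\<nu> y)" if \<mu>: "\<mu> \<in> M" for \<mu>
  proof (rule ccontr)
    assume "\<not> ?thesis"
    then have "(\<lambda>x. exp (\<mu> x)) = (\<lambda>x. exp (\<nu> x))" by auto
    then have "dir_deriv v (\<lambda>x. exp (\<mu> x)) 0 = dir_deriv v (\<lambda>x. exp (\<nu> x)) 0" for v by simp
    then have "\<mu> v = \<nu> v" for v
      using insert.prems(2) \<mu> by (simp add: dir_deriv_exp linear_0)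
    then have "\<mu> = \<nu>" by (rule ext)
    then show False using \<mu> insert.hyps by simp
  qed
  ultimately have M0: "c \<mu> = 0" if "\<mu> \<in> M" for \<mu>
    using that by (metis mult_eq_0_iff right_minus_eq)
  have "c \<nu> * exp (\<nu> 0) = 0" using zero[of 0] M0 by simp
  then show ?case using insert.prems(1) M0 by auto
qed simp

context bethe_data
begin

definition orbit :: "('a \<Rightarrow> complex) set" where
  "orbit = (\<lambda>w. weyl_act w \<Lambda>) ` W"

lemma finite_orbit: "finite orbit" by (simp add: orbit_def finite_W)

lemma weyl_act_comp: "u \<in> W \<Longrightarrow> w \<in> W \<Longrightarrow> weyl_act (u \<circ> w) \<nu> = weyl_act u (weyl_act w \<nu>)"
  by (simp add: weyl_act_def W_inv_comp fun_eq_iff)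

lemma linear_weyl_act: "w \<in> W \<Longrightarrow> linear \<nu> \<Longrightarrow> linear (weyl_act w \<nu>)"
  unfolding weyl_act_def using linear_compose[OF W_linear[OF W_inv], of w \<nu>] by (simp add: o_def)

lemma linear_orbit: "\<mu> \<in> orbit \<Longrightarrow> linear \<mu>"
  unfolding orbit_def using linear_weyl_act[OF _ linear_Lambda] by blast

lemma weyl_act_id: "weyl_act id \<nu> = \<nu>" by (simp add: weyl_act_def)

lemma Lambda_in_orbit: "\<Lambda> \<in> orbit"
  unfolding orbit_def using weyl_act_id[of \<Lambda>, symmetric] W_id by (rule image_eqI)

lemma orbit_closed: "u \<in> W \<Longrightarrow> \<mu> \<in> orbit \<Longrightarrow> weyl_act u \<mu> \<in> orbit"
proof -
  assume u: "u \<in> W" and "\<mu> \<in> orbit"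
  then obtain w where w: "w \<in> W" "\<mu> = weyl_act w \<Lambda>" by (auto simp: orbit_def)
  then have "weyl_act u \<mu> = weyl_act (u \<circ> w) \<Lambda>" by (simp only: weyl_act_comp[OF u w(1)])
  then show ?thesis unfolding orbit_def using W_comp[OF u w(1)] by (rule image_eqI)
qed

lemma weyl_act_weyl_act_inv:
  assumes "u \<in> W" shows "weyl_act u (weyl_act (inv u) \<nu>) = \<nu>" "weyl_act (inv u) (weyl_act u \<nu>) = \<nu>"
  by (simp_all add: weyl_act_def W_inv_inv[OF assms] W_inv_apply[OF assms] W_apply_inv[OF assms])

lemma bij_betw_orbit: "u \<in> W \<Longrightarrow> bij_betw (weyl_act u) orbit orbit"
  by (rule bij_betw_byWitness[where f' = "weyl_act (inv u)"])
    (auto simp: weyl_act_weyl_act_inv orbit_closed W_inv)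

lemma orbit_induct [consumes 1, case_names base step]:
  assumes "\<mu> \<in> orbit" "P \<Lambda>"
    and step: "\<And>\<alpha> \<mu>. \<alpha> \<in> B \<Longrightarrow> \<mu> \<in> orbit \<Longrightarrow> P \<mu> \<Longrightarrow> P (weyl_act (reflection \<alpha>) \<mu>)"
  shows "P \<mu>"
proof -
  have "P (weyl_act w \<Lambda>)" if "w \<in> W" for w
    using that
  proof (induction rule: W_induct)
    case id then show ?case using assms(2) by (simp only: weyl_act_id)
  next
    case (step \<beta> w)
    have "weyl_act w \<Lambda> \<in> orbit" using step(2) by (simp add: orbit_def)
    from assms(3)[OF step(1) this step(3)] show ?case
      by (simp only: weyl_act_comp[OF W_reflection[OF B_sub[OF step(1)]] step(2)])
  qed
  then show ?thesis using assms(1) by (auto simp: orbit_def)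
qed

text \<open>For each v the annihilating product forces \<mu>(v) = \<lambda>(u v) for some u in W
  that may depend on v. If no u worked for all v, a generic v would make all these differences
  nonzero at once.\<close>

lemma exponent_in_orbit:
  assumes G: "G \<in> solutions" and eig: "\<And>b. b \<in> Basis \<Longrightarrow> solutions.X b (c b) G = 0" and "G id 0 \<noteq> 0"
  shows "coordinate_form c \<in> orbit"
proof -
  let ?\<mu> = "coordinate_form c"
  obtain us where us: "distinct us" "set us = W" using finite_distinct_list[OF finite_W] by blast
  have Gid: "G id = (\<lambda>x. G id 0 * exp (?\<mu> x))"
    by (rule ext) (rule eigen_component(1)[OF G eig])
  have cover: "\<exists>u\<in>W. ?\<mu> v = \<Lambda> (u v)" for v
  proof -
    have "iterated_shifted_deriv v (map (\<lambda>u. \<Lambda> (u v)) us) (G id) = (\<lambda>x. 0)"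
      using G us unfolding solutions_def by blast
    then have "iterated_shifted_deriv v (map (\<lambda>u. \<Lambda> (u v)) us) (\<lambda>x. G id 0 * exp (?\<mu> x)) 0 = 0"
      unfolding Gid[symmetric] by (rule fun_cong)
    then have "prod_list (map (\<lambda>c. ?\<mu> v - c) (map (\<lambda>u. \<Lambda> (u v)) us)) = 0"
      using \<open>G id 0 \<noteq> 0\<close> unfolding iterated_shifted_deriv_exp[OF linear_coordinate_form] by simp
    then show ?thesis using us(2) by (auto simp: prod_list_zero_iff)
  qed
  have "\<exists>u\<in>W. \<forall>v. ?\<mu> v = \<Lambda> (u v)"
  proof (rule ccontr)
    assume "\<not> ?thesis"
    then have "\<exists>v. \<forall>d\<in>(\<lambda>u v. ?\<mu> v - \<Lambda> (u v)) ` W. d v \<noteq> 0"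
      using linear_compose[OF W_linear linear_Lambda]
      by (intro generic_vector) (auto simp: finite_W o_def intro!: linear_compose_sub linear_coordinate_form)
    then show False using cover by auto
  qed
  then obtain u where u: "u \<in> W" "\<And>v. ?\<mu> v = \<Lambda> (u v)" by blast
  then have "?\<mu> = weyl_act (inv u) \<Lambda>" by (simp add: weyl_act_def W_inv_inv fun_eq_iff)
  then show ?thesis using u(1) W_inv by (auto simp: orbit_def)
qed

lemma imaginary_of_orbit:
  assumes "\<mu> \<in> orbit" "\<And>v. Re (\<mu> v) = 0" shows "Re (\<Lambda> v) = 0"
proof -
  obtain w where w: "w \<in> W" "\<mu> = weyl_act w \<Lambda>" using assms(1) by (auto simp: orbit_def)
  have "\<Lambda> v = \<mu> (w v)" by (simp add: w(2) weyl_act_def W_inv_apply[OF w(1)])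
  then show ?thesis using assms(2) by simp
qed

text \<open>Both conclusions survive linear combinations, so it suffices to check joint generalized
  eigentuples, which the exclusion of rank two makes eigentuples. One with \<open>G id 0 = 0\<close>
  contributes nothing to the component at \<open>id\<close>.\<close>

lemma solutions_expansion:
  assumes "H \<in> solutions"
  shows "(\<exists>C. \<forall>x. H id x = (\<Sum>\<mu>\<in>orbit. C \<mu> * exp (\<mu> x))) \<and> ((\<forall>x. H id x = 0) \<or> (\<forall>v. Re (\<Lambda> v) = 0))"
proof -
  define good where "good H \<longleftrightarrow>
    (\<exists>C. \<forall>x. H id x = (\<Sum>\<mu>\<in>orbit. C \<mu> * exp (\<mu> x))) \<and> ((\<forall>x. H id x = 0) \<or> (\<forall>v. Re (\<Lambda> v) = 0))" for H :: "'a tuple"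
  obtain us where us: "distinct us" "set us = W" using finite_distinct_list[OF finite_W] by blast
  have fold: "foldr (solutions.X v) cs H = (\<lambda>w. iterated_shifted_deriv v cs (H w))" for v cs H
    by (induction cs) (simp_all add: solutions_X)
  have ann: "\<exists>cs. \<forall>H\<in>solutions. foldr (solutions.X v) cs H = 0" for v
    unfolding fold zero_fun_def
    by (intro exI[of _ "map (\<lambda>u. \<Lambda> (u v)) us"]) (use us in \<open>auto simp: solutions_def\<close>)
  have "H \<in> tuple.span (solutions.joint_gen_eigen Basis)"
    by (rule solutions.in_span_joint_gen_eigen[OF finite_Basis ann assms])
  then have "good H"
  proof (rule tuple.span_induct)
    show "tuple.subspace {H. good H}"
    proof (rule tuple.subspaceI)
      show "0 \<in> {H. good H}" by (auto simp: good_def intro!: exI[of _ "\<lambda>_. 0"])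
      show "H + G \<in> {H. good H}" if hg: "H \<in> {H. good H}" "G \<in> {H. good H}" for H G
      proof -
        obtain C D where "\<forall>x. H id x = (\<Sum>\<mu>\<in>orbit. C \<mu> * exp (\<mu> x))" "\<forall>x. G id x = (\<Sum>\<mu>\<in>orbit. D \<mu> * exp (\<mu> x))"
          using hg unfolding good_def by blast
        then have "\<forall>x. (H + G) id x = (\<Sum>\<mu>\<in>orbit. (C \<mu> + D \<mu>) * exp (\<mu> x))"
          by (simp add: distrib_right sum.distrib)
        moreover have "(\<forall>x. (H + G) id x = 0) \<or> (\<forall>v. Re (\<Lambda> v) = 0)" using hg by (auto simp: good_def)
        ultimately show ?thesis unfolding good_def mem_Collect_eq by (intro conjI exI[of _ "\<lambda>\<mu>. C \<mu> + D \<mu>"])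
      qed
      show "tuple_scale c H \<in> {H. good H}" if hg: "H \<in> {H. good H}" for H c
      proof -
        obtain C where "\<forall>x. H id x = (\<Sum>\<mu>\<in>orbit. C \<mu> * exp (\<mu> x))"
          using hg unfolding good_def by blast
        then have "\<forall>x. tuple_scale c H id x = (\<Sum>\<mu>\<in>orbit. (c * C \<mu>) * exp (\<mu> x))"
          by (simp add: tuple_scale_def sum_distrib_left mult.assoc)
        moreover have "(\<forall>x. tuple_scale c H id x = 0) \<or> (\<forall>v. Re (\<Lambda> v) = 0)"
          using hg by (auto simp: good_def tuple_scale_def)
        ultimately show ?thesis unfolding good_def mem_Collect_eq by (intro conjI exI[of _ "\<lambda>\<mu>. c * C \<mu>"])
      qed
    qed
    fix G assume "G \<in> solutions.joint_gen_eigen Basis"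
    then have GS: "G \<in> solutions" and "\<forall>v\<in>Basis. \<exists>c n. (solutions.X v c ^^ n) G = 0"
      by (simp_all add: solutions.joint_gen_eigen_def)
    then obtain c n where cn: "\<And>v. v \<in> Basis \<Longrightarrow> (solutions.X v (c v) ^^ n v) G = 0" by metis
    have eig: "solutions.X b (c b) G = 0" if "b \<in> Basis" for b
      by (rule solutions.joint_gen_eigen_semisimple[where B = Basis and c = c and n = n,
            OF finite_Basis cn GS no_rank_two_solution[where c = c] that])
    have Gid: "G id x = G id 0 * exp (coordinate_form c x)" for x by (rule eigen_component(1)[OF GS eig])
    show "good G"
    proof (cases "G id 0 = 0")
      case True
      then have "G id x = 0" for x using Gid[of x] by simp
      then show ?thesis by (auto simp: good_def intro!: exI[of _ "\<lambda>_. 0"])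
    next
      case False
      have O: "coordinate_form c \<in> orbit" by (rule exponent_in_orbit[OF GS eig False])
      have "G \<noteq> 0" using False by auto
      then have "Re (\<Lambda> v) = 0" for v
        using imaginary_of_orbit[OF O] eigen_exponent_imaginary[OF GS eig] by blast
      moreover have "G id x = (\<Sum>\<mu>\<in>orbit. (if \<mu> = coordinate_form c then G id 0 else 0) * exp (\<mu> x))" for x
      proof -
        have "(\<Sum>\<mu>\<in>orbit. (if \<mu> = coordinate_form c then G id 0 else 0) * exp (\<mu> x)) =
          (\<Sum>\<mu>\<in>orbit. if \<mu> = coordinate_form c then G id 0 * exp (coordinate_form c x) else 0)"
          by (rule sum.cong) auto
        then show ?thesis using O finite_orbit Gid[of x] by simp
      qed
      ultimately show ?thesis
        unfolding good_def by (intro conjI exI[of _ "\<lambda>\<mu>. if \<mu> = coordinate_form c then G id 0 else 0"]) auto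
    qed
  qed
  then show ?thesis by (simp only: good_def)
qed

text \<open>The simple reflection permutes the positive roots other than \<alpha>, so only one
  factor changes, from (m + k) / m to (m - k) / m.\<close>

lemma c_function_simple_reflection:
  fixes \<mu> :: "'a \<Rightarrow> complex"
  assumes \<alpha>: "\<alpha> \<in> B" and reg: "\<mu> (coroot \<alpha>) \<noteq> 0" and \<mu>: "linear \<mu>"
  shows "(\<mu> (coroot \<alpha>) + k (\<alpha>, 0)) * c_function R B k (weyl_act (reflection \<alpha>) \<mu>) =
    (\<mu> (coroot \<alpha>) - k (\<alpha>, 0)) * c_function R B k \<mu>"
proof -
  let ?F = "\<lambda>\<mu> \<gamma>. (\<mu> (coroot \<gamma>) + complex_of_real (k (\<gamma>, 0))) / \<mu> (coroot \<gamma>)"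
  let ?P = "positive_roots R B"
  have \<alpha>P: "\<alpha> \<in> ?P" using nonneg_comb_base[OF finite_B \<alpha>] B_sub[OF \<alpha>] by (simp add: positive_roots_def)
  have split: "c_function R B k \<nu> = ?F \<nu> \<alpha> * (\<Prod>\<gamma>\<in>?P - {\<alpha>}. ?F \<nu> \<gamma>)" for \<nu>
    unfolding c_function_def by (rule prod.remove[OF finite_positive_roots \<alpha>P])
  have "(\<Prod>\<gamma>\<in>?P - {\<alpha>}. ?F (weyl_act (reflection \<alpha>) \<mu>) \<gamma>) = (\<Prod>\<gamma>\<in>?P - {\<alpha>}. ?F \<mu> \<gamma>)"
  proof (rule prod.reindex_bij_witness[where i = "dual_reflection \<alpha>" and j = "dual_reflection \<alpha>"])
    fix \<gamma> assume \<gamma>: "\<gamma> \<in> ?P - {\<alpha>}"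
    show "dual_reflection \<alpha> \<gamma> \<in> ?P - {\<alpha>}" using \<gamma> by (intro dual_reflection_simple_positive[OF \<alpha>]) auto
    show "?F \<mu> (dual_reflection \<alpha> \<gamma>) = ?F (weyl_act (reflection \<alpha>) \<mu>) \<gamma>"
      using \<gamma> k_dual_reflection[OF B_sub[OF \<alpha>] positive_roots_subset, of \<gamma>]
      by (simp add: weyl_act_def inv_reflection coroot_dual_reflection)
    show "dual_reflection \<alpha> \<gamma> \<in> ?P - {\<alpha>}" by fact
  qed (simp_all only: dual_reflection_dual_reflection)
  moreover have "weyl_act (reflection \<alpha>) \<mu> (coroot \<alpha>) = - \<mu> (coroot \<alpha>)"
    using coroot_dual_reflection[of \<alpha> \<alpha>]
    by (simp add: weyl_act_def inv_reflection dual_reflection_self[OF B_sub[OF \<alpha>]] coroot_uminus linear_neg[OF \<mu>] flip: coroot_dual_reflection)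
  ultimately show ?thesis
    unfolding split[of "weyl_act (reflection \<alpha>) \<mu>"] split[of \<mu>] using reg by (simp add: field_simps)
qed

text \<open>\<phi> splits the positive roots: those of exponent 0 are fixed by s_\<phi>, those of
  exponent 1 are permuted by \<gamma> \<mapsto> - s_\<phi> \<gamma>, and \<phi> itself has exponent
  2. Outside exponent 0 every root changes its c-factor by one quotient (m - k) / (m + k); the
  second power at \<phi> converts the prefactor.\<close>

lemma bethe_product:
  fixes \<mu> :: "'a \<Rightarrow> complex"
  assumes \<mu>: "linear \<mu>" and reg: "\<And>\<gamma>. \<gamma> \<in> R \<Longrightarrow> \<mu> (coroot \<gamma>) \<noteq> 0"
    and plus: "\<And>\<gamma>. \<gamma> \<in> R \<Longrightarrow> \<mu> (coroot \<gamma>) + k (\<gamma>, 0) \<noteq> 0"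
  shows "(\<Prod>\<gamma>\<in>positive_roots R B. ((\<mu> (coroot \<gamma>) - k (\<gamma>, 0)) / (\<mu> (coroot \<gamma>) + k (\<gamma>, 0)))
           powi \<lfloor>blinfun_apply \<gamma> (coroot \<phi>)\<rfloor>) * ((\<mu> (coroot \<phi>) + k (\<phi>, 0)) * c_function R B k \<mu>) =
    (\<mu> (coroot \<phi>) - k (\<phi>, 0)) * c_function R B k (weyl_act (reflection \<phi>) \<mu>)"
proof -
  let ?P = "positive_roots R B"
  define P0 where "P0 = {\<gamma> \<in> ?P. blinfun_apply \<gamma> (coroot \<phi>) = 0}"
  define P1 where "P1 = {\<gamma> \<in> ?P. blinfun_apply \<gamma> (coroot \<phi>) = 1}"
  have phi2: "blinfun_apply \<phi> (coroot \<phi>) = 2" by (rule coroot_pairing[OF phi_in])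
  have P: "?P = P0 \<union> (P1 \<union> {\<phi>})" "P0 \<inter> (P1 \<union> {\<phi>}) = {}" "P1 \<inter> {\<phi>} = {}"
    using positive_roots_phi_cases phi_positive phi2 by (auto simp: P0_def P1_def)
  have fin: "finite P0" "finite P1" using finite_positive_roots by (auto simp: P0_def P1_def)
  have prod_P: "(\<Prod>\<gamma>\<in>?P. g \<gamma>) = (\<Prod>\<gamma>\<in>P0. g \<gamma>) * ((\<Prod>\<gamma>\<in>P1. g \<gamma>) * g \<phi>)" for g :: "'a dual \<Rightarrow> complex"
    unfolding P(1) by (subst prod.union_disjoint, (use fin P in auto)[3], subst prod.union_disjoint) (use fin P in auto)
  let ?F = "\<lambda>\<mu> \<gamma>. (\<mu> (coroot \<gamma>) + complex_of_real (k (\<gamma>, 0))) / \<mu> (coroot \<gamma>)"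
  let ?\<theta> = "\<lambda>\<gamma>. (\<mu> (coroot \<gamma>) - complex_of_real (k (\<gamma>, 0))) / (\<mu> (coroot \<gamma>) + complex_of_real (k (\<gamma>, 0)))"
  let ?\<nu> = "weyl_act (reflection \<phi>) \<mu>"
  have refl: "?\<nu> (coroot \<gamma>) = \<mu> (coroot (dual_reflection \<phi> \<gamma>))" for \<gamma>
    by (simp add: weyl_act_def inv_reflection coroot_dual_reflection)
  have c0: "(\<Prod>\<gamma>\<in>P0. ?F ?\<nu> \<gamma>) = (\<Prod>\<gamma>\<in>P0. ?F \<mu> \<gamma>)"
  proof (rule prod.cong)
    fix \<gamma> assume "\<gamma> \<in> P0"
    then have "dual_reflection \<phi> \<gamma> = \<gamma>" by (simp add: P0_def dual_reflection_def)
    then show "?F ?\<nu> \<gamma> = ?F \<mu> \<gamma>" by (simp only: refl)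
  qed simp
  have P1: "- dual_reflection \<phi> \<gamma> \<in> P1" "\<gamma> \<in> R" if "\<gamma> \<in> P1" for \<gamma>
  proof -
    have g: "\<gamma> \<in> ?P" "blinfun_apply \<gamma> (coroot \<phi>) = 1" using that by (auto simp: P1_def)
    then have "- dual_reflection \<phi> \<gamma> \<in> ?P" using positive_roots_phi_cases[OF g(1)] phi2 by auto
    moreover have "blinfun_apply (- dual_reflection \<phi> \<gamma>) (coroot \<phi>) = 1"
      by (simp add: dual_reflection_def blinfun.minus_left blinfun.diff_left blinfun.scaleR_left g phi2)
    ultimately show "- dual_reflection \<phi> \<gamma> \<in> P1" by (simp add: P1_def)
    show "\<gamma> \<in> R" using g(1) by (rule positive_roots_subset)
  qed
  have inv: "- dual_reflection \<phi> (- dual_reflection \<phi> \<gamma>) = \<gamma>" for \<gamma>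
    by (rule blinfun_eqI) (simp add: blinfun.minus_left dual_reflection_apply reflection_reflection)
  \<comment> \<open>- s_\<phi> is an involution of \<open>P1\<close>, and negating the argument of a
    c-factor multiplies it by the Bethe quotient.\<close>
  have "(\<Prod>\<gamma>\<in>P1. ?F ?\<nu> \<gamma>) = (\<Prod>\<gamma>\<in>P1. ?\<theta> \<gamma> * ?F \<mu> \<gamma>)"
  proof (rule prod.reindex_bij_witness[where i = "\<lambda>\<gamma>. - dual_reflection \<phi> \<gamma>" and j = "\<lambda>\<gamma>. - dual_reflection \<phi> \<gamma>"])
    fix \<gamma> assume \<gamma>: "\<gamma> \<in> P1"
    let ?\<gamma> = "- dual_reflection \<phi> \<gamma>"
    have R': "?\<gamma> \<in> R" using P1 \<gamma> by blast
    have "k (?\<gamma>, 0) = k (\<gamma>, 0)"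
      using k_uminus[OF R_reflection[OF phi_in P1(2)[OF \<gamma>]]] k_dual_reflection[OF phi_in P1(2)[OF \<gamma>]] by simp
    moreover have "?\<nu> (coroot \<gamma>) = - \<mu> (coroot ?\<gamma>)"
      unfolding refl coroot_uminus linear_neg[OF \<mu>] by simp
    ultimately show "?\<theta> ?\<gamma> * ?F \<mu> ?\<gamma> = ?F ?\<nu> \<gamma>"
      using c_factor_uminus[OF reg[OF R'] plus[OF R']] by (simp only:)
  qed (simp_all add: inv P1)
  then have c1: "(\<Prod>\<gamma>\<in>P1. ?F ?\<nu> \<gamma>) = (\<Prod>\<gamma>\<in>P1. ?\<theta> \<gamma>) * (\<Prod>\<gamma>\<in>P1. ?F \<mu> \<gamma>)"
    by (simp only: prod.distrib)
  have "?\<nu> (coroot \<phi>) = - \<mu> (coroot \<phi>)"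
    unfolding refl dual_reflection_self[OF phi_in] coroot_uminus linear_neg[OF \<mu>] ..
  then have c2: "?F ?\<nu> \<phi> = ?\<theta> \<phi> * ?F \<mu> \<phi>"
    using c_factor_uminus[OF reg[OF phi_in] plus[OF phi_in]] by (simp only:)
  have "(\<Prod>\<gamma>\<in>P0. ?\<theta> \<gamma> powi \<lfloor>blinfun_apply \<gamma> (coroot \<phi>)\<rfloor>) = 1"
    by (rule prod.neutral) (simp add: P0_def)
  moreover have "(\<Prod>\<gamma>\<in>P1. ?\<theta> \<gamma> powi \<lfloor>blinfun_apply \<gamma> (coroot \<phi>)\<rfloor>) = (\<Prod>\<gamma>\<in>P1. ?\<theta> \<gamma>)"
    by (rule prod.cong) (simp_all add: P1_def)
  moreover have "?\<theta> \<phi> powi \<lfloor>blinfun_apply \<phi> (coroot \<phi>)\<rfloor> = ?\<theta> \<phi> * ?\<theta> \<phi>"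
    by (simp add: phi2 power_int_def power2_eq_square)
  ultimately have e1: "(\<Prod>\<gamma>\<in>?P. ?\<theta> \<gamma> powi \<lfloor>blinfun_apply \<gamma> (coroot \<phi>)\<rfloor>) = (\<Prod>\<gamma>\<in>P1. ?\<theta> \<gamma>) * (?\<theta> \<phi> * ?\<theta> \<phi>)"
    unfolding prod_P by simp
  have e2: "c_function R B k ?\<nu> = (\<Prod>\<gamma>\<in>P1. ?\<theta> \<gamma>) * ?\<theta> \<phi> * c_function R B k \<mu>"
    unfolding c_function_def prod_P c0 c1 c2 by (simp add: mult_ac)
  have e3: "?\<theta> \<phi> * (\<mu> (coroot \<phi>) + k (\<phi>, 0)) = \<mu> (coroot \<phi>) - k (\<phi>, 0)"
    using plus[OF phi_in] by simp
  have "A * (t * t) * (p * c) = (t * p) * (A * t * c)" for A t p c :: complex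
    by (simp only: mult_ac)
  then show ?thesis unfolding e1 e2 by (rule trans) (simp only: e3)
qed

end

section \<open>Invariant differential equations and integral-reflection operators\<close>

definition endo_on :: "'m::ab_group_add set \<Rightarrow> ('m \<Rightarrow> 'm) \<Rightarrow> bool" where
  "endo_on S T \<longleftrightarrow> (\<forall>g\<in>S. T g \<in> S) \<and> (\<forall>g\<in>S. \<forall>h\<in>S. T (g - h) = T g - T h)"

text \<open>The coefficient of T^j in the product of the factors T - D u applied to f. It is formed
  without T, so that a scalar and later a derivative can be substituted for T.\<close>

fun operator_coeff :: "('u \<Rightarrow> 'm \<Rightarrow> 'm) \<Rightarrow> 'u list \<Rightarrow> 'm \<Rightarrow> nat \<Rightarrow> 'm::ab_group_add" where
  "operator_coeff D [] f j = (if j = 0 then f else 0)"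
| "operator_coeff D (u # us) f j = (case j of 0 \<Rightarrow> 0 | Suc i \<Rightarrow> operator_coeff D us f i) - D u (operator_coeff D us f j)"

context
  fixes S :: "'m::ab_group_add set" and T :: "'m \<Rightarrow> 'm" and D :: "'u \<Rightarrow> 'm \<Rightarrow> 'm"
  assumes S: "0 \<in> S" "\<And>g h. g \<in> S \<Longrightarrow> h \<in> S \<Longrightarrow> g - h \<in> S"
    and D: "\<And>u. endo_on S (D u)"
begin

lemma endo_zero: "endo_on S E \<Longrightarrow> E 0 = 0"
  using S unfolding endo_on_def by (metis diff_self)

lemma endo_minus: "endo_on S E \<Longrightarrow> g \<in> S \<Longrightarrow> E (- g) = - E g"
  using endo_zero[of E] S unfolding endo_on_def by (metis diff_0)

lemma S_uminus: "g \<in> S \<Longrightarrow> - g \<in> S" using S by (metis diff_0)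

lemma S_add: "g \<in> S \<Longrightarrow> h \<in> S \<Longrightarrow> g + h \<in> S"
  using S(2)[OF _ S_uminus] by (metis diff_minus_eq_add)

lemma endo_add: "endo_on S E \<Longrightarrow> g \<in> S \<Longrightarrow> h \<in> S \<Longrightarrow> E (g + h) = E g + E h"
  using endo_minus[of E h] S_uminus[of h] unfolding endo_on_def by (metis diff_minus_eq_add)

lemma endo_sum:
  assumes "endo_on S E" "finite A" "\<And>a. a \<in> A \<Longrightarrow> g a \<in> S"
  shows "E (sum g A) = (\<Sum>a\<in>A. E (g a)) \<and> sum g A \<in> S"
  using assms(2,3) by (induction A rule: finite_induct) (simp_all add: endo_zero[OF assms(1)] endo_add[OF assms(1)] S S_add)

lemma endo_power: "endo_on S E \<Longrightarrow> endo_on S (E ^^ n)"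
  by (induction n) (auto simp: endo_on_def)

lemma operator_coeff_in: "f \<in> S \<Longrightarrow> operator_coeff D us f j \<in> S"
  using D by (induction us arbitrary: j) (auto simp: S endo_on_def split: nat.split)

lemma operator_coeff_zero: "length us < j \<Longrightarrow> operator_coeff D us f j = 0"
  using endo_zero[OF D] by (induction us arbitrary: j) (auto split: nat.split)

lemma foldr_operator_coeff:
  assumes T: "endo_on S T" and comm: "\<And>g u. g \<in> S \<Longrightarrow> T (D u g) = D u (T g)" and f: "f \<in> S"
  shows "foldr (\<lambda>u g. T g - D u g) us f = (\<Sum>j\<le>length us. (T ^^ j) (operator_coeff D us f j))"
proof (induction us)
  case (Cons u us)
  let ?c = "operator_coeff D us f" and ?n = "length us"
  have c: "?c j \<in> S" for j by (rule operator_coeff_in[OF f])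
  have Tn: "endo_on S (T ^^ j)" for j by (rule endo_power[OF T])
  have Tc: "(T ^^ j) g \<in> S" if "g \<in> S" for j g using Tn[of j] that by (simp add: endo_on_def)
  have comm_n: "(T ^^ j) (D u g) = D u ((T ^^ j) g)" if "g \<in> S" for j g
    using that by (induction j) (simp_all add: comm Tc)
  have Dc: "D u g \<in> S" if "g \<in> S" for g using D[of u] that by (simp add: endo_on_def)
  have "(\<Sum>j\<le>Suc ?n. (T ^^ j) (operator_coeff D (u # us) f j)) =
      (\<Sum>j\<le>Suc ?n. (T ^^ j) (case j of 0 \<Rightarrow> 0 | Suc i \<Rightarrow> ?c i) - D u ((T ^^ j) (?c j)))"
  proof (rule sum.cong)
    fix j
    have "(case j of 0 \<Rightarrow> 0 | Suc i \<Rightarrow> ?c i) \<in> S" using c S(1) by (simp split: nat.split)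
    then show "(T ^^ j) (operator_coeff D (u # us) f j) = (T ^^ j) (case j of 0 \<Rightarrow> 0 | Suc i \<Rightarrow> ?c i) - D u ((T ^^ j) (?c j))"
      using Tn[of j] Dc[OF c[of j]] unfolding endo_on_def by (simp add: comm_n[OF c])
  qed simp
  also have "\<dots> = (\<Sum>j\<le>Suc ?n. (T ^^ j) (case j of 0 \<Rightarrow> 0 | Suc i \<Rightarrow> ?c i)) - (\<Sum>j\<le>Suc ?n. D u ((T ^^ j) (?c j)))"
    by (rule sum_subtractf)
  also have "(\<Sum>j\<le>Suc ?n. (T ^^ j) (case j of 0 \<Rightarrow> 0 | Suc i \<Rightarrow> ?c i)) = (\<Sum>j\<le>?n. T ((T ^^ j) (?c j)))"
    by (subst sum.atMost_Suc_shift) simp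
  also have "\<dots> = T (\<Sum>j\<le>?n. (T ^^ j) (?c j))"
    using endo_sum[OF T, of "{..?n}" "\<lambda>j. (T ^^ j) (?c j)"] Tc[OF c] by simp
  also have "(\<Sum>j\<le>Suc ?n. D u ((T ^^ j) (?c j))) = D u (\<Sum>j\<le>?n. (T ^^ j) (?c j))"
    using endo_sum[OF D, of "{..?n}" "\<lambda>j. (T ^^ j) (?c j)" u] Tc[OF c] operator_coeff_zero[of us "Suc ?n" f]
      endo_zero[OF Tn, of "Suc ?n"] endo_zero[OF D[of u]] by simp
  finally show ?case using Cons.IH by simp
qed simp

end

lemma endo_on_smooth_deriv: "endo_on (Collect smooth) (dir_deriv v)"
  unfolding endo_on_def using dir_deriv_lincomb[of _ _ v 1 "-1"]
  by (auto intro: smooth_dir_deriv simp: fun_diff_def)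

lemma endo_on_smooth_cmult: "endo_on (Collect smooth) (\<lambda>g x. z * g x)"
  unfolding endo_on_def using smooth_lincomb[of _ _ z 0]
  by (auto simp: fun_diff_def algebra_simps)

lemma smooth_diff: "smooth f \<Longrightarrow> smooth g \<Longrightarrow> f - g \<in> Collect smooth"
  using smooth_lincomb[of f g 1 "-1"] by (simp add: fun_diff_def)

lemma dir_deriv_cmult: "smooth g \<Longrightarrow> dir_deriv v (\<lambda>x. z * g x) = (\<lambda>x. z * dir_deriv v g x)"
  using dir_deriv_lincomb[of g g v z 0] by simp

text \<open>The product of the factors z - y in the symmetric algebra, multiplied out into a list of
  terms.\<close>

fun linear_factors :: "complex \<Rightarrow> 'a list \<Rightarrow> 'a sym" where
  "linear_factors z [] = [(1, [])]"
| "linear_factors z (y # ys) = map (\<lambda>(c, vs). (- c, y # vs)) (linear_factors z ys) @ map (\<lambda>(c, vs). (z * c, vs)) (linear_factors z ys)"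

lemma sym_eval_linear_factors: "sym_eval (linear_factors z ys) M = prod_list (map (\<lambda>y. z - M y) ys)"
proof (induction ys)
  case (Cons y ys)
  have "sym_eval (map (\<lambda>(c, vs). (- c, y # vs)) p) M = - M y * sym_eval p M" for p
    unfolding sym_eval_def by (induction p) (auto simp: algebra_simps)
  moreover have "sym_eval (map (\<lambda>(c, vs). (z * c, vs)) p) M = z * sym_eval p M" for p :: "'a sym"
    unfolding sym_eval_def by (induction p) (auto simp: algebra_simps)
  moreover have "sym_eval (p @ q) M = sym_eval p M + sym_eval q M" for p q by (simp add: sym_eval_def)
  ultimately show ?case using Cons.IH by (simp add: algebra_simps)
qed (simp add: sym_eval_def)

lemma smooth_foldr: "smooth f \<Longrightarrow> smooth (foldr dir_deriv vs f)"
  by (induction vs) (simp_all add: smooth_dir_deriv)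

lemma sym_diff_Cons: "sym_diff ((c, vs) # p) f = (\<lambda>x. c * foldr dir_deriv vs f x + 1 * sym_diff p f x)"
  by (simp add: sym_diff_def fun_eq_iff)

lemma sym_diff_Nil: "sym_diff [] f = (\<lambda>x. 0)"
  by (simp add: sym_diff_def fun_eq_iff)

lemma smooth_sym_diff: "smooth f \<Longrightarrow> smooth (sym_diff p f)"
proof (induction p)
  case (Cons t p)
  then show ?case
    by (cases t) (simp only: sym_diff_Cons smooth_lincomb[OF smooth_foldr])
qed (simp add: sym_diff_Nil smooth_zero)

lemma sym_diff_linear_factors:
  assumes f: "smooth f"
  shows "sym_diff (linear_factors z ys) f = foldr (\<lambda>y g. (\<lambda>x. z * g x) - dir_deriv y g) ys f"
proof (induction ys)
  case (Cons y ys)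
  have "sym_diff (map (\<lambda>(c, vs). (- c, y # vs)) p) f = (\<lambda>x. - dir_deriv y (sym_diff p f) x)" for p
  proof (induction p)
    case (Cons t p)
    obtain c vs where t: "t = (c, vs)" by (cases t)
    have "dir_deriv y (sym_diff ((c, vs) # p) f) = (\<lambda>x. c * dir_deriv y (foldr dir_deriv vs f) x + 1 * dir_deriv y (sym_diff p f) x)"
      unfolding sym_diff_Cons by (rule dir_deriv_lincomb[OF smooth_foldr[OF f] smooth_sym_diff[OF f]])
    then show ?case using Cons.IH by (simp add: t sym_diff_Cons)
  qed (simp add: sym_diff_Nil dir_deriv_zero)
  moreover have "sym_diff (map (\<lambda>(c, vs). (z * c, vs)) p) f x = z * sym_diff p f x" for p x
    unfolding sym_diff_def by (induction p) (auto simp: algebra_simps)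
  moreover have "sym_diff (p @ q) f x = sym_diff p f x + sym_diff q f x" for p q x by (simp add: sym_diff_def)
  ultimately have "sym_diff (linear_factors z (y # ys)) f =
      (\<lambda>x. z * sym_diff (linear_factors z ys) f x) - dir_deriv y (sym_diff (linear_factors z ys) f)"
    by (simp add: fun_eq_iff)
  then show ?case unfolding Cons.IH by (simp only: foldr_Cons o_apply)
qed (simp add: sym_diff_def fun_eq_iff)

lemma power_cmult: "((\<lambda>g x. z * g x) ^^ j) g = (\<lambda>x. z ^ j * g x)" for g :: "'a \<Rightarrow> complex"
  by (induction j) (simp_all add: mult.assoc)

lemma foldr_factor_zero:
  assumes "y \<in> set ys" "D y = T" "T 0 = 0" "\<And>u. D u 0 = 0"
  shows "foldr (\<lambda>u g. T g - D u g) ys f = (0::'m::ab_group_add)"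
  using assms(1)
proof (induction ys)
  case (Cons u ys)
  then show ?case
    by (cases "u = y") (simp_all add: assms)
qed simp

lemma smooth_operator_coeff:
  fixes F :: "'u \<Rightarrow> ('a::euclidean_space \<Rightarrow> complex) \<Rightarrow> 'a \<Rightarrow> complex"
  assumes f: "smooth f" and T: "endo_on (Collect smooth) T" and F: "\<And>u. endo_on (Collect smooth) (F u)"
    and comm: "\<And>g u. smooth g \<Longrightarrow> T (F u g) = F u (T g)"
  shows "foldr (\<lambda>u g. T g - F u g) us f = (\<Sum>j\<le>length us. (T ^^ j) (operator_coeff F us f j))"
proof (rule foldr_operator_coeff[where S = "Collect smooth" and D = F and T = T])
  show "(0 :: 'a \<Rightarrow> complex) \<in> Collect smooth" using smooth_zero by (simp add: zero_fun_def)
  show "g - h \<in> Collect smooth" if "g \<in> Collect smooth" "h \<in> Collect smooth" for g h :: "'a \<Rightarrow> complex"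
    using that smooth_diff by blast
qed (use assms in auto)

text \<open>Cayley-Hamilton argument: \<Prod>(z - \<partial>_y) f and \<Prod>(z - \<lambda>(y)) f
  agree as polynomials in the scalar z, hence in their coefficients. Substituting \<partial>_v for z
  makes the first product vanish, since v is one of the y.\<close>

lemma product_annihilates:
  fixes f :: "'a::euclidean_space \<Rightarrow> complex"
  assumes f: "smooth f" and v: "v \<in> set ys"
    and eig: "\<And>z x. sym_diff (linear_factors z ys) f x = sym_eval (linear_factors z ys) \<Lambda> * f x"
  shows "iterated_shifted_deriv v (map \<Lambda> ys) f = (\<lambda>x. 0)"
proof -
  let ?S = "Collect smooth :: ('a \<Rightarrow> complex) set"
  let ?D = "\<lambda>y g. dir_deriv y g" and ?E = "\<lambda>y g. (\<lambda>x. \<Lambda> y * g x) :: 'a \<Rightarrow> complex"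
  have coD: "foldr (\<lambda>y g. T g - ?D y g) us f = (\<Sum>j\<le>length us. (T ^^ j) (operator_coeff ?D us f j))"
    if "endo_on ?S T" "\<And>g y. g \<in> ?S \<Longrightarrow> T (?D y g) = ?D y (T g)" for T us
    using that by (intro smooth_operator_coeff[where F = "\<lambda>y g. dir_deriv y g"] f endo_on_smooth_deriv) blast+
  have coE: "foldr (\<lambda>y g. T g - ?E y g) us f = (\<Sum>j\<le>length us. (T ^^ j) (operator_coeff ?E us f j))"
    if "endo_on ?S T" "\<And>g y. g \<in> ?S \<Longrightarrow> T (?E y g) = ?E y (T g)" for T us
    using that by (intro smooth_operator_coeff[where F = "\<lambda>y g x. \<Lambda> y * g x"] f endo_on_smooth_cmult) blast+
  have z_sum: "(\<Sum>j\<le>n. ((\<lambda>g x. z * g x) ^^ j) (c j)) x = (\<Sum>j\<le>n. c j x * z ^ j)" for c :: "nat \<Rightarrow> 'a \<Rightarrow> complex" and z x n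
    by (induction n) (simp_all add: power_cmult mult.commute)
  have "operator_coeff ?D ys f j x = operator_coeff ?E ys f j x" if "j \<le> length ys" for j x
  proof -
    have "(\<Sum>j\<le>length ys. operator_coeff ?D ys f j x * z ^ j) = (\<Sum>j\<le>length ys. operator_coeff ?E ys f j x * z ^ j)" for z
    proof -
      have "(\<Sum>j\<le>length ys. operator_coeff ?D ys f j x * z ^ j) =
          (\<Sum>j\<le>length ys. ((\<lambda>g x. z * g x) ^^ j) (operator_coeff ?D ys f j)) x"
        by (rule z_sum[symmetric])
      also have "(\<Sum>j\<le>length ys. ((\<lambda>g x. z * g x) ^^ j) (operator_coeff ?D ys f j)) =
          foldr (\<lambda>y g. (\<lambda>x. z * g x) - ?D y g) ys f"
        by (rule coD[OF endo_on_smooth_cmult, symmetric]) (simp add: dir_deriv_cmult)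
      also have "\<dots> = (\<lambda>x. prod_list (map (\<lambda>y. z - \<Lambda> y) ys) * f x)"
        using eig[of z] unfolding sym_diff_linear_factors[OF f] sym_eval_linear_factors by (rule ext)
      also have "\<dots> = foldr (\<lambda>y g. (\<lambda>x. z * g x) - ?E y g) ys f"
        by (induction ys) (simp_all add: fun_eq_iff algebra_simps)
      also have "\<dots> = (\<Sum>j\<le>length ys. ((\<lambda>g x. z * g x) ^^ j) (operator_coeff ?E ys f j))"
        by (rule coE[OF endo_on_smooth_cmult]) (simp add: mult.left_commute)
      also have "\<dots> x = (\<Sum>j\<le>length ys. operator_coeff ?E ys f j x * z ^ j)"
        by (rule z_sum)
      finally show ?thesis .
    qed
    then have "\<forall>z. (\<Sum>j\<le>length ys. operator_coeff ?D ys f j x * z ^ j) = (\<Sum>j\<le>length ys. operator_coeff ?E ys f j x * z ^ j)"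
      by (rule allI)
    from iffD1[OF polyfun_eq_coeffs this] show ?thesis using that by (elim allE) (erule (1) mp)
  qed
  then have coeffs: "operator_coeff ?D ys f j = operator_coeff ?E ys f j" if "j \<le> length ys" for j
    using that by (intro ext)
  \<comment> \<open>From here on the equality of coefficients is used with \<partial>_v in place of
    z.\<close>
  have "iterated_shifted_deriv v (map \<Lambda> ys) f = foldr (\<lambda>y g. dir_deriv v g - ?E y g) ys f"
    by (induction ys) (simp_all add: shifted_deriv_def fun_diff_def)
  also have "\<dots> = (\<Sum>j\<le>length ys. (dir_deriv v ^^ j) (operator_coeff ?E ys f j))"
    by (rule coE[OF endo_on_smooth_deriv]) (simp add: dir_deriv_cmult)
  also have "\<dots> = (\<Sum>j\<le>length ys. (dir_deriv v ^^ j) (operator_coeff ?D ys f j))"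
    by (rule sum.cong) (simp_all add: coeffs)
  also have "\<dots> = foldr (\<lambda>y g. dir_deriv v g - ?D y g) ys f"
    by (rule coD[OF endo_on_smooth_deriv, symmetric]) (simp add: smooth_commute)
  also have "\<dots> = 0"
    by (rule foldr_factor_zero[OF v]) (simp_all add: zero_fun_def dir_deriv_zero)
  finally show ?thesis by (simp add: zero_fun_def)
qed

section \<open>Integral-reflection operators on lines across a wall\<close>

lemma antiderivative_exists:
  fixes h :: "real \<Rightarrow> complex"
  assumes "continuous_on UNIV h"
  shows "\<exists>H. \<forall>t. (H has_vector_derivative h t) (at t)"
proof (intro exI allI)
  fix t :: real
  let ?b = "\<bar>t\<bar> + 1"
  have "((\<lambda>u. LBINT y=ereal 0..ereal u. h y) has_vector_derivative h t) (at t within {- ?b..?b})"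
    by (rule interval_integral_FTC2) (use continuous_on_subset[OF assms] in auto)
  then show "((\<lambda>u. LBINT y=ereal 0..ereal u. h y) has_vector_derivative h t) (at t)"
    by (subst (asm) at_within_Icc_at) auto
qed

lemma aff_reflection_on_line:
  assumes a: "fst a \<noteq> 0" and x0: "aff_eval a x0 = 0"
  shows "aff_reflection a (x0 + s *\<^sub>R coroot (fst a)) = x0 - s *\<^sub>R coroot (fst a)"
proof -
  have ev: "aff_eval a (x0 + s *\<^sub>R coroot (fst a)) = s + s"
    using x0 by (simp add: aff_eval_def blinfun.add_right blinfun.scaleR_right apply_coroot_self[OF a])
  show ?thesis unfolding aff_reflection_def ev scaleR_add_left by simp
qed

text \<open>On the line through a wall point x0 along the coroot, with coordinate s, the functional
  a takes the value 2 s and the integral covers the segment between - s and s.\<close>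

lemma integral_reflection_on_line:
  fixes f :: "'a::euclidean_space \<Rightarrow> complex"
  assumes f: "continuous_on UNIV f" and a: "fst a \<noteq> 0" and x0: "aff_eval a x0 = 0"
    and H: "\<And>t. (H has_vector_derivative f (x0 + t *\<^sub>R coroot (fst a))) (at t)"
  shows "integral_reflection k a f (x0 + s *\<^sub>R coroot (fst a)) = f (x0 - s *\<^sub>R coroot (fst a)) + k a * (H s - H (- s))"
proof -
  let ?y = "coroot (fst a)"
  have ev: "aff_eval a (x0 + s *\<^sub>R ?y) = 2 * s"
    using x0 by (simp add: aff_eval_def blinfun.add_right blinfun.scaleR_right apply_coroot_self[OF a])
  note refl = aff_reflection_on_line[OF a x0, of s]
  have "(LBINT t=ereal 0..ereal (2 * s). f (x0 + s *\<^sub>R ?y - t *\<^sub>R ?y)) = - H (s - 2 * s) - - H (s - 0)"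
  proof (rule interval_integral_FTC_finite)
    show "continuous_on {min 0 (2 * s)..max 0 (2 * s)} (\<lambda>t. f (x0 + s *\<^sub>R ?y - t *\<^sub>R ?y))"
      by (rule continuous_on_compose2[OF f]) (auto intro!: continuous_intros)
    fix t
    have "((\<lambda>t. s - t) has_vector_derivative -1) (at t)" by (auto intro!: derivative_eq_intros)
    from vector_diff_chain_at[OF this H[of "s - t"]]
    have "((\<lambda>t. - H (s - t)) has_vector_derivative f (x0 + (s - t) *\<^sub>R ?y)) (at t)"
      by (auto simp: o_def intro!: derivative_eq_intros)
    then show "((\<lambda>t. - H (s - t)) has_vector_derivative f (x0 + s *\<^sub>R ?y - t *\<^sub>R ?y)) (at t within {min 0 (2 * s)..max 0 (2 * s)})"
      by (simp add: scaleR_diff_left add_diff_eq has_vector_derivative_at_within)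
  qed
  then show ?thesis
    unfolding integral_reflection_def ev refl by simp
qed

lemma smooth_continuous: "smooth f \<Longrightarrow> continuous_on UNIV f"
  unfolding continuous_on_eq_continuous_within
  by (intro ballI differentiable_imp_continuous_within smooth_differentiable)

lemma aff_reflection_affine: "aff_reflection a x = reflection (fst a) x + - snd a *\<^sub>R coroot (fst a)"
  by (simp add: aff_reflection_def reflection_def aff_eval_def algebra_simps)

text \<open>On each such line the defect E(s) = h(s) - h(- s) - k (H(s) - H(- s)) vanishes at 0, so
  it vanishes identically exactly when its derivative does. The derivative is the differential
  equation, and these lines cover V.\<close>

lemma integral_reflection_fixed_iff:
  fixes f :: "'a::euclidean_space \<Rightarrow> complex"
  assumes f: "smooth f" and a: "fst a \<noteq> 0"
  defines "y \<equiv> coroot (fst a)"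
  shows "integral_reflection k a f = f \<longleftrightarrow>
    (\<forall>x. shifted_deriv y (- k a) f x = shifted_deriv y (k a) (\<lambda>x. f (aff_reflection a x)) x)"
proof -
  define \<Delta> where "\<Delta> x = dir_deriv y f x" for x
  have d_refl: "dir_deriv y (\<lambda>x. f (aff_reflection a x)) x = - \<Delta> (aff_reflection a x)" for x
  proof -
    have "dir_deriv y (\<lambda>x. f (aff_reflection a x)) x = dir_deriv (reflection (fst a) y) f (aff_reflection a x)"
      unfolding aff_reflection_affine dir_deriv_compose_affine[OF linear_reflection] ..
    also have "reflection (fst a) y = - y"
      by (simp add: y_def reflection_def apply_coroot_self[OF a] scaleR_2)
    also have "dir_deriv (- y) f (aff_reflection a x) = - \<Delta> (aff_reflection a x)"
      unfolding \<Delta>_def by (rule linear_neg[OF dir_deriv_direction_linear[OF f]])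
    finally show ?thesis .
  qed
  have local_iff: "(\<forall>s. integral_reflection k a f (x0 + s *\<^sub>R y) = f (x0 + s *\<^sub>R y)) \<longleftrightarrow>
      (\<forall>s. \<Delta> (x0 + s *\<^sub>R y) + \<Delta> (x0 - s *\<^sub>R y) = k a * (f (x0 + s *\<^sub>R y) + f (x0 - s *\<^sub>R y)))"
    if x0: "aff_eval a x0 = 0" for x0
  proof -
    define h where "h t = f (x0 + t *\<^sub>R y)" for t
    have h': "(h has_vector_derivative \<Delta> (x0 + t *\<^sub>R y)) (at t)" for t
    proof -
      have "((\<lambda>t. x0 + t *\<^sub>R y) has_derivative (\<lambda>t. t *\<^sub>R y)) (at t)" by (auto intro!: derivative_eq_intros)
      from has_derivative_compose[OF this smooth_has_derivative[OF f]]
      show ?thesis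
        by (simp add: h_def[abs_def] has_vector_derivative_def \<Delta>_def linear_scale[OF dir_deriv_direction_linear[OF f]])
    qed
    have "continuous_on UNIV h"
      unfolding h_def[abs_def] by (rule continuous_on_compose2[OF smooth_continuous[OF f]]) (auto intro!: continuous_intros)
    then obtain H where H: "\<And>t. (H has_vector_derivative h t) (at t)" using antiderivative_exists by blast
    define E where "E s = h s - h (- s) - k a * (H s - H (- s))" for s
    have neg: "((\<lambda>s. g (- s)) has_vector_derivative - g') (at s)" if "(g has_vector_derivative g') (at (- s))"
      for g :: "real \<Rightarrow> complex" and g' s
    proof -
      have "((\<lambda>t. - t) has_vector_derivative -1) (at s)" by (auto intro!: derivative_eq_intros)
      from vector_diff_chain_at[OF this that] show ?thesis by (simp add: o_def)
    qed
    have E': "(E has_vector_derivative (\<Delta> (x0 + s *\<^sub>R y) + \<Delta> (x0 - s *\<^sub>R y) - k a * (h s + h (- s)))) (at s)" for s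
    proof -
      have "(E has_vector_derivative ((\<Delta> (x0 + s *\<^sub>R y) - - \<Delta> (x0 + (- s) *\<^sub>R y)) - k a * (h s - - h (- s)))) (at s)"
        unfolding E_def[abs_def]
        by (intro has_vector_derivative_diff has_vector_derivative_mult_right h' H neg)
      then show ?thesis by simp
    qed
    have "integral_reflection k a f (x0 + s *\<^sub>R y) = h (- s) + k a * (H s - H (- s))" for s
      using integral_reflection_on_line[OF smooth_continuous[OF f] a x0, of H k s] H by (simp add: h_def y_def)
    moreover have "h (- s) + k a * (H s - H (- s)) = h s \<longleftrightarrow> E s = 0" for s
      unfolding E_def by (auto simp: algebra_simps)
    ultimately have "(\<forall>s. integral_reflection k a f (x0 + s *\<^sub>R y) = f (x0 + s *\<^sub>R y)) \<longleftrightarrow> (\<forall>s. E s = 0)"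
      unfolding h_def by simp
    also have "\<dots> \<longleftrightarrow> (\<forall>s. \<Delta> (x0 + s *\<^sub>R y) + \<Delta> (x0 - s *\<^sub>R y) - k a * (h s + h (- s)) = 0)"
    proof
      assume "\<forall>s. E s = 0"
      then have "E = (\<lambda>s. 0)" by auto
      then have "(E has_vector_derivative 0) (at s)" for s by simp
      then show "\<forall>s. \<Delta> (x0 + s *\<^sub>R y) + \<Delta> (x0 - s *\<^sub>R y) - k a * (h s + h (- s)) = 0"
        using E' vector_derivative_unique_at by blast
    next
      assume z: "\<forall>s. \<Delta> (x0 + s *\<^sub>R y) + \<Delta> (x0 - s *\<^sub>R y) - k a * (h s + h (- s)) = 0"
      then have "(E has_vector_derivative 0) (at s within UNIV)" for s using E'[of s] by simp
      then obtain c where c: "\<And>s. E s = c"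
        using has_vector_derivative_zero_constant[of UNIV E] by auto
      moreover have "E 0 = 0" by (simp add: E_def)
      ultimately show "\<forall>s. E s = 0" by simp
    qed
    finally show ?thesis by (simp add: h_def)
  qed
  have line: "\<exists>x0 s. aff_eval a x0 = 0 \<and> v = x0 + s *\<^sub>R y" for v
  proof (intro exI conjI)
    show "aff_eval a (v - (aff_eval a v / 2) *\<^sub>R y) = 0"
      by (simp add: aff_eval_def y_def blinfun.diff_right blinfun.scaleR_right apply_coroot_self[OF a] field_simps)
    show "v = v - (aff_eval a v / 2) *\<^sub>R y + (aff_eval a v / 2) *\<^sub>R y" by simp
  qed
  have refl: "aff_reflection a (x0 + s *\<^sub>R y) = x0 - s *\<^sub>R y" if "aff_eval a x0 = 0" for x0 s
    unfolding y_def by (rule aff_reflection_on_line[OF a that])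
  have "integral_reflection k a f = f \<longleftrightarrow>
      (\<forall>x0. aff_eval a x0 = 0 \<longrightarrow> (\<forall>s. integral_reflection k a f (x0 + s *\<^sub>R y) = f (x0 + s *\<^sub>R y)))"
    unfolding fun_eq_iff using line by metis
  also have "\<dots> \<longleftrightarrow> (\<forall>x0. aff_eval a x0 = 0 \<longrightarrow> (\<forall>s. \<Delta> (x0 + s *\<^sub>R y) + \<Delta> (x0 - s *\<^sub>R y) = k a * (f (x0 + s *\<^sub>R y) + f (x0 - s *\<^sub>R y))))"
    using local_iff by blast
  also have "\<dots> \<longleftrightarrow> (\<forall>x0. aff_eval a x0 = 0 \<longrightarrow> (\<forall>s. \<Delta> (x0 + s *\<^sub>R y) + \<Delta> (aff_reflection a (x0 + s *\<^sub>R y)) =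
      k a * (f (x0 + s *\<^sub>R y) + f (aff_reflection a (x0 + s *\<^sub>R y)))))"
    using refl by simp
  also have "\<dots> \<longleftrightarrow> (\<forall>x. \<Delta> x + \<Delta> (aff_reflection a x) = k a * (f x + f (aff_reflection a x)))"
    using line by metis
  also have "\<dots> \<longleftrightarrow> (\<forall>x. shifted_deriv y (- k a) f x = shifted_deriv y (k a) (\<lambda>x. f (aff_reflection a x)) x)"
    unfolding shifted_deriv_def d_refl \<Delta>_def[symmetric] by (simp add: algebra_simps)
  finally show ?thesis .
qed

section \<open>The sum of the c-function over the Weyl group\<close>

lemma prod_linear_poly:
  fixes a b :: "'i \<Rightarrow> complex"
  assumes "finite A"
  shows "degree (\<Prod>i\<in>A. [:a i, b i:]) \<le> card A \<and> coeff (\<Prod>i\<in>A. [:a i, b i:]) (card A) = (\<Prod>i\<in>A. b i)"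
  using assms
proof (induction A rule: finite_induct)
  case (insert i A)
  let ?p = "\<Prod>i\<in>A. [:a i, b i:]"
  have d: "degree [:a i, b i:] \<le> 1" by (simp add: degree_pCons_le)
  have "degree ([:a i, b i:] * ?p) \<le> 1 + card A"
    by (rule order_trans[OF degree_mult_le add_mono[OF d]]) (use insert.IH in simp)
  moreover have "coeff ([:a i, b i:] * ?p) (Suc (card A)) = b i * coeff ?p (card A) + a i * coeff ?p (Suc (card A))"
    by (simp add: mult_pCons_left)
  moreover have "coeff ?p (Suc (card A)) = 0" by (rule coeff_eq_0) (use insert.IH in simp)
  ultimately show ?case using insert by simp
qed simp

context bethe_data
begin

text \<open>\<open>c_function\<close> is the quotient of \<open>shifted_discriminant\<close> by
  \<open>discriminant\<close>; separating the two gives polynomials along a line.\<close>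

definition discriminant :: "('a \<Rightarrow> complex) \<Rightarrow> complex" where
  "discriminant \<mu> = (\<Prod>\<gamma>\<in>positive_roots R B. \<mu> (coroot \<gamma>))"

definition shifted_discriminant :: "('a \<Rightarrow> complex) \<Rightarrow> complex" where
  "shifted_discriminant \<mu> = (\<Prod>\<gamma>\<in>positive_roots R B. \<mu> (coroot \<gamma>) + k (\<gamma>, 0))"

lemma weyl_act_reflection_coroot:
  assumes "\<alpha> \<in> R" "linear \<mu>" shows "weyl_act (reflection \<alpha>) \<mu> (coroot \<alpha>) = - \<mu> (coroot \<alpha>)"
proof -
  have "reflection \<alpha> (coroot \<alpha>) = - coroot \<alpha>"
    using coroot_pairing[OF assms(1)] by (simp add: reflection_def scaleR_2)
  then show ?thesis by (simp add: weyl_act_def inv_reflection linear_neg[OF assms(2)])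
qed

lemma discriminant_simple_reflection:
  assumes \<alpha>: "\<alpha> \<in> B" and \<mu>: "linear \<mu>"
  shows "discriminant (weyl_act (reflection \<alpha>) \<mu>) = - discriminant \<mu>"
proof -
  let ?P = "positive_roots R B"
  have \<alpha>P: "\<alpha> \<in> ?P" using nonneg_comb_base[OF finite_B \<alpha>] B_sub[OF \<alpha>] by (simp add: positive_roots_def)
  have split: "discriminant \<nu> = \<nu> (coroot \<alpha>) * (\<Prod>\<gamma>\<in>?P - {\<alpha>}. \<nu> (coroot \<gamma>))" for \<nu>
    unfolding discriminant_def by (rule prod.remove[OF finite_positive_roots \<alpha>P])
  have "(\<Prod>\<gamma>\<in>?P - {\<alpha>}. weyl_act (reflection \<alpha>) \<mu> (coroot \<gamma>)) = (\<Prod>\<gamma>\<in>?P - {\<alpha>}. \<mu> (coroot \<gamma>))"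
  proof (rule prod.reindex_bij_witness[where i = "dual_reflection \<alpha>" and j = "dual_reflection \<alpha>"])
    fix \<gamma> assume \<gamma>: "\<gamma> \<in> ?P - {\<alpha>}"
    show "dual_reflection \<alpha> \<gamma> \<in> ?P - {\<alpha>}" using \<gamma> by (intro dual_reflection_simple_positive[OF \<alpha>]) auto
    then show "dual_reflection \<alpha> \<gamma> \<in> ?P - {\<alpha>}" .
    show "\<mu> (coroot (dual_reflection \<alpha> \<gamma>)) = weyl_act (reflection \<alpha>) \<mu> (coroot \<gamma>)"
      by (simp add: weyl_act_def inv_reflection coroot_dual_reflection)
  qed (simp_all only: dual_reflection_dual_reflection)
  then show ?thesis
    unfolding split[of "weyl_act (reflection \<alpha>) \<mu>"] split[of \<mu>] weyl_act_reflection_coroot[OF B_sub[OF \<alpha>] \<mu>] by simp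
qed

text \<open>Provides the sign character of W, read off from the antisymmetry of the
  discriminant.\<close>

lemma sign_exists:
  assumes "w \<in> W"
  shows "\<exists>s. s * s = 1 \<and> (\<forall>\<mu>. linear \<mu> \<longrightarrow> discriminant (weyl_act w \<mu>) = s * discriminant \<mu>)"
  using assms
proof (induction rule: W_induct)
  case id then show ?case by (intro exI[of _ 1]) (simp only: weyl_act_id mult_1_left simp_thms)
next
  case (step \<beta> w)
  then obtain s where s: "s * s = 1" "\<And>\<mu>. linear \<mu> \<Longrightarrow> discriminant (weyl_act w \<mu>) = s * discriminant \<mu>" by blast
  show ?case
  proof (intro exI[of _ "- s"] conjI allI impI)
    fix \<mu> :: "'a \<Rightarrow> complex" assume \<mu>: "linear \<mu>"
    show "discriminant (weyl_act (reflection \<beta> \<circ> w) \<mu>) = - s * discriminant \<mu>"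
      unfolding weyl_act_comp[OF W_reflection[OF B_sub[OF step(1)]] step(2)]
        discriminant_simple_reflection[OF step(1) linear_weyl_act[OF step(2) \<mu>]] s(2)[OF \<mu>] by simp
  qed (simp add: s)
qed

text \<open>Distinct positive roots of a reduced system are not proportional. This supplies
  directions that separate two walls.\<close>

lemma coroot_not_parallel:
  assumes "\<gamma> \<in> positive_roots R B" "\<delta> \<in> positive_roots R B" "\<gamma> \<noteq> \<delta>"
  shows "\<exists>e. e \<bullet> coroot \<gamma> = 0 \<and> e \<bullet> coroot \<delta> \<noteq> 0"
proof (rule ccontr)
  assume con: "\<not> ?thesis"
  have R: "\<gamma> \<in> R" "\<delta> \<in> R" using assms positive_roots_subset by blast+
  let ?g = "coroot \<gamma>" and ?d = "coroot \<delta>"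
  have g0: "?g \<noteq> 0" using coroot_pairing[OF R(1)] by auto
  define c where "c = (?d \<bullet> ?g) / (?g \<bullet> ?g)"
  have "(?d - c *\<^sub>R ?g) \<bullet> ?g = 0" using g0 by (simp add: c_def inner_diff_left)
  then have "(?d - c *\<^sub>R ?g) \<bullet> ?d = 0" using con by blast
  then have "(?d - c *\<^sub>R ?g) \<bullet> (?d - c *\<^sub>R ?g) = 0"
    using \<open>(?d - c *\<^sub>R ?g) \<bullet> ?g = 0\<close> by (simp only: inner_diff_right inner_scaleR_right)
  then have "?d = c *\<^sub>R ?g" by simp
  then have "(2 / (norm \<delta>)\<^sup>2) *\<^sub>R riesz \<delta> = (c * (2 / (norm \<gamma>)\<^sup>2)) *\<^sub>R riesz \<gamma>"
    by (simp add: coroot_eq_riesz)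
  then have "((norm \<delta>)\<^sup>2 / 2) *\<^sub>R ((2 / (norm \<delta>)\<^sup>2) *\<^sub>R riesz \<delta>) = ((norm \<delta>)\<^sup>2 / 2) *\<^sub>R ((c * (2 / (norm \<gamma>)\<^sup>2)) *\<^sub>R riesz \<gamma>)"
    by simp
  then obtain t where "riesz \<delta> = t *\<^sub>R riesz \<gamma>" using R_nonzero[OF R(2)] by (auto simp: mult.assoc)
  then have t: "\<delta> = t *\<^sub>R \<gamma>" by (simp add: linear_scale[OF linear_riesz, symmetric] riesz_eq_iff)
  then have "t *\<^sub>R \<gamma> \<in> R" using R(2) by simp
  then have "\<delta> = - \<gamma>" using R_scaleR[OF R(1)] t assms(3) by fastforce
  then have "\<gamma> = 0" using assms(1,2) nonneg_comb_antisym[of \<gamma>] by (simp add: positive_roots_def)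
  then show False using R_nonzero[OF R(1)] by simp
qed

text \<open>The sum is N / \<open>discriminant\<close>, with N the antisymmetrized shifted
  discriminant. N vanishes on every wall, so along a generic line \<lambda> + z \<eta> it vanishes
  at all zeros of the discriminant; comparing top coefficients shows that it is #W times the
  discriminant.\<close>

lemma sum_c_function:
  assumes reg: "regular_value R \<Lambda>"
  shows "(\<Sum>w\<in>W. c_function R B k (weyl_act w \<Lambda>)) = of_nat (card W)"
proof -
  let ?P = "positive_roots R B"
  have regP: "\<Lambda> (coroot \<gamma>) \<noteq> 0" if "\<gamma> \<in> ?P" for \<gamma>
    using reg positive_roots_subset[OF that] by (simp add: regular_value_def)
  have D0: "discriminant \<Lambda> \<noteq> 0"
    unfolding discriminant_def using regP finite_positive_roots by simp
  have "\<forall>w. \<exists>s. w \<in> W \<longrightarrow> s * s = 1 \<and> (\<forall>\<mu>. linear \<mu> \<longrightarrow> discriminant (weyl_act w \<mu>) = s * discriminant \<mu>)"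
    using sign_exists by blast
  then obtain sg where sg: "\<And>w. w \<in> W \<Longrightarrow> sg w * sg w = 1"
    "\<And>w \<mu>. w \<in> W \<Longrightarrow> linear \<mu> \<Longrightarrow> discriminant (weyl_act w \<mu>) = sg w * discriminant \<mu>"
    by metis
  have sg_mult: "sg (u \<circ> w) = sg u * sg w" if "u \<in> W" "w \<in> W" for u w
  proof -
    have "sg (u \<circ> w) * discriminant \<Lambda> = sg u * sg w * discriminant \<Lambda>"
      using that by (simp only: sg(2)[symmetric] W_comp linear_Lambda linear_weyl_act weyl_act_comp mult.assoc)
    then show ?thesis using D0 by simp
  qed
  have sg_simple: "sg (reflection \<alpha>) = -1" if "\<alpha> \<in> B" for \<alpha>
  proof -
    have "sg (reflection \<alpha>) * discriminant \<Lambda> = (-1) * discriminant \<Lambda>"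
      using sg(2)[OF W_reflection[OF B_sub[OF that]] linear_Lambda] discriminant_simple_reflection[OF that linear_Lambda] by simp
    then show ?thesis using D0 mult_right_cancel by blast
  qed
  define N where "N \<mu> = (\<Sum>w\<in>W. sg w * shifted_discriminant (weyl_act w \<mu>))" for \<mu> :: "'a \<Rightarrow> complex"
  have N_act: "N (weyl_act u \<mu>) = sg (inv u) * N \<mu>" if u: "u \<in> W" for u \<mu>
  proof -
    have "N \<mu> = (\<Sum>w\<in>W. sg (w \<circ> u) * shifted_discriminant (weyl_act (w \<circ> u) \<mu>))"
      unfolding N_def by (rule sum.reindex_bij_betw[OF bij_betw_comp_W[OF u], symmetric])
    also have "\<dots> = (\<Sum>w\<in>W. sg u * (sg w * shifted_discriminant (weyl_act w (weyl_act u \<mu>))))"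
      by (rule sum.cong) (simp_all only: sg_mult[OF _ u] weyl_act_comp[OF _ u] mult_ac)
    also have "\<dots> = sg u * N (weyl_act u \<mu>)" by (simp only: N_def sum_distrib_left)
    finally have "sg (inv u) * N \<mu> = (sg (inv u) * sg u) * N (weyl_act u \<mu>)" by (simp only: mult.assoc)
    also have "sg (inv u) * sg u = sg id"
      using sg_mult[OF W_inv[OF u] u] W_bij[OF u] by (simp only: bij_is_inj inv_o_cancel)
    also have "sg id = 1"
      using sg_mult[OF W_id W_id] sg(1)[OF W_id] by (simp only: id_comp)
    finally show ?thesis by simp
  qed
  \<comment> \<open>\<mu> is moved to a simple wall, where the reflection fixes it while N changes
    sign.\<close>
  have N_wall: "N \<mu> = 0" if \<mu>: "linear \<mu>" and \<gamma>: "\<gamma> \<in> R" and z: "\<mu> (coroot \<gamma>) = 0" for \<mu> \<gamma>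
  proof -
    obtain w \<alpha> where w: "w \<in> W" "\<alpha> \<in> B" "coroot \<gamma> = w (coroot \<alpha>)" using root_conjugate_simple[OF \<gamma>] by blast
    let ?\<nu> = "weyl_act (inv w) \<mu>"
    have "?\<nu> (coroot \<alpha>) = 0" using z by (simp add: weyl_act_def W_inv_inv[OF w(1)] w(3))
    moreover have \<nu>: "linear ?\<nu>" by (intro linear_weyl_act W_inv w \<mu>)
    ultimately have "?\<nu> (reflection \<alpha> v) = ?\<nu> v" for v
      by (simp add: reflection_def linear_diff[OF \<nu>] linear_scale[OF \<nu>])
    then have "weyl_act (reflection \<alpha>) ?\<nu> = ?\<nu>"
      unfolding weyl_act_def[of "reflection \<alpha>"] inv_reflection by (rule ext)
    then have "N ?\<nu> = - N ?\<nu>"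
      using N_act[OF W_reflection[OF B_sub[OF w(2)]], of ?\<nu>] by (simp add: inv_reflection sg_simple[OF w(2)])
    then have "N ?\<nu> = 0" by simp
    then have "sg (inv (inv w)) * N \<mu> = 0" using N_act[OF W_inv[OF w(1)], of \<mu>] by simp
    moreover have "sg (inv (inv w)) \<noteq> 0" using sg(1)[OF w(1)] by (auto simp: W_inv_inv[OF w(1)])
    ultimately show ?thesis by simp
  qed
  define dir where "dir \<gamma> e = complex_of_real (e \<bullet> coroot \<gamma>)" for \<gamma> :: "'a dual" and e
  \<comment> \<open>When both \<open>dir\<close> values are nonzero, \<open>cross\<close> is nonzero
    exactly if the walls of \<gamma> and \<delta> meet the line at different parameters z.\<close>
  define cross where "cross \<gamma> \<delta> e = \<Lambda> (coroot \<gamma>) * dir \<delta> e - \<Lambda> (coroot \<delta>) * dir \<gamma> e" for \<gamma> \<delta> e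
  define F where "F = dir ` ?P \<union> (\<lambda>(\<gamma>, \<delta>). cross \<gamma> \<delta>) ` {(\<gamma>, \<delta>). \<gamma> \<in> ?P \<and> \<delta> \<in> ?P \<and> \<gamma> \<noteq> \<delta>}"
  have dir_lin: "linear (dir \<gamma>)" for \<gamma>
    unfolding dir_def by (rule linearI) (simp_all add: inner_add_left scaleR_conv_of_real)
  have "finite {(\<gamma>, \<delta>). \<gamma> \<in> ?P \<and> \<delta> \<in> ?P \<and> \<gamma> \<noteq> \<delta>}"
    by (rule finite_subset[of _ "?P \<times> ?P"]) (use finite_positive_roots in auto)
  then have "finite F" unfolding F_def using finite_positive_roots by blast
  moreover have "linear d" if "d \<in> F" for d
  proof -
    have "linear (cross \<gamma> \<delta>)" for \<gamma> \<delta>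
      unfolding cross_def by (rule linearI) (simp_all add: linear_add[OF dir_lin] linear_scale[OF dir_lin] algebra_simps scaleR_conv_of_real)
    then show ?thesis using that dir_lin by (auto simp: F_def)
  qed
  moreover have "\<exists>e. d e \<noteq> 0" if d: "d \<in> F" for d
  proof -
    consider \<gamma> where "\<gamma> \<in> ?P" "d = dir \<gamma>" | \<gamma> \<delta> where "\<gamma> \<in> ?P" "\<delta> \<in> ?P" "\<gamma> \<noteq> \<delta>" "d = cross \<gamma> \<delta>"
      using d by (auto simp: F_def)
    then show ?thesis
    proof cases
      case 1
      have "coroot \<gamma> \<noteq> 0" using coroot_pairing[OF positive_roots_subset[OF 1(1)]] by auto
      then show ?thesis by (intro exI[of _ "coroot \<gamma>"]) (simp add: 1 dir_def)
    next
      case 2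
      obtain e where "e \<bullet> coroot \<gamma> = 0" "e \<bullet> coroot \<delta> \<noteq> 0" using coroot_not_parallel[OF 2(1,2,3)] by blast
      then show ?thesis by (intro exI[of _ e]) (simp add: 2 cross_def dir_def regP)
    qed
  qed
  ultimately obtain e where e: "\<And>d. d \<in> F \<Longrightarrow> d e \<noteq> 0" using generic_vector[of F] by blast
  define \<eta> where "\<eta> v = complex_of_real (e \<bullet> v)" for v
  have \<eta>: "linear \<eta>" unfolding \<eta>_def by (rule linearI) (simp_all add: inner_add_right scaleR_conv_of_real)
  have \<eta>0: "\<eta> (coroot \<gamma>) \<noteq> 0" if "\<gamma> \<in> ?P" for \<gamma>
  proof -
    have "dir \<gamma> \<in> F" using that by (simp add: F_def)
    from e[OF this] show ?thesis by (simp add: \<eta>_def dir_def)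
  qed
  have \<eta>cross: "\<Lambda> (coroot \<gamma>) * \<eta> (coroot \<delta>) \<noteq> \<Lambda> (coroot \<delta>) * \<eta> (coroot \<gamma>)"
    if "\<gamma> \<in> ?P" "\<delta> \<in> ?P" "\<gamma> \<noteq> \<delta>" for \<gamma> \<delta>
  proof -
    have "cross \<gamma> \<delta> \<in> F" unfolding F_def using that by (intro UnI2 image_eqI[of _ _ "(\<gamma>, \<delta>)"]) auto
    from e[OF this] show ?thesis by (simp add: \<eta>_def dir_def cross_def)
  qed
  define q where "q = (\<Prod>\<gamma>\<in>?P. [:\<Lambda> (coroot \<gamma>), \<eta> (coroot \<gamma>):])"
  define p where "p w = (\<Prod>\<gamma>\<in>?P. [:weyl_act w \<Lambda> (coroot \<gamma>) + k (\<gamma>, 0), weyl_act w \<eta> (coroot \<gamma>):])" for w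
  define n where "n = (\<Sum>w\<in>W. smult (sg w) (p w))"
  define g where "g = n - smult (of_nat (card W)) q"
  let ?r = "card ?P"
  note lin_poly = prod_linear_poly[OF finite_positive_roots]
  have poly_n: "poly n z = N (\<lambda>v. \<Lambda> v + z * \<eta> v)" for z
    unfolding n_def N_def p_def poly_sum poly_smult poly_prod shifted_discriminant_def
    by (intro sum.cong arg_cong2[where f = "(*)"] prod.cong refl) (simp add: weyl_act_def)
  have poly_q: "poly q z = discriminant (\<lambda>v. \<Lambda> v + z * \<eta> v)" for z
    unfolding q_def poly_prod discriminant_def by (intro prod.cong refl) simp
  have p_deg: "degree (p w) \<le> ?r" and p_coeff: "coeff (p w) ?r = discriminant (weyl_act w \<eta>)" for w
    unfolding p_def discriminant_def by (rule conjunct1[OF lin_poly], rule conjunct2[OF lin_poly])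
  have q_deg: "degree q \<le> ?r" and q_coeff: "coeff q ?r = discriminant \<eta>"
    unfolding q_def discriminant_def by (rule conjunct1[OF lin_poly], rule conjunct2[OF lin_poly])
  have "degree n \<le> ?r"
    unfolding n_def by (intro degree_sum_le finite_W order_trans[OF degree_smult_le] p_deg)
  moreover note q_deg
  ultimately have deg_g: "degree g \<le> ?r"
    unfolding g_def by (intro degree_diff_le order_trans[OF degree_smult_le])
  \<comment> \<open>The signs cancel in the top coefficient, because the discriminant of w \<eta>
    carries the same sign as its summand.\<close>
  have "coeff n ?r = (\<Sum>w\<in>W. sg w * discriminant (weyl_act w \<eta>))"
    unfolding n_def coeff_sum coeff_smult p_coeff ..
  also have "\<dots> = (\<Sum>w\<in>W. discriminant \<eta>)"
    by (rule sum.cong) (simp_all only: sg(2)[OF _ \<eta>] mult.assoc[symmetric] sg(1) mult_1_left)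
  also have "\<dots> = of_nat (card W) * discriminant \<eta>" by simp
  finally have "coeff g ?r = 0"
    by (simp add: g_def q_coeff)
  define root where "root \<gamma> = - \<Lambda> (coroot \<gamma>) / \<eta> (coroot \<gamma>)" for \<gamma>
  have "inj_on root ?P"
  proof (rule inj_onI, rule ccontr)
    fix \<gamma> \<delta> assume h: "\<gamma> \<in> ?P" "\<delta> \<in> ?P" "root \<gamma> = root \<delta>" "\<gamma> \<noteq> \<delta>"
    then have "\<Lambda> (coroot \<gamma>) * \<eta> (coroot \<delta>) = \<Lambda> (coroot \<delta>) * \<eta> (coroot \<gamma>)"
      using \<eta>0[OF h(1)] \<eta>0[OF h(2)] by (simp add: root_def frac_eq_eq)
    then show False using \<eta>cross[OF h(1,2,4)] by simp
  qed
  have roots: "poly g (root \<gamma>) = 0" if "\<gamma> \<in> ?P" for \<gamma>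
  proof -
    let ?\<mu> = "\<lambda>v. \<Lambda> v + root \<gamma> * \<eta> v"
    have lin: "linear ?\<mu>"
      by (rule linearI) (simp_all add: linear_add[OF linear_Lambda] linear_add[OF \<eta>] linear_scale[OF linear_Lambda]
          linear_scale[OF \<eta>] algebra_simps scaleR_conv_of_real)
    have z: "?\<mu> (coroot \<gamma>) = 0" using \<eta>0[OF that] by (simp add: root_def)
    have "N ?\<mu> = 0" by (rule N_wall[OF lin positive_roots_subset[OF that] z])
    moreover have "discriminant ?\<mu> = 0"
      unfolding discriminant_def using finite_positive_roots that z by (intro prod_zero) auto
    ultimately show ?thesis unfolding g_def by (simp add: poly_n poly_q)
  qed
  \<comment> \<open>Otherwise its degree would be below the number of positive roots, while it has
    that many distinct zeros.\<close>
  have "g = 0"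
  proof (rule ccontr)
    assume g0: "g \<noteq> 0"
    then have "degree g \<noteq> ?r" using \<open>coeff g ?r = 0\<close> by (metis leading_coeff_0_iff)
    then have "degree g < ?r" using deg_g by simp
    also have "?r = card (root ` ?P)" using \<open>inj_on root ?P\<close> by (simp add: card_image)
    also have "\<dots> \<le> card {z. poly g z = 0}"
      by (rule card_mono[OF poly_roots_finite[OF g0]]) (use roots in auto)
    also have "\<dots> \<le> degree g" by (rule card_poly_roots_bound[OF g0])
    finally show False by simp
  qed
  then have "poly n 0 = of_nat (card W) * poly q 0" by (simp add: g_def)
  then have N\<Lambda>: "N \<Lambda> = of_nat (card W) * discriminant \<Lambda>" by (simp add: poly_n poly_q)
  have "(\<Sum>w\<in>W. c_function R B k (weyl_act w \<Lambda>)) = (\<Sum>w\<in>W. sg w * shifted_discriminant (weyl_act w \<Lambda>) / discriminant \<Lambda>)"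
  proof (rule sum.cong)
    fix w assume w: "w \<in> W"
    have c: "c_function R B k \<mu> = shifted_discriminant \<mu> / discriminant \<mu>" for \<mu>
      by (simp add: c_function_def shifted_discriminant_def discriminant_def prod_dividef)
    have "sg w \<noteq> 0" using sg(1)[OF w] by auto
    then have "1 / sg w = sg w" using sg(1)[OF w] by (simp add: field_simps)
    have "c_function R B k (weyl_act w \<Lambda>) = (1 / sg w) * shifted_discriminant (weyl_act w \<Lambda>) / discriminant \<Lambda>"
      unfolding c sg(2)[OF w linear_Lambda] by simp
    then show "c_function R B k (weyl_act w \<Lambda>) = sg w * shifted_discriminant (weyl_act w \<Lambda>) / discriminant \<Lambda>"
      by (simp only: \<open>1 / sg w = sg w\<close>)
  qed simp
  also have "\<dots> = N \<Lambda> / discriminant \<Lambda>" by (simp only: N_def sum_divide_distrib)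
  also have "\<dots> = of_nat (card W)" using D0 by (simp add: N\<Lambda>)
  finally show ?thesis .
qed

end

section \<open>The Bethe ansatz\<close>

lemma purely_imaginary_iff:
  fixes \<Lambda> :: "'a::euclidean_space \<Rightarrow> complex"
  assumes "linear \<Lambda>"
  shows "purely_imaginary \<Lambda> \<longleftrightarrow> (\<forall>v. Re (\<Lambda> v) = 0)"
proof
  assume "purely_imaginary \<Lambda>"
  then show "\<forall>v. Re (\<Lambda> v) = 0" by (auto simp: purely_imaginary_def complexify_def)
next
  assume re: "\<forall>v. Re (\<Lambda> v) = 0"
  have "bounded_linear (\<lambda>v. Im (\<Lambda> v))"
    by (rule linear_conv_bounded_linear[THEN iffD1], rule linearI)
      (simp_all add: linear_add[OF assms] linear_scale[OF assms])
  then have "\<Lambda> = (\<lambda>v. \<i> * complexify (Blinfun (\<lambda>v. Im (\<Lambda> v))) v)"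
    using re by (simp add: fun_eq_iff complexify_def bounded_linear_Blinfun_apply complex_eq_iff)
  then show "purely_imaginary \<Lambda>" unfolding purely_imaginary_def by (rule exI)
qed

lemma iterated_shifted_deriv_compose:
  assumes "linear L"
  shows "iterated_shifted_deriv v cs (\<lambda>x. f (L x)) = (\<lambda>x. iterated_shifted_deriv (L v) cs f (L x))"
proof (induction cs)
  case (Cons c cs)
  then show ?case
    using dir_deriv_compose_affine[OF assms, of v "iterated_shifted_deriv (L v) cs f" 0] by (simp add: shifted_deriv_def)
qed simp

text \<open>The polynomial z \<mapsto> p(z M); a term with r vectors contributes in degree
  r.\<close>

definition scaled_sym_poly :: "'a sym \<Rightarrow> ('a \<Rightarrow> complex) \<Rightarrow> complex poly" where
  "scaled_sym_poly p M = sum_list (map (\<lambda>(c, vs). monom (c * prod_list (map M vs)) (length vs)) p)"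

lemma poly_scaled_sym_poly: "poly (scaled_sym_poly p M) z = sym_eval p (\<lambda>v. z * M v)"
proof -
  have "prod_list (map (\<lambda>v. z * M v) vs) = prod_list (map M vs) * z ^ length vs" for vs
    by (induction vs) (simp_all add: mult_ac)
  then show ?thesis
    unfolding scaled_sym_poly_def sym_eval_def by (induction p) (auto simp: poly_monom)
qed

text \<open>Invariance is only demanded at real points; it extends to imaginary ones because both sides
  are polynomial in a scalar factor.\<close>

lemma sym_invariant_imaginary:
  assumes inv: "sym_invariant R p" and w: "w \<in> weyl_group R" and \<Lambda>: "\<Lambda> = (\<lambda>v. \<i> * complexify \<xi> v)"
  shows "sym_eval p (weyl_act w \<Lambda>) = sym_eval p \<Lambda>"
proof -
  let ?d = "scaled_sym_poly p (weyl_act w (complexify \<xi>)) - scaled_sym_poly p (complexify \<xi>)"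
  have "poly ?d (complex_of_real t) = 0" for t
  proof -
    have "sym_eval p (weyl_act w (complexify (t *\<^sub>R \<xi>))) = sym_eval p (complexify (t *\<^sub>R \<xi>))"
      using inv w by (simp add: sym_invariant_def)
    then show ?thesis by (simp add: poly_scaled_sym_poly weyl_act_def complexify_def blinfun.scaleR_left)
  qed
  then have "range complex_of_real \<subseteq> {z. poly ?d z = 0}" by auto
  moreover have "infinite (range complex_of_real)"
    using finite_imageD[of complex_of_real UNIV] infinite_UNIV_char_0 by (auto simp: inj_on_def)
  ultimately have "?d = 0" using poly_roots_finite[of ?d] finite_subset by blast
  then have "poly ?d \<i> = 0" by simp
  then show ?thesis by (simp add: poly_scaled_sym_poly \<Lambda> weyl_act_def)
qed

lemma sym_diff_exponential_sum:
  fixes \<mu> :: "'i \<Rightarrow> 'a::euclidean_space \<Rightarrow> complex"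
  assumes A: "finite A" and lin: "\<And>i. i \<in> A \<Longrightarrow> linear (\<mu> i)"
  shows "sym_diff p (\<lambda>x. \<Sum>i\<in>A. a i * exp (\<mu> i x)) x = (\<Sum>i\<in>A. sym_eval p (\<mu> i) * (a i * exp (\<mu> i x)))"
proof -
  have d: "dir_deriv v (\<lambda>x. \<Sum>i\<in>A. b i * exp (\<mu> i x)) = (\<lambda>x. \<Sum>i\<in>A. (\<mu> i v * b i) * exp (\<mu> i x))" for v b
  proof
    fix x
    have "((\<lambda>x. \<Sum>i\<in>A. b i * exp (\<mu> i x)) has_derivative (\<lambda>v. \<Sum>i\<in>A. b i * (\<mu> i v * exp (\<mu> i x)))) (at x)"
      by (intro has_derivative_sum has_derivative_mult_right exp_linear_has_derivative lin)
    then show "dir_deriv v (\<lambda>x. \<Sum>i\<in>A. b i * exp (\<mu> i x)) x = (\<Sum>i\<in>A. (\<mu> i v * b i) * exp (\<mu> i x))"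
      by (subst dir_deriv_has_derivative) (simp_all add: mult_ac)
  qed
  have f: "foldr dir_deriv vs (\<lambda>x. \<Sum>i\<in>A. a i * exp (\<mu> i x)) = (\<lambda>x. \<Sum>i\<in>A. (prod_list (map (\<mu> i) vs) * a i) * exp (\<mu> i x))" for vs
  proof (induction vs)
    case (Cons v vs)
    have "foldr dir_deriv (v # vs) (\<lambda>x. \<Sum>i\<in>A. a i * exp (\<mu> i x)) =
        dir_deriv v (\<lambda>x. \<Sum>i\<in>A. (prod_list (map (\<mu> i) vs) * a i) * exp (\<mu> i x))"
      by (simp only: foldr_Cons o_apply Cons.IH)
    also have "\<dots> = (\<lambda>x. \<Sum>i\<in>A. (\<mu> i v * (prod_list (map (\<mu> i) vs) * a i)) * exp (\<mu> i x))"
      by (rule d)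
    finally show ?case by (simp add: mult.assoc)
  qed simp
  show ?thesis
    unfolding sym_diff_def sym_eval_def f
    by (induction p) (auto simp: distrib_right sum.distrib sum_distrib_left mult.assoc)
qed

context bethe_data
begin

section \<open>From invariant functions to solution tuples\<close>

lemma enumeration_translate:
  assumes "distinct us" "set us = W" "w \<in> W"
  shows "distinct (map (\<lambda>u. u \<circ> w) us) \<and> set (map (\<lambda>u. u \<circ> w) us) = W"
  using bij_betw_comp_W[OF assms(3)] assms(1,2) by (simp add: distinct_map bij_betw_def del: o_apply)

definition tuple_of :: "('a \<Rightarrow> complex) \<Rightarrow> 'a tuple" where
  "tuple_of f = (\<lambda>w. if w \<in> W then (\<lambda>x. f (w x)) else (\<lambda>x. 0))"

lemma fst_affine_simple: "fst (- \<phi>, 1::real) \<noteq> 0" and fst_simple: "\<alpha> \<in> B \<Longrightarrow> fst (\<alpha>, 0::real) \<noteq> 0"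
  using R_nonzero[OF phi_in] R_nonzero[OF B_sub] by auto

lemma fixed_simple_iff:
  assumes f: "smooth f" and \<alpha>: "\<alpha> \<in> B"
  shows "integral_reflection k (\<alpha>, 0) f = f \<longleftrightarrow>
    (\<forall>x. shifted_deriv (coroot \<alpha>) (- k (\<alpha>, 0)) f x = shifted_deriv (coroot \<alpha>) (k (\<alpha>, 0)) (\<lambda>x. f (reflection \<alpha> x)) x)"
  using integral_reflection_fixed_iff[OF f fst_simple[OF \<alpha>], of k] by (simp add: aff_reflection_linear_root)

text \<open>The affine simple reflection sends x to s_\<phi>(x - y), y the coroot of \<phi>. Its
  gradient is - \<phi>, and differentiating along y instead of - y interchanges k and - k.\<close>

lemma fixed_affine_iff:
  assumes f: "smooth f"
  shows "integral_reflection k (- \<phi>, 1) f = f \<longleftrightarrow>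
    (\<forall>x. shifted_deriv (coroot \<phi>) (k (\<phi>, 0)) f x = shifted_deriv (coroot \<phi>) (- k (\<phi>, 0)) (\<lambda>x. f (reflection \<phi> x)) (x - coroot \<phi>))"
proof -
  let ?g = "\<lambda>x. f (reflection \<phi> x)"
  have g: "smooth ?g" using smooth_compose_affine[OF f linear_reflection, of \<phi> 0] by simp
  have "reflection \<phi> (coroot \<phi>) = - coroot \<phi>"
    using coroot_pairing[OF phi_in] by (simp add: reflection_def scaleR_2)
  then have "aff_reflection (- \<phi>, 1) x = reflection \<phi> (x - coroot \<phi>)" for x
    unfolding aff_reflection_affine by (simp add: reflection_uminus coroot_uminus linear_diff[OF linear_reflection])
  then have refl: "(\<lambda>x. f (aff_reflection (- \<phi>, 1) x)) = (\<lambda>x. ?g (x - coroot \<phi>))" by simp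
  have neg: "shifted_deriv (- y) c h x = - shifted_deriv y (- c) h x" if "smooth h" for y c h x
    unfolding shifted_deriv_def by (simp add: linear_neg[OF dir_deriv_direction_linear[OF that]])
  have kk: "k (- \<phi>, 1) = k (\<phi>, 0)" by (rule k_affine[OF phi_in])
  have "shifted_deriv (coroot (fst (- \<phi>, 1::real))) (- k (- \<phi>, 1)) f x = - shifted_deriv (coroot \<phi>) (k (\<phi>, 0)) f x" for x
    by (simp add: coroot_uminus kk neg[OF f])
  moreover have "shifted_deriv (coroot (fst (- \<phi>, 1::real))) (k (- \<phi>, 1)) (\<lambda>x. f (aff_reflection (- \<phi>, 1) x)) x =
      - shifted_deriv (coroot \<phi>) (- k (\<phi>, 0)) ?g (x - coroot \<phi>)" for x
    unfolding refl by (simp add: coroot_uminus kk neg[OF smooth_shift[OF g]]) (simp add: shifted_deriv_def dir_deriv_shift[of _ ?g])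
  ultimately show ?thesis
    unfolding integral_reflection_fixed_iff[OF f fst_affine_simple, of k] by simp
qed

text \<open>By the chain rule each w carries the equations for f along y to equations for f \<circ>
  w along \<open>inv w y\<close>.\<close>

lemma tuple_of_solutions:
  assumes f: "smooth f"
    and ode: "\<And>us v. distinct us \<Longrightarrow> set us = W \<Longrightarrow> iterated_shifted_deriv v (map (\<lambda>u. \<Lambda> (u v)) us) f = (\<lambda>x. 0)"
    and simple: "\<And>\<alpha>. \<alpha> \<in> B \<Longrightarrow> integral_reflection k (\<alpha>, 0) f = f" and affine: "integral_reflection k (- \<phi>, 1) f = f"
  shows "tuple_of f \<in> solutions"
proof -
  have comp: "shifted_deriv (inv w y) c (\<lambda>x. g (w x)) = (\<lambda>x. shifted_deriv y c g (w x))" if w: "w \<in> W" for w y c and g :: "'a \<Rightarrow> complex"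
    using dir_deriv_compose_affine[OF W_linear[OF w], of "inv w y" g 0] by (simp add: shifted_deriv_def W_apply_inv[OF w])
  have H: "tuple_of f w = (\<lambda>x. f (w x))" if "w \<in> W" for w using that by (simp add: tuple_of_def)
  have Hs: "tuple_of f (reflection \<alpha> \<circ> w) = (\<lambda>x. f (reflection \<alpha> (w x)))" if "w \<in> W" "\<alpha> \<in> R" for w \<alpha>
    using W_comp[OF W_reflection[OF that(2)] that(1)] by (simp only: H o_apply)
  show ?thesis
    unfolding solutions_def mem_Collect_eq
  proof (intro conjI allI ballI impI)
    show "smooth (tuple_of f w)" for w
      using smooth_compose_affine[OF f W_linear, of w 0] by (cases "w \<in> W") (simp_all add: tuple_of_def smooth_zero)
    show "tuple_of f w = (\<lambda>x. 0)" if "w \<notin> W" for w using that by (simp add: tuple_of_def)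
    show "iterated_shifted_deriv v (map (\<lambda>u. \<Lambda> (u v)) us) (tuple_of f w) = (\<lambda>x. 0)"
      if us: "distinct us \<and> set us = W" for w v us
    proof (cases "w \<in> W")
      case True
      \<comment> \<open>Right translation by \<open>inv w\<close> permutes the enumeration, so the
        annihilating product in direction v turns into the one in direction w v.\<close>
      have "map (\<lambda>u. \<Lambda> (u v)) us = map (\<lambda>u. \<Lambda> (u (w v))) (map (\<lambda>u. u \<circ> inv w) us)"
        by (simp add: W_inv_apply[OF True])
      moreover have "iterated_shifted_deriv (w v) (map (\<lambda>u. \<Lambda> (u (w v))) (map (\<lambda>u. u \<circ> inv w) us)) f = (\<lambda>x. 0)"
        using enumeration_translate[OF _ _ W_inv[OF True], of us] us by (intro ode) blast+
      ultimately show ?thesis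
        unfolding H[OF True] iterated_shifted_deriv_compose[OF W_linear[OF True]] by (simp only:)
    next
      case False
      have "iterated_shifted_deriv v cs (\<lambda>x. 0) = (\<lambda>x. 0)" for cs
        by (induction cs) (simp_all add: shifted_deriv_def dir_deriv_zero)
      then show ?thesis using False by (simp add: tuple_of_def)
    qed
    show "shifted_deriv (inv w (coroot \<alpha>)) (- k (\<alpha>, 0)) (tuple_of f w) =
       shifted_deriv (inv w (coroot \<alpha>)) (k (\<alpha>, 0)) (tuple_of f (reflection \<alpha> \<circ> w))" if w: "w \<in> W" and \<alpha>: "\<alpha> \<in> B" for w \<alpha>
      unfolding H[OF w] Hs[OF w B_sub[OF \<alpha>]] comp[OF w] comp[OF w, of _ _ "\<lambda>x. f (reflection \<alpha> x)"]
      using simple[OF \<alpha>] fixed_simple_iff[OF f \<alpha>] by simp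
    show "shifted_deriv (inv w (coroot \<phi>)) (k (\<phi>, 0)) (tuple_of f w) =
       (\<lambda>x. shifted_deriv (inv w (coroot \<phi>)) (- k (\<phi>, 0)) (tuple_of f (reflection \<phi> \<circ> w)) (x - inv w (coroot \<phi>)))" if w: "w \<in> W" for w
      unfolding H[OF w] Hs[OF w phi_in] comp[OF w] comp[OF w, of _ _ "\<lambda>x. f (reflection \<phi> x)"]
      using affine fixed_affine_iff[OF f] by (simp add: linear_diff[OF W_linear[OF w]] W_apply_inv[OF w])
  qed
qed

text \<open>The product of z - u v over u in W is an invariant for every z, and u = id puts v among
  its factors, so \<open>product_annihilates\<close> applies.\<close>

lemma E_space_ode:
  assumes f: "f \<in> E_space R \<Lambda>" and us: "distinct us" "set us = W"
  shows "iterated_shifted_deriv v (map (\<lambda>u. \<Lambda> (u v)) us) f = (\<lambda>x. 0)"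
proof -
  have ra: "real_analytic f" and eig: "\<And>p x. sym_invariant R p \<Longrightarrow> sym_diff p f x = sym_eval p \<Lambda> * f x"
    using f by (auto simp: E_space_def)
  let ?ys = "map (\<lambda>u. u v) us"
  have ev: "sym_eval (linear_factors z ?ys) M = (\<Prod>u\<in>W. z - M (u v))" for z M
    unfolding sym_eval_linear_factors using us by (simp add: prod.distinct_set_conv_list[symmetric] o_def)
  have "sym_invariant R (linear_factors z ?ys)" for z
    unfolding sym_invariant_def ev
  proof (intro ballI allI)
    fix w \<xi> assume w: "w \<in> W"
    show "(\<Prod>u\<in>W. z - weyl_act w (complexify \<xi>) (u v)) = (\<Prod>u\<in>W. z - complexify \<xi> (u v))"
      by (rule prod.reindex_bij_witness[where i = "\<lambda>u. w \<circ> u" and j = "\<lambda>u. inv w \<circ> u"])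
        (auto simp: weyl_act_def W_comp W_inv w fun_eq_iff W_inv_apply[OF w] W_apply_inv[OF w])
  qed
  then have "iterated_shifted_deriv v (map \<Lambda> ?ys) f = (\<lambda>x. 0)"
    using eig W_id us(2) by (intro product_annihilates real_analytic_smooth ra) (auto intro!: image_eqI[of _ _ id])
  then show ?thesis by (simp add: o_def)
qed

lemma expansion_of_fixed:
  assumes f: "f \<in> E_space R \<Lambda>" and simple: "\<And>\<alpha>. \<alpha> \<in> B \<Longrightarrow> integral_reflection k (\<alpha>, 0) f = f"
    and affine: "integral_reflection k (- \<phi>, 1) f = f"
  shows "\<exists>C. f = (\<lambda>x. \<Sum>\<mu>\<in>orbit. C \<mu> * exp (\<mu> x))" and "f = (\<lambda>x. 0) \<or> purely_imaginary \<Lambda>"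
proof -
  have "smooth f" using f by (auto simp: E_space_def intro: real_analytic_smooth)
  then have H: "tuple_of f \<in> solutions"
    by (rule tuple_of_solutions[OF _ E_space_ode[OF f] simple affine])
  have id: "tuple_of f id = f" using W_id by (simp add: tuple_of_def)
  show "\<exists>C. f = (\<lambda>x. \<Sum>\<mu>\<in>orbit. C \<mu> * exp (\<mu> x))" "f = (\<lambda>x. 0) \<or> purely_imaginary \<Lambda>"
    using solutions_expansion[OF H] unfolding id purely_imaginary_iff[OF linear_Lambda] fun_eq_iff by auto
qed

section \<open>Relations between the coefficients on the orbit\<close>

lemma shifted_deriv_exponential_sum:
  "shifted_deriv y c (\<lambda>x. \<Sum>\<mu>\<in>orbit. C \<mu> * exp (\<mu> x)) = (\<lambda>x. \<Sum>\<mu>\<in>orbit. ((\<mu> y + c) * C \<mu>) * exp (\<mu> x))"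
proof
  fix x
  have "((\<lambda>x. \<Sum>\<mu>\<in>orbit. C \<mu> * exp (\<mu> x)) has_derivative (\<lambda>v. \<Sum>\<mu>\<in>orbit. C \<mu> * (\<mu> v * exp (\<mu> x)))) (at x)"
    by (intro has_derivative_sum has_derivative_mult_right exp_linear_has_derivative linear_orbit)
  then have "dir_deriv y (\<lambda>x. \<Sum>\<mu>\<in>orbit. C \<mu> * exp (\<mu> x)) x = (\<Sum>\<mu>\<in>orbit. C \<mu> * (\<mu> y * exp (\<mu> x)))"
    by (rule dir_deriv_has_derivative)
  then show "shifted_deriv y c (\<lambda>x. \<Sum>\<mu>\<in>orbit. C \<mu> * exp (\<mu> x)) x = (\<Sum>\<mu>\<in>orbit. ((\<mu> y + c) * C \<mu>) * exp (\<mu> x))"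
    by (simp add: shifted_deriv_def sum_distrib_left sum.distrib[symmetric] algebra_simps)
qed

lemma exponential_sum_reflect:
  assumes "\<alpha> \<in> R"
  shows "(\<Sum>\<mu>\<in>orbit. C \<mu> * exp (\<mu> (reflection \<alpha> x))) = (\<Sum>\<mu>\<in>orbit. C (weyl_act (reflection \<alpha>) \<mu>) * exp (\<mu> x))"
proof -
  let ?s = "weyl_act (reflection \<alpha>)"
  have "(\<Sum>\<mu>\<in>orbit. C \<mu> * exp (\<mu> (reflection \<alpha> x))) = (\<Sum>\<mu>\<in>orbit. C (?s \<mu>) * exp (?s \<mu> (reflection \<alpha> x)))"
    by (rule sum.reindex_bij_betw[OF bij_betw_orbit[OF W_reflection[OF assms]], symmetric])
  then show ?thesis by (simp add: weyl_act_def inv_reflection reflection_reflection)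
qed

lemma exponential_sums_eq_iff:
  "(\<forall>x. (\<Sum>\<mu>\<in>orbit. C \<mu> * exp (\<mu> x)) = (\<Sum>\<mu>\<in>orbit. D \<mu> * exp (\<mu> x))) \<longleftrightarrow> (\<forall>\<mu>\<in>orbit. C \<mu> = D \<mu>)"
proof
  assume eq: "\<forall>x. (\<Sum>\<mu>\<in>orbit. C \<mu> * exp (\<mu> x)) = (\<Sum>\<mu>\<in>orbit. D \<mu> * exp (\<mu> x))"
  have zero: "(\<Sum>\<mu>\<in>orbit. (C \<mu> - D \<mu>) * exp (\<mu> x)) = 0" for x
    using eq by (simp add: left_diff_distrib sum_subtractf)
  have "C \<mu> - D \<mu> = 0" if "\<mu> \<in> orbit" for \<mu>
    by (rule exponentials_independent[where c = "\<lambda>\<mu>. C \<mu> - D \<mu>" and M = orbit])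
      (rule finite_orbit, erule linear_orbit, rule zero, rule that)
  then show "\<forall>\<mu>\<in>orbit. C \<mu> = D \<mu>" by simp
qed (simp cong: sum.cong)

lemma smooth_exponential_sum: "smooth (\<lambda>x. \<Sum>\<mu>\<in>orbit. C \<mu> * exp (\<mu> x))"
  by (intro real_analytic_smooth real_analytic_sum finite_orbit real_analytic_cmult real_analytic_exp linear_orbit)

lemma fixed_simple_coefficients:
  assumes \<alpha>: "\<alpha> \<in> B" and f: "f = (\<lambda>x. \<Sum>\<mu>\<in>orbit. C \<mu> * exp (\<mu> x))"
  shows "integral_reflection k (\<alpha>, 0) f = f \<longleftrightarrow>
    (\<forall>\<mu>\<in>orbit. (\<mu> (coroot \<alpha>) + - k (\<alpha>, 0)) * C \<mu> = (\<mu> (coroot \<alpha>) + k (\<alpha>, 0)) * C (weyl_act (reflection \<alpha>) \<mu>))"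
  unfolding f fixed_simple_iff[OF smooth_exponential_sum \<alpha>] exponential_sum_reflect[OF B_sub[OF \<alpha>]]
    shifted_deriv_exponential_sum exponential_sums_eq_iff by simp

lemma fixed_affine_coefficients:
  assumes f: "f = (\<lambda>x. \<Sum>\<mu>\<in>orbit. C \<mu> * exp (\<mu> x))"
  shows "integral_reflection k (- \<phi>, 1) f = f \<longleftrightarrow>
    (\<forall>\<mu>\<in>orbit. (\<mu> (coroot \<phi>) + k (\<phi>, 0)) * C \<mu> =
      exp (- \<mu> (coroot \<phi>)) * ((\<mu> (coroot \<phi>) + - k (\<phi>, 0)) * C (weyl_act (reflection \<phi>) \<mu>)))"
proof -
  have "(\<Sum>\<mu>\<in>orbit. D \<mu> * exp (\<mu> (x - coroot \<phi>))) = (\<Sum>\<mu>\<in>orbit. (exp (- \<mu> (coroot \<phi>)) * D \<mu>) * exp (\<mu> x))" for D x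
    by (rule sum.cong) (simp_all add: linear_diff[OF linear_orbit] exp_diff exp_minus field_simps)
  then show ?thesis
    unfolding f fixed_affine_iff[OF smooth_exponential_sum] exponential_sum_reflect[OF phi_in]
      shifted_deriv_exponential_sum by (simp only: exponential_sums_eq_iff of_real_minus)
qed

lemma imaginary_shift_nonzero:
  assumes "purely_imaginary \<Lambda>" "\<mu> \<in> orbit" "t \<noteq> 0"
  shows "\<mu> v + complex_of_real t \<noteq> 0"
proof -
  have "Re (\<mu> v) = 0"
    using assms(1,2) by (auto simp: purely_imaginary_iff[OF linear_Lambda] orbit_def weyl_act_def)
  then show ?thesis
    using assms(3) by (auto simp: complex_eq_iff)
qed

lemma orbit_regular:
  assumes "regular_value R \<Lambda>" "\<mu> \<in> orbit" "\<gamma> \<in> R"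
  shows "\<mu> (coroot \<gamma>) \<noteq> 0"
proof -
  obtain w where w: "w \<in> W" "\<mu> = weyl_act w \<Lambda>" using assms(2) by (auto simp: orbit_def)
  obtain \<beta> where "\<beta> \<in> R" "coroot \<beta> = inv w (coroot \<gamma>)" using W_roots[OF W_inv[OF w(1)]] assms(3) by blast
  then show ?thesis using assms(1) by (auto simp: w(2) weyl_act_def regular_value_def)
qed

lemma c_function_nonzero:
  assumes "purely_imaginary \<Lambda>" "regular_value R \<Lambda>" "\<mu> \<in> orbit"
  shows "c_function R B k \<mu> \<noteq> 0"
  unfolding c_function_def
  using imaginary_shift_nonzero[OF assms(1,3)] orbit_regular[OF assms(2,3)] k_pos positive_roots_subset
  by (auto simp: finite_positive_roots less_imp_neq[symmetric])

text \<open>For imaginary \<lambda> the factors in \<open>rel\<close> never vanish, so one nonzero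
  coefficient makes all of them nonzero. A wall through \<lambda> would yield an orbit point fixed
  by a simple reflection, where \<open>rel\<close> reads - k C = k C.\<close>

lemma regular_of_fixed:
  assumes imag: "purely_imaginary \<Lambda>" and C: "\<mu>0 \<in> orbit" "C \<mu>0 \<noteq> 0"
    and rel: "\<And>\<alpha> \<mu>. \<alpha> \<in> B \<Longrightarrow> \<mu> \<in> orbit \<Longrightarrow>
      (\<mu> (coroot \<alpha>) + - k (\<alpha>, 0)) * C \<mu> = (\<mu> (coroot \<alpha>) + k (\<alpha>, 0)) * C (weyl_act (reflection \<alpha>) \<mu>)"
  shows "regular_value R \<Lambda>"
  unfolding regular_value_def
proof (intro ballI notI)
  fix \<gamma> assume "\<gamma> \<in> R" and z: "\<Lambda> (coroot \<gamma>) = 0"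
  then obtain w \<alpha> where w: "w \<in> W" "\<alpha> \<in> B" "coroot \<gamma> = w (coroot \<alpha>)" using root_conjugate_simple by blast
  have kn: "k (\<beta>, 0) \<noteq> 0" if "\<beta> \<in> B" for \<beta> using k_pos[OF B_sub[OF that]] by simp
  have iff: "C \<mu> = 0 \<longleftrightarrow> C \<Lambda> = 0" if "\<mu> \<in> orbit" for \<mu>
    using that
  proof (induction rule: orbit_induct)
    case (step \<beta> \<mu>)
    have "C (weyl_act (reflection \<beta>) \<mu>) = 0 \<longleftrightarrow> C \<mu> = 0"
      using rel[OF step(1,2)] imaginary_shift_nonzero[OF imag step(2), of "k (\<beta>, 0)"]
        imaginary_shift_nonzero[OF imag step(2), of "- k (\<beta>, 0)"] kn[OF step(1)]
      by (metis mult_eq_0_iff neg_equal_0_iff_equal)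
    then show ?case using step(3) by blast
  qed (rule refl)
  let ?\<mu> = "weyl_act (inv w) \<Lambda>"
  have \<mu>: "?\<mu> \<in> orbit" using W_inv[OF w(1)] by (simp add: orbit_def)
  have \<mu>0: "?\<mu> (coroot \<alpha>) = 0" using z by (simp add: weyl_act_def W_inv_inv[OF w(1)] w(3))
  then have "?\<mu> (reflection \<alpha> v) = ?\<mu> v" for v
    by (simp add: reflection_def linear_diff[OF linear_orbit[OF \<mu>]] linear_scale[OF linear_orbit[OF \<mu>]])
  then have "weyl_act (reflection \<alpha>) ?\<mu> = ?\<mu>"
    unfolding weyl_act_def[of "reflection \<alpha>"] inv_reflection by (rule ext)
  then have "- complex_of_real (k (\<alpha>, 0)) * C ?\<mu> = k (\<alpha>, 0) * C ?\<mu>"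
    using rel[OF w(2) \<mu>] \<mu>0 by simp
  then have "C ?\<mu> = 0" using kn[OF w(2)] by simp
  then show False using iff[OF \<mu>] iff[OF C(1)] C(2) by simp
qed

text \<open>Along simple reflections, which generate the orbit, C and the c-function obey the same
  recursion.\<close>

lemma coefficients_proportional:
  assumes imag: "purely_imaginary \<Lambda>" and reg: "regular_value R \<Lambda>" and \<mu>: "\<mu> \<in> orbit"
    and rel: "\<And>\<alpha> \<mu>. \<alpha> \<in> B \<Longrightarrow> \<mu> \<in> orbit \<Longrightarrow>
      (\<mu> (coroot \<alpha>) + - k (\<alpha>, 0)) * C \<mu> = (\<mu> (coroot \<alpha>) + k (\<alpha>, 0)) * C (weyl_act (reflection \<alpha>) \<mu>)"
  shows "C \<mu> = C \<Lambda> / c_function R B k \<Lambda> * c_function R B k \<mu>"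
  using \<mu>
proof (induction rule: orbit_induct)
  case base
  then show ?case using c_function_nonzero[OF imag reg Lambda_in_orbit] by simp
next
  case (step \<alpha> \<mu>)
  let ?K = "C \<Lambda> / c_function R B k \<Lambda>" and ?s = "weyl_act (reflection \<alpha>) \<mu>"
  have nz: "\<mu> (coroot \<alpha>) + k (\<alpha>, 0) \<noteq> 0"
    using imaginary_shift_nonzero[OF imag step(2)] k_pos[OF B_sub[OF step(1)]] by simp
  have "(\<mu> (coroot \<alpha>) + k (\<alpha>, 0)) * C ?s = (\<mu> (coroot \<alpha>) + - k (\<alpha>, 0)) * C \<mu>"
    by (rule rel[OF step(1,2), symmetric])
  also have "\<dots> = ?K * ((\<mu> (coroot \<alpha>) - k (\<alpha>, 0)) * c_function R B k \<mu>)"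
    by (simp only: step(3) of_real_minus add_uminus_conv_diff mult.left_commute)
  also have "\<dots> = (\<mu> (coroot \<alpha>) + k (\<alpha>, 0)) * (?K * c_function R B k ?s)"
    unfolding c_function_simple_reflection[OF step(1) orbit_regular[OF reg step(2) B_sub[OF step(1)]] linear_orbit[OF step(2)], symmetric]
    by (simp only: mult.left_commute)
  finally show ?case using nz mult_left_cancel by blast
qed

text \<open>\<open>bethe_product\<close> expresses the right-hand side through c-functions; the
  factor to be cancelled is nonzero for imaginary regular \<lambda>.\<close>

lemma bethe_equation_iff:
  assumes imag: "purely_imaginary \<Lambda>" and reg: "regular_value R \<Lambda>" and \<mu>: "\<mu> \<in> orbit"
  shows "exp (\<mu> (coroot \<phi>)) = (\<Prod>\<alpha>\<in>positive_roots R B.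
       ((\<mu> (coroot \<alpha>) - complex_of_real (k (\<alpha>, 0))) / (\<mu> (coroot \<alpha>) + complex_of_real (k (\<alpha>, 0))))
         powi \<lfloor>blinfun_apply \<alpha> (coroot \<phi>)\<rfloor>) \<longleftrightarrow>
    (\<mu> (coroot \<phi>) + k (\<phi>, 0)) * c_function R B k \<mu> =
      exp (- \<mu> (coroot \<phi>)) * ((\<mu> (coroot \<phi>) + - k (\<phi>, 0)) * c_function R B k (weyl_act (reflection \<phi>) \<mu>))"
    (is "?e = ?P \<longleftrightarrow> ?a = _ * ?b")
proof -
  have plus: "\<mu> (coroot \<gamma>) + k (\<gamma>, 0) \<noteq> 0" if "\<gamma> \<in> R" for \<gamma>
    using imaginary_shift_nonzero[OF imag \<mu>] k_pos[OF that] by simp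
  have P: "?P * ?a = ?b"
    using bethe_product[OF linear_orbit[OF \<mu>] orbit_regular[OF reg \<mu>] plus] by simp
  have "?a \<noteq> 0" using plus[OF phi_in] c_function_nonzero[OF imag reg \<mu>] by simp
  then have "?e = ?P \<longleftrightarrow> ?e * ?a = ?P * ?a" by (rule mult_right_cancel[symmetric])
  also have "\<dots> \<longleftrightarrow> ?e * ?a = ?b" by (simp only: P)
  also have "\<dots> \<longleftrightarrow> ?a = exp (- \<mu> (coroot \<phi>)) * ?b"
    by (auto simp: exp_minus field_simps)
  finally show ?thesis .
qed

lemma bethe_equations_iff:
  assumes "purely_imaginary \<Lambda>" "regular_value R \<Lambda>"
  shows "bethe_equations R B \<phi> k \<Lambda> \<longleftrightarrow> (\<forall>\<mu>\<in>orbit. (\<mu> (coroot \<phi>) + k (\<phi>, 0)) * c_function R B k \<mu> =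
      exp (- \<mu> (coroot \<phi>)) * ((\<mu> (coroot \<phi>) + - k (\<phi>, 0)) * c_function R B k (weyl_act (reflection \<phi>) \<mu>)))"
  using bethe_equation_iff[OF assms] by (simp add: bethe_equations_def orbit_def)

text \<open>The fibres of \<open>w \<mapsto> w\<lambda>\<close> all have the size of the stabilizer of \<open>\<lambda>\<close>, so that sums over the
  Weyl group are multiples of sums over the orbit.\<close>

lemma sum_weyl_eq_sum_orbit: "\<exists>m. \<forall>F :: _ \<Rightarrow> complex. (\<Sum>w\<in>W. F (weyl_act w \<Lambda>)) = of_nat m * (\<Sum>\<mu>\<in>orbit. F \<mu>)"
proof (intro exI allI)
  fix F :: "('a \<Rightarrow> complex) \<Rightarrow> complex"
  let ?S = "{w \<in> W. weyl_act w \<Lambda> = \<Lambda>}"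
  have "(\<Sum>w\<in>W. F (weyl_act w \<Lambda>)) = (\<Sum>\<mu>\<in>orbit. \<Sum>w | w \<in> W \<and> weyl_act w \<Lambda> = \<mu>. F (weyl_act w \<Lambda>))"
    unfolding orbit_def by (rule sum.image_gen[OF finite_W])
  also have "\<dots> = (\<Sum>\<mu>\<in>orbit. of_nat (card ?S) * F \<mu>)"
  proof (rule sum.cong)
    fix \<mu> assume "\<mu> \<in> orbit"
    then obtain u where u: "u \<in> W" "\<mu> = weyl_act u \<Lambda>" by (auto simp: orbit_def)
    have "bij_betw (\<lambda>w. u \<circ> w) ?S {w \<in> W. weyl_act w \<Lambda> = \<mu>}"
    proof (rule bij_betw_byWitness[where f' = "\<lambda>w. inv u \<circ> w"])
      show "(\<lambda>w. u \<circ> w) ` ?S \<subseteq> {w \<in> W. weyl_act w \<Lambda> = \<mu>}"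
        using W_comp[OF u(1)] weyl_act_comp[OF u(1)] u(2) by auto
      show "(\<lambda>w. inv u \<circ> w) ` {w \<in> W. weyl_act w \<Lambda> = \<mu>} \<subseteq> ?S"
        using W_comp[OF W_inv[OF u(1)]] weyl_act_comp[OF W_inv[OF u(1)]] weyl_act_weyl_act_inv(2)[OF u(1)] u(2) by auto
    qed (auto simp: fun_eq_iff W_inv_apply[OF u(1)] W_apply_inv[OF u(1)])
    then have "card {w \<in> W. weyl_act w \<Lambda> = \<mu>} = card ?S" by (rule bij_betw_same_card[symmetric])
    then show "(\<Sum>w | w \<in> W \<and> weyl_act w \<Lambda> = \<mu>. F (weyl_act w \<Lambda>)) = of_nat (card ?S) * F \<mu>" by simp
  qed simp
  finally show "(\<Sum>w\<in>W. F (weyl_act w \<Lambda>)) = of_nat (card ?S) * (\<Sum>\<mu>\<in>orbit. F \<mu>)"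
    by (simp only: sum_distrib_left)
qed

lemma bethe_eigenfunction_zero:
  assumes "regular_value R \<Lambda>" shows "bethe_eigenfunction R B k \<Lambda> 0 = 1"
proof -
  have "weyl_act w \<Lambda> 0 = 0" if "w \<in> W" for w
    using linear_0[OF linear_weyl_act[OF that linear_Lambda]] .
  then have "bethe_eigenfunction R B k \<Lambda> 0 = (1 / of_nat (card W)) * (\<Sum>w\<in>W. c_function R B k (weyl_act w \<Lambda>))"
    by (simp add: bethe_eigenfunction_def)
  moreover have "card W \<noteq> 0" using finite_W W_id by auto
  ultimately show ?thesis by (simp add: sum_c_function[OF assms])
qed

text \<open>m stands for the order of the stabilizer over that of W; its value is left open.\<close>

lemma bethe_eigenfunction_orbit:
  "\<exists>m. bethe_eigenfunction R B k \<Lambda> = (\<lambda>x. \<Sum>\<mu>\<in>orbit. (m * c_function R B k \<mu>) * exp (\<mu> x))"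
proof -
  obtain m where m: "\<And>F :: _ \<Rightarrow> complex. (\<Sum>w\<in>W. F (weyl_act w \<Lambda>)) = of_nat m * (\<Sum>\<mu>\<in>orbit. F \<mu>)"
    using sum_weyl_eq_sum_orbit by blast
  have "bethe_eigenfunction R B k \<Lambda> x = (\<Sum>\<mu>\<in>orbit. ((1 / of_nat (card W) * of_nat m) * c_function R B k \<mu>) * exp (\<mu> x))" for x
    unfolding bethe_eigenfunction_def m[of "\<lambda>\<mu>. c_function R B k \<mu> * exp (\<mu> x)"] by (simp only: sum_distrib_left mult.assoc)
  then show ?thesis by blast
qed

text \<open>Each exp \<mu> is an eigenfunction with eigenvalue p(\<mu>), and p is constant on the
  orbit by \<open>sym_invariant_imaginary\<close>.\<close>

lemma E_space_exponential_sum: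
  assumes "purely_imaginary \<Lambda>"
  shows "(\<lambda>x. \<Sum>\<mu>\<in>orbit. C \<mu> * exp (\<mu> x)) \<in> E_space R \<Lambda>"
proof -
  obtain \<xi> where \<xi>: "\<Lambda> = (\<lambda>v. \<i> * complexify \<xi> v)" using assms by (auto simp: purely_imaginary_def)
  have inv: "sym_eval p \<mu> = sym_eval p \<Lambda>" if "sym_invariant R p" "\<mu> \<in> orbit" for p \<mu>
    using that sym_invariant_imaginary[OF _ _ \<xi>] by (auto simp: orbit_def)
  have "sym_diff p (\<lambda>x. \<Sum>\<mu>\<in>orbit. C \<mu> * exp (\<mu> x)) x = sym_eval p \<Lambda> * (\<Sum>\<mu>\<in>orbit. C \<mu> * exp (\<mu> x))"
    if "sym_invariant R p" for p x
  proof -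
    have "sym_diff p (\<lambda>x. \<Sum>\<mu>\<in>orbit. C \<mu> * exp (\<mu> x)) x = (\<Sum>\<mu>\<in>orbit. sym_eval p \<mu> * (C \<mu> * exp (\<mu> x)))"
      by (rule sym_diff_exponential_sum[where \<mu> = "\<lambda>\<mu>. \<mu>"]) (rule finite_orbit, erule linear_orbit)
    also have "\<dots> = (\<Sum>\<mu>\<in>orbit. sym_eval p \<Lambda> * (C \<mu> * exp (\<mu> x)))"
      by (rule sum.cong) (simp_all add: inv[OF that])
    finally show ?thesis by (simp only: sum_distrib_left)
  qed
  moreover have "real_analytic (\<lambda>x. \<Sum>\<mu>\<in>orbit. C \<mu> * exp (\<mu> x))"
    by (intro real_analytic_sum finite_orbit real_analytic_cmult real_analytic_exp linear_orbit)
  ultimately show ?thesis by (simp add: E_space_def)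
qed

text \<open>The invariants expressed by the simple affine operators, independently of the action
  \<open>Q\<close>.\<close>

definition fixed_space :: "('a \<Rightarrow> complex) set" where
  "fixed_space = {f \<in> E_space R \<Lambda>. \<forall>b\<in>affine_basis B \<phi>. integral_reflection k b f = f}"

lemma fixed_spaceD:
  assumes "f \<in> fixed_space"
  shows "f \<in> E_space R \<Lambda>" "\<alpha> \<in> B \<Longrightarrow> integral_reflection k (\<alpha>, 0) f = f" "integral_reflection k (- \<phi>, 1) f = f"
  using assms by (auto simp: fixed_space_def affine_basis_def)

text \<open>The simple equations make the coefficients proportional to the c-function, with a
  nonzero factor. This identifies f and turns the affine equation into the Bethe ansatz
  equations.\<close>

lemma fixed_space_nonzero:
  assumes f: "f \<in> fixed_space" "f \<noteq> (\<lambda>x. 0)"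
  shows "purely_imaginary \<Lambda> \<and> regular_value R \<Lambda> \<and> bethe_equations R B \<phi> k \<Lambda>"
    and "\<exists>c. f = (\<lambda>x. c * bethe_eigenfunction R B k \<Lambda> x)"
proof -
  note fx = fixed_spaceD[OF f(1)]
  have imag: "purely_imaginary \<Lambda>" using expansion_of_fixed(2)[OF fx] f(2) by blast
  obtain C where C: "f = (\<lambda>x. \<Sum>\<mu>\<in>orbit. C \<mu> * exp (\<mu> x))" using expansion_of_fixed(1)[OF fx] by blast
  have rel: "(\<mu> (coroot \<alpha>) + - k (\<alpha>, 0)) * C \<mu> = (\<mu> (coroot \<alpha>) + k (\<alpha>, 0)) * C (weyl_act (reflection \<alpha>) \<mu>)"
    if "\<alpha> \<in> B" "\<mu> \<in> orbit" for \<alpha> \<mu>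
    using fixed_simple_coefficients[OF that(1) C] fx(2)[OF that(1)] that(2) by blast
  have "\<exists>\<mu>\<in>orbit. C \<mu> \<noteq> 0"
  proof (rule ccontr)
    assume "\<not> ?thesis"
    then have "f = (\<lambda>x. 0)" unfolding C by (simp cong: sum.cong)
    then show False using f(2) by simp
  qed
  then obtain \<mu>0 where \<mu>0: "\<mu>0 \<in> orbit" "C \<mu>0 \<noteq> 0" by blast
  have reg: "regular_value R \<Lambda>" by (rule regular_of_fixed[OF imag \<mu>0 rel])
  define K where "K = C \<Lambda> / c_function R B k \<Lambda>"
  have CK: "C \<mu> = K * c_function R B k \<mu>" if "\<mu> \<in> orbit" for \<mu>
    unfolding K_def by (rule coefficients_proportional[OF imag reg that rel])
  have "K \<noteq> 0" using CK[OF \<mu>0(1)] \<mu>0(2) by auto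
  have "bethe_equations R B \<phi> k \<Lambda>"
    unfolding bethe_equations_iff[OF imag reg]
  proof
    fix \<mu> assume \<mu>: "\<mu> \<in> orbit"
    let ?s = "weyl_act (reflection \<phi>) \<mu>"
    have "(\<mu> (coroot \<phi>) + k (\<phi>, 0)) * C \<mu> = exp (- \<mu> (coroot \<phi>)) * ((\<mu> (coroot \<phi>) + - k (\<phi>, 0)) * C ?s)"
      using fixed_affine_coefficients[OF C] fx(3) \<mu> by blast
    then have "K * ((\<mu> (coroot \<phi>) + k (\<phi>, 0)) * c_function R B k \<mu>) =
        K * (exp (- \<mu> (coroot \<phi>)) * ((\<mu> (coroot \<phi>) + - k (\<phi>, 0)) * c_function R B k ?s))"
      unfolding CK[OF \<mu>] CK[OF orbit_closed[OF W_reflection[OF phi_in] \<mu>]] by (simp only: mult.left_commute)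
    then show "(\<mu> (coroot \<phi>) + k (\<phi>, 0)) * c_function R B k \<mu> =
        exp (- \<mu> (coroot \<phi>)) * ((\<mu> (coroot \<phi>) + - k (\<phi>, 0)) * c_function R B k ?s)"
      using \<open>K \<noteq> 0\<close> mult_left_cancel by blast
  qed
  with imag reg show "purely_imaginary \<Lambda> \<and> regular_value R \<Lambda> \<and> bethe_equations R B \<phi> k \<Lambda>" by blast
  obtain m where m: "bethe_eigenfunction R B k \<Lambda> = (\<lambda>x. \<Sum>\<mu>\<in>orbit. (m * c_function R B k \<mu>) * exp (\<mu> x))"
    using bethe_eigenfunction_orbit by blast
  \<comment> \<open>The normalization at the origin excludes m = 0 without computing the
    stabilizer.\<close>
  have "m \<noteq> 0"
  proof
    assume "m = 0"
    then have "bethe_eigenfunction R B k \<Lambda> 0 = 0" by (simp add: m)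
    then show False using bethe_eigenfunction_zero[OF reg] by simp
  qed
  have "f x = (K / m) * bethe_eigenfunction R B k \<Lambda> x" for x
    unfolding C m sum_distrib_left by (rule sum.cong) (use \<open>m \<noteq> 0\<close> in \<open>simp_all add: CK\<close>)
  then show "\<exists>c. f = (\<lambda>x. c * bethe_eigenfunction R B k \<Lambda> x)" by blast
qed

lemma multiple_in_fixed_space:
  assumes imag: "purely_imaginary \<Lambda>" and reg: "regular_value R \<Lambda>" and bethe: "bethe_equations R B \<phi> k \<Lambda>"
  shows "(\<lambda>x. c * bethe_eigenfunction R B k \<Lambda> x) \<in> fixed_space"
proof -
  obtain m where m: "bethe_eigenfunction R B k \<Lambda> = (\<lambda>x. \<Sum>\<mu>\<in>orbit. (m * c_function R B k \<mu>) * exp (\<mu> x))"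
    using bethe_eigenfunction_orbit by blast
  define C where "C \<mu> = (c * m) * c_function R B k \<mu>" for \<mu>
  have f: "(\<lambda>x. c * bethe_eigenfunction R B k \<Lambda> x) = (\<lambda>x. \<Sum>\<mu>\<in>orbit. C \<mu> * exp (\<mu> x))"
    by (simp add: m C_def sum_distrib_left mult.assoc)
  have "integral_reflection k (\<alpha>, 0) (\<lambda>x. c * bethe_eigenfunction R B k \<Lambda> x) = (\<lambda>x. c * bethe_eigenfunction R B k \<Lambda> x)"
    if \<alpha>: "\<alpha> \<in> B" for \<alpha>
    unfolding fixed_simple_coefficients[OF \<alpha> f]
  proof
    fix \<mu> assume \<mu>: "\<mu> \<in> orbit"
    show "(\<mu> (coroot \<alpha>) + - k (\<alpha>, 0)) * C \<mu> = (\<mu> (coroot \<alpha>) + k (\<alpha>, 0)) * C (weyl_act (reflection \<alpha>) \<mu>)"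
      using c_function_simple_reflection[OF \<alpha> orbit_regular[OF reg \<mu> B_sub[OF \<alpha>]] linear_orbit[OF \<mu>]]
      by (simp add: C_def mult.left_commute[of _ "c * m"])
  qed
  moreover have "integral_reflection k (- \<phi>, 1) (\<lambda>x. c * bethe_eigenfunction R B k \<Lambda> x) = (\<lambda>x. c * bethe_eigenfunction R B k \<Lambda> x)"
    unfolding fixed_affine_coefficients[OF f]
  proof
    fix \<mu> assume \<mu>: "\<mu> \<in> orbit"
    have "(\<mu> (coroot \<phi>) + k (\<phi>, 0)) * c_function R B k \<mu> =
        exp (- \<mu> (coroot \<phi>)) * ((\<mu> (coroot \<phi>) + - k (\<phi>, 0)) * c_function R B k (weyl_act (reflection \<phi>) \<mu>))"
      using bethe \<mu> unfolding bethe_equations_iff[OF imag reg] by blast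
    then show "(\<mu> (coroot \<phi>) + k (\<phi>, 0)) * C \<mu> =
        exp (- \<mu> (coroot \<phi>)) * ((\<mu> (coroot \<phi>) + - k (\<phi>, 0)) * C (weyl_act (reflection \<phi>) \<mu>))"
      unfolding C_def mult.left_commute[of _ "c * m"] by (simp only:)
  qed
  moreover have "(\<lambda>x. c * bethe_eigenfunction R B k \<Lambda> x) \<in> E_space R \<Lambda>"
    unfolding f by (rule E_space_exponential_sum[OF imag])
  ultimately show ?thesis by (auto simp: fixed_space_def affine_basis_def)
qed

lemma E_space_continuous: "f \<in> E_space R \<Lambda> \<Longrightarrow> f \<in> C_space"
  by (auto simp: E_space_def C_space_def intro: smooth_continuous real_analytic_smooth)

text \<open>Functions in E(\<lambda>) are continuous, so the axioms of the action apply to them;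
  invariance spreads from the simple affine reflections to the group by
  \<open>affine_weyl_induct\<close>.\<close>

lemma E_invariants_eq_fixed_space:
  assumes Q: "integral_reflection_action R B \<phi> k Q"
  shows "E_invariants R Q \<Lambda> = fixed_space"
proof (rule set_eqI)
  fix f
  have in_group: "aff_reflection b \<in> affine_weyl_group R" if "b \<in> affine_basis B \<phi>" for b
    unfolding affine_weyl_group_def using that affine_basis_subset by (intro transformation_group.generator imageI) blast
  have Qb: "Q (aff_reflection b) f = integral_reflection k b f" if "b \<in> affine_basis B \<phi>" "f \<in> E_space R \<Lambda>" for b
    using Q that E_space_continuous unfolding integral_reflection_action_def by blast
  show "f \<in> E_invariants R Q \<Lambda> \<longleftrightarrow> f \<in> fixed_space"
  proof
    assume "f \<in> E_invariants R Q \<Lambda>"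
    then show "f \<in> fixed_space"
      using in_group Qb unfolding E_invariants_def fixed_space_def by auto
  next
    assume f: "f \<in> fixed_space"
    then have fE: "f \<in> E_space R \<Lambda>" and fb: "\<And>b. b \<in> affine_basis B \<phi> \<Longrightarrow> integral_reflection k b f = f"
      by (auto simp: fixed_space_def)
    have "Q w f = f" if "w \<in> affine_weyl_group R" for w
      using that
    proof (induction rule: affine_weyl_induct)
      case id
      show ?case using Q E_space_continuous[OF fE] unfolding integral_reflection_action_def by blast
    next
      case (step b w)
      have "Q (aff_reflection b \<circ> w) f = Q (aff_reflection b) (Q w f)"
        using Q in_group[OF step(1)] step(2) E_space_continuous[OF fE] unfolding integral_reflection_action_def by blast
      also have "\<dots> = f" using step(3) Qb[OF step(1) fE] fb[OF step(1)] by simp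
      finally show ?case .
    qed
    then show "f \<in> E_invariants R Q \<Lambda>" using fE by (simp add: E_invariants_def)
  qed
qed

lemma zero_in_fixed_space: "(\<lambda>x. 0) \<in> fixed_space"
proof -
  have "foldr dir_deriv vs (\<lambda>x. 0) = (\<lambda>x. 0)" for vs :: "'a list"
    by (induction vs) (simp_all add: dir_deriv_zero)
  then have "sym_diff p (\<lambda>x. 0) x = 0" for p :: "'a sym" and x
    unfolding sym_diff_def by (induction p) auto
  then have "(\<lambda>x. 0) \<in> E_space R \<Lambda>" by (simp add: E_space_def real_analytic_zero)
  moreover have "integral_reflection k b (\<lambda>x. 0) = (\<lambda>x. 0)" for b
    by (simp add: integral_reflection_def fun_eq_iff)
  ultimately show ?thesis by (simp add: fixed_space_def)
qed

lemma fixed_space_cases: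
  defines "\<psi> \<equiv> bethe_eigenfunction R B k \<Lambda>"
    and "good \<equiv> purely_imaginary \<Lambda> \<and> regular_value R \<Lambda> \<and> bethe_equations R B \<phi> k \<Lambda>"
  shows "good \<Longrightarrow> fixed_space = {(\<lambda>x. c * \<psi> x) |c. True} \<and> \<psi> 0 = 1" and "\<not> good \<Longrightarrow> fixed_space = {\<lambda>x. 0}"
proof -
  assume g: good
  have "f \<in> {(\<lambda>x. c * \<psi> x) |c. True}" if "f \<in> fixed_space" for f
  proof (cases "f = (\<lambda>x. 0)")
    case True
    then have "f = (\<lambda>x. 0 * \<psi> x)" by simp
    then show ?thesis by blast
  next
    case False
    then show ?thesis using fixed_space_nonzero(2)[OF that] unfolding \<psi>_def by blast
  qed
  moreover have "(\<lambda>x. c * \<psi> x) \<in> fixed_space" for c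
    using g unfolding \<psi>_def good_def by (intro multiple_in_fixed_space) blast+
  moreover have "\<psi> 0 = 1" using g bethe_eigenfunction_zero unfolding \<psi>_def good_def by blast
  ultimately show "fixed_space = {(\<lambda>x. c * \<psi> x) |c. True} \<and> \<psi> 0 = 1" by blast
next
  assume "\<not> good"
  then show "fixed_space = {\<lambda>x. 0}"
    using fixed_space_nonzero(1) zero_in_fixed_space unfolding good_def by blast
qed

end

theorem theorem3p5:
  fixes \<Sigma>\<^sub>0 I\<^sub>0 :: "'a::euclidean_space dual set"
    and \<phi> :: "'a dual"
    and k :: "'a dual \<times> real \<Rightarrow> real"
    and Q :: "('a \<Rightarrow> 'a) \<Rightarrow> ('a \<Rightarrow> complex) \<Rightarrow> 'a \<Rightarrow> complex"
    and \<Lambda> :: "'a \<Rightarrow> complex"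
  assumes "root_system \<Sigma>\<^sub>0" and "reduced_roots \<Sigma>\<^sub>0" and "irreducible_roots \<Sigma>\<^sub>0"
    and "root_basis \<Sigma>\<^sub>0 I\<^sub>0" and "highest_root \<Sigma>\<^sub>0 I\<^sub>0 \<phi>"
    and "multiplicity_function \<Sigma>\<^sub>0 k"
    and "integral_reflection_action \<Sigma>\<^sub>0 I\<^sub>0 \<phi> k Q"
    and "\<Lambda> \<in> complex_dual"
  shows "(one_dimensional (E_invariants \<Sigma>\<^sub>0 Q \<Lambda>) \<or> zero_dimensional (E_invariants \<Sigma>\<^sub>0 Q \<Lambda>)) \<and>
    (one_dimensional (E_invariants \<Sigma>\<^sub>0 Q \<Lambda>) \<longleftrightarrow>
       purely_imaginary \<Lambda> \<and> regular_value \<Sigma>\<^sub>0 \<Lambda> \<and> bethe_equations \<Sigma>\<^sub>0 I\<^sub>0 \<phi> k \<Lambda>) \<and>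
    (one_dimensional (E_invariants \<Sigma>\<^sub>0 Q \<Lambda>) \<longrightarrow>
       bethe_eigenfunction \<Sigma>\<^sub>0 I\<^sub>0 k \<Lambda> \<in> E_invariants \<Sigma>\<^sub>0 Q \<Lambda> \<and>
       bethe_eigenfunction \<Sigma>\<^sub>0 I\<^sub>0 k \<Lambda> 0 = 1 \<and>
       (\<forall>g\<in>E_invariants \<Sigma>\<^sub>0 Q \<Lambda>. g 0 = 1 \<longrightarrow> g = bethe_eigenfunction \<Sigma>\<^sub>0 I\<^sub>0 k \<Lambda>))"
proof -
  have "linear \<Lambda>" using assms(8) by (simp add: complex_dual_def)
  then interpret bethe_data \<Sigma>\<^sub>0 I\<^sub>0 \<phi> k \<Lambda>
    by (intro bethe_data.intro root_data.intro bethe_data_axioms.intro assms)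
  let ?\<psi> = "bethe_eigenfunction \<Sigma>\<^sub>0 I\<^sub>0 k \<Lambda>"
  let ?good = "purely_imaginary \<Lambda> \<and> regular_value \<Sigma>\<^sub>0 \<Lambda> \<and> bethe_equations \<Sigma>\<^sub>0 I\<^sub>0 \<phi> k \<Lambda>"
  have E: "E_invariants \<Sigma>\<^sub>0 Q \<Lambda> = fixed_space"
    by (rule E_invariants_eq_fixed_space[OF assms(7)])
  show ?thesis
  proof (cases ?good)
    case True
    from fixed_space_cases(1)[OF True]
    have S: "fixed_space = {(\<lambda>x. c * ?\<psi> x) |c. True}" and \<psi>0: "?\<psi> 0 = 1" by blast+
    have "?\<psi> \<noteq> (\<lambda>v. 0)" using \<psi>0 by auto
    then have "one_dimensional fixed_space" unfolding one_dimensional_def using S by blast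
    moreover have "?\<psi> \<in> fixed_space" using multiple_in_fixed_space[of 1] True by simp
    moreover have "g = ?\<psi>" if "g \<in> fixed_space" "g 0 = 1" for g
      using that \<psi>0 unfolding S by auto
    ultimately show ?thesis unfolding E using True \<psi>0 by blast
  next
    case False
    then have S: "fixed_space = {\<lambda>x. 0}" by (rule fixed_space_cases(2))
    have "\<not> one_dimensional fixed_space"
    proof
      assume "one_dimensional fixed_space"
      then obtain f :: "'a \<Rightarrow> complex" where f: "f \<noteq> (\<lambda>v. 0)" "{\<lambda>x. 0} = {(\<lambda>v. c * f v) |c. True}"
        unfolding one_dimensional_def S by blast
      have "(\<lambda>v. 1 * f v) \<in> {\<lambda>x. 0}" unfolding f(2) by blast
      then have "f = (\<lambda>v. 0)" by simp
      then show False using f(1) by (rule notE[rotated])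
    qed
    then show ?thesis unfolding E using False S by (simp add: zero_dimensional_def)
  qed
qed

end
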